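(* Suppose $X_1,\dots,X_n$ are i.i.d. $N(0,\Sigma)$ in a separable Banach space $E$ with $\mathbf{r}(\Sigma)\lesssim n$. Let $f:L(E^{\ast},E)\to\mathbb{R}$ be a Fréchet continuously differentiable functional with the first derivative $f'$ satisfying the Hölder condition with exponent $\rho\in(0,1]$. Then $$\bigl\|f(\hat\Sigma_n)-f(\Sigma)-\langle\hat\Sigma_n-\Sigma,f'(\Sigma)\rangle\bigr\|_{L_{\psi_{1/(1+\rho)}}(\mathbb{P}_\Sigma)}\lesssim_\rho\|f'\|_{\mathrm{Lip}_\rho}\|\Sigma\|^{1+\rho}\Bigl(\sqrt{\tfrac{\mathbf{r}(\Sigma)}{n}}\Bigr)^{1+\rho}.$$
   Context: $E$ is a separable Banach space with dual $E^\ast$; $\langle x,u\rangle$ is the value of $u\in E^\ast$ at $x\in E$. $L(E^\ast,E)$ is the space of bounded linear operators $A:E^\ast\to E$ with the operator norm. $X\sim N(0,\Sigma)$ is a centered Gaussian random variable in $E$ with covariance operator $\Sigma u=\mathbb{E}\langle X,u\rangle X$. The sample covariance operator of i.i.d. copies $X_1,\dots,X_n$ is $\hat\Sigma_n u=n^{-1}\sum_{j=1}^n\langle X_j,u\rangle X_j$. The effective rank is $\mathbf{r}(\Sigma)=\mathbb{E}\|X\|^2/\|\Sigma\|$ (for $\Sigma\ne0$). $f'(\Sigma)$ is the Fréchet derivative, and $\langle H,f'(\Sigma)\rangle=f'(\Sigma)[H]$. $\|f'\|_{\mathrm{Lip}_\rho}=\sup_{A\ne B}\|f'(A)-f'(B)\|/\|A-B\|^\rho$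 with the dual norm in the numerator. For $\alpha>0$, $\|\eta\|_{L_{\psi_\alpha}(\mathbb{P}_\Sigma)}:=\sup_{p\ge1}p^{-1/\alpha}(\mathbb{E}_\Sigma|\eta|^p)^{1/p}$. $A\lesssim_\rho B$ means $A\le C_\rho B$ with a constant depending only on $\rho$. The assumption $\mathbf{r}(\Sigma)\lesssim n$ means $\mathbf{r}(\Sigma)\le C_0n$ for a numerical constant $C_0$; constants in the conclusion may depend on $C_0$. *)

theory Defs
  imports "HOL-Probability.Probability"
begin

text \<open>
  Throughout, a separable Banach space \<open>E\<close> is a type
  \<open>'a :: {banach, second_countable_topology}\<close>, its dual is \<open>'a \<Rightarrow>\<^sub>L real\<close>, and
  \<open>L(E*, E)\<close> with the operator norm is \<open>('a \<Rightarrow>\<^sub>L real) \<Rightarrow>\<^sub>L 'a\<close>.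
\<close>

text \<open>The variance may vanish; \<open>normal_density\<close> only makes sense for positive deviation.\<close>

definition centered_normal_real :: "real measure \<Rightarrow> bool" where
  "centered_normal_real \<nu> \<longleftrightarrow>
     \<nu> = return borel 0 \<or>
     (\<exists>\<sigma>>0. \<nu> = density lborel (\<lambda>x. ennreal (normal_density 0 \<sigma> x)))"

text \<open>
  \<open>normal_law \<Sigma> \<gamma>\<close>: the measure \<open>\<gamma>\<close> is the law \<open>N(0, \<Sigma>)\<close>. It is Gaussian in the
  sense that every continuous functional is a (possibly degenerate) centered normal
  variable, and \<open>\<Sigma> u\<close> is the Bochner integral of \<open>\<langle>x, u\<rangle> x\<close>.
\<close>

definition normal_law ::
  "(('a::{banach, second_countable_topology} \<Rightarrow>\<^sub>L real) \<Rightarrow>\<^sub>L 'a) \<Rightarrow> 'a measure \<Rightarrow> bool" where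
  "normal_law \<Sigma> \<gamma> \<longleftrightarrow>
     prob_space \<gamma> \<and> sets \<gamma> = sets borel \<and>
     (\<forall>u :: 'a \<Rightarrow>\<^sub>L real. centered_normal_real (distr \<gamma> borel (blinfun_apply u))) \<and>
     (\<forall>u :: 'a \<Rightarrow>\<^sub>L real.
        has_bochner_integral \<gamma> (\<lambda>x. blinfun_apply u x *\<^sub>R x) (blinfun_apply \<Sigma> u))"

definition effective_rank ::
  "(('a::{banach, second_countable_topology} \<Rightarrow>\<^sub>L real) \<Rightarrow>\<^sub>L 'a) \<Rightarrow> 'a measure \<Rightarrow> real" where
  "effective_rank \<Sigma> \<gamma> = (\<integral>x. (norm x)\<^sup>2 \<partial>\<gamma>) / norm \<Sigma>"

definition sample_cov ::
  "nat \<Rightarrow> (nat \<Rightarrow> 'b \<Rightarrow> 'a::real_normed_vector) \<Rightarrow> 'b \<Rightarrow> ('a \<Rightarrow>\<^sub>L real) \<Rightarrow>\<^sub>L 'a" where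
  "sample_cov n X \<omega> =
     Blinfun (\<lambda>u. (1 / real n) *\<^sub>R (\<Sum>j\<in>{1..n}. blinfun_apply u (X j \<omega>) *\<^sub>R X j \<omega>))"

lemma sample_cov_apply:
  "blinfun_apply (sample_cov n X \<omega>) u =
     (1 / real n) *\<^sub>R (\<Sum>j\<in>{1..n}. blinfun_apply u (X j \<omega>) *\<^sub>R X j \<omega>)"
proof -
  have "bounded_linear (\<lambda>u. (1 / real n) *\<^sub>R (\<Sum>j\<in>{1..n}. blinfun_apply u (X j \<omega>) *\<^sub>R X j \<omega>))"
    by (intro bounded_linear_const_scaleR bounded_linear_sum bounded_linear_scaleR_const
        blinfun.bounded_linear_left)
  then show ?thesis
    by (simp add: sample_cov_def bounded_linear_Blinfun_apply)
qed

definition hoelder_condition ::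
  "real \<Rightarrow> ('c::real_normed_vector \<Rightarrow> 'd::real_normed_vector) \<Rightarrow> bool" where
  "hoelder_condition \<rho> g \<longleftrightarrow>
     (\<exists>L. \<forall>A B. norm (g A - g B) \<le> L * norm (A - B) powr \<rho>)"

text \<open>Meaningful only under \<open>hoelder_condition \<rho> g\<close>, which makes the supremum finite.\<close>

definition lip_seminorm ::
  "real \<Rightarrow> ('c::real_normed_vector \<Rightarrow> 'd::real_normed_vector) \<Rightarrow> real" where
  "lip_seminorm \<rho> g =
     (SUP (A, B) \<in> {(A, B). A \<noteq> B}. norm (g A - g B) / norm (A - B) powr \<rho>)"

text \<open>
  Moments and Orlicz-type norms take values in \<open>[0, \<infinity>]\<close>, so that a finite bound on
  them includes finiteness of all moments involved.
\<close>

definition Lp_norm :: "'b measure \<Rightarrow> real \<Rightarrow> ('b \<Rightarrow> real) \<Rightarrow> ennreal" where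
  "Lp_norm M p \<eta> =
     (let m = (\<integral>\<^sup>+ \<omega>. ennreal (\<bar>\<eta> \<omega>\<bar> powr p) \<partial>M)
      in if m = \<infinity> then \<infinity> else ennreal (enn2real m powr (1 / p)))"

definition psi_norm :: "'b measure \<Rightarrow> real \<Rightarrow> ('b \<Rightarrow> real) \<Rightarrow> ennreal" where
  "psi_norm M \<alpha> \<eta> = (SUP p\<in>{1::real..}. ennreal (p powr (- 1 / \<alpha>)) * Lp_norm M p \<eta>)"

text \<open>
  An admissible value of the constant hidden in \<open>\<lesssim>\<close>, where \<open>C0\<close> is the constant
  in the assumption \<open>r(\<Sigma>) \<le> C0 n\<close>. It is given as a closed expression, because a constant
  existentially quantified inside a theorem that is polymorphic in \<open>E\<close> and in the
  probability space could depend on these types. The numeral is not optimal: if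
  \<open>A\<close> is a constant with
  \<open>(E \<parallel>\<Sigma>n - \<Sigma>\<parallel>\<^sup>q)\<^bsup>1/q\<^esup> \<le> A q \<parallel>\<Sigma>\<parallel> (sqrt (r / n) + r / n)\<close> for all \<open>q \<ge> 1\<close>,
  then \<open>(2 A (1 + sqrt C0)) powr (1 + \<rho>)\<close> suffices.
\<close>

definition remainder_const :: "real \<Rightarrow> real \<Rightarrow> real" where
  "remainder_const \<rho> C0 = (10 ^ 6 * (1 + C0)) powr (1 + \<rho>)"

end

theory Submission
  imports Defs
begin

text \<open>
  By the mean value theorem the remainder is at most \<open>lip_seminorm \<rho> f'\<close> times the
  operator norm of \<open>\<Sigma>n - \<Sigma>\<close> to the power \<open>1 + \<rho>\<close>, so it suffices to bound
  the \<open>q\<close>-th moment norm of this operator norm by a constant times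
  \<open>q \<parallel>\<Sigma>\<parallel> (sqrt (r / n) + r / n)\<close>. Rotation invariance decouples the quadratic forms
  into the bilinear chaos \<open>\<Sum>i. u (X i) * v (X' i)\<close> with an independent copy \<open>X'\<close>.
  Conditionally on \<open>X\<close> this is a Gaussian process in \<open>(u, v)\<close>, and the Sudakov-Fernique
  inequality bounds the mean of its maximum by a seminorm of \<open>X\<close>. The \<open>q\<close>-th moment norm of
  a Gaussian seminorm is at most a constant times \<open>sqrt q\<close> times its mean; using this once
  conditionally on \<open>X\<close> and once for \<open>X\<close> gives the linear growth in \<open>q\<close>.
  Sudakov-Fernique follows from Lindeberg replacement for the log-sum-exp function. Beyond
  one-dimensional moments, the only property of Gaussian families needed is that \<open>(a Z + b Z', b Z - a Z')\<close> has the law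
  of \<open>(Z, Z')\<close> if \<open>a\<^sup>2 + b\<^sup>2 = 1\<close>. All estimates are uniform over finite sets of functionals;
  a countable norming set and Fatou's lemma give the operator norm.
\<close>

section \<open>Determination of a law by its linear combinations\<close>

text \<open>\<open>normal_law\<close> gives integrability only after testing with a functional,
  while \<open>effective_rank\<close> contains the integral of the squared norm, which would be 0 by
  default if it diverged. Hence a weak form of Fernique's theorem is part of the proof; it comes
  from the doubling argument that also yields the moment growth. Doubling is why moments are bounded
  at powers of two only and interpolated at the end. The bound on the mean of the chaos is circular:
  it contains the mean of \<open>radius\<close>, whose square is at most \<open>n * norm S\<close>
  plus the mean deviation, which is again bounded by the chaos. A quadratic inequality resolves this
  and produces the term with \<open>r / n\<close>; the rank assumption then absorbs that term into
  \<open>sqrt (r / n)\<close>. Constants: each of the two uses of the Gaussian moment bound costs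
  20, decoupling 2, the split of the Chevet increments \<open>sqrt 2\<close>, together at most 1200.
  With \<open>2 + 5 * y \<le> 10 * (1 + C0)\<close> for \<open>y = sqrt (r / n)\<close> this becomes
  12000, and the passage to arbitrary exponents contributes 8; the product 96000 is below
  \<open>10 ^ 6\<close>.\<close>

lemma weighted_distr_char:
  fixes w g :: "'a \<Rightarrow> real"
  assumes "prob_space M" and [measurable]: "w \<in> borel_measurable M" "g \<in> borel_measurable M"
    and w: "\<And>x. 0 \<le> w x" "\<And>x. w x \<le> C"
    and c: "c = (\<integral>x. w x \<partial>M)" "c > 0"
  defines "D \<equiv> distr (density M (\<lambda>x. ennreal (w x / c))) borel g"
  shows "real_distribution D"
    and "char D t = (CLINT x|M. complex_of_real (w x) * iexp (t * g x)) / c"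
    and "B \<in> sets borel \<Longrightarrow> measure D B = (\<integral>x. w x * indicator B (g x) \<partial>M) / c"
proof -
  interpret prob_space M by fact
  have iw: "integrable M w"
    by (rule integrable_const_bound[where B=C]) (use w in auto)
  have "emeasure (density M (\<lambda>x. ennreal (w x / c))) (space M) = (\<integral>\<^sup>+x. ennreal (w x / c) \<partial>M)"
    by (simp add: emeasure_density cong: nn_integral_cong)
  also have "\<dots> = ennreal (\<integral>x. w x / c \<partial>M)"
    using iw w c by (intro nn_integral_eq_integral) auto
  also have "\<dots> = 1" using c by simp
  finally have "prob_space (density M (\<lambda>x. ennreal (w x / c)))"
    by (intro prob_spaceI) simp
  then interpret N: prob_space "density M (\<lambda>x. ennreal (w x / c))" .
  show rd: "real_distribution D"
    unfolding D_def by (rule N.real_distribution_distr) simp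
  then interpret D: real_distribution D .
  have "char D t = (CLINT x|density M (\<lambda>x. ennreal (w x / c)). iexp (t * g x))"
    unfolding char_def D_def by (rule integral_distr) auto
  also have "\<dots> = (CLINT x|M. (w x / c) *\<^sub>R iexp (t * g x))"
    using w c by (intro integral_density) auto
  also have "\<dots> = (CLINT x|M. (complex_of_real (w x) * iexp (t * g x)) / c)"
    by (intro Bochner_Integration.integral_cong) (auto simp: scaleR_conv_of_real)
  finally show "char D t = (CLINT x|M. complex_of_real (w x) * iexp (t * g x)) / c" by simp
  assume [measurable]: "B \<in> sets borel"
  have "measure D B = (\<integral>x. indicator B x \<partial>D)"
    unfolding D_def by simp
  also have "\<dots> = (\<integral>x. indicator B (g x) \<partial>density M (\<lambda>x. ennreal (w x / c)))"
    unfolding D_def by (rule integral_distr) auto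
  also have "\<dots> = (\<integral>x. (w x / c) *\<^sub>R indicator B (g x) \<partial>M)"
    using w c by (intro integral_density) auto
  also have "\<dots> = (\<integral>x. (w x * indicator B (g x)) / c \<partial>M)"
    by (intro Bochner_Integration.integral_cong) auto
  finally show "measure D B = (\<integral>x. w x * indicator B (g x) \<partial>M) / c" by simp
qed

text \<open>Levy's uniqueness theorem for finite measures: \<open>t = 0\<close> shows that both
  weights have the same total mass \<open>c\<close>, and division by \<open>c\<close> reduces to
  probability laws. For \<open>c = 0\<close> both weights vanish almost everywhere. In
  \<open>cramer_wold\<close> the weights carry all coordinates but one.\<close>

lemma weighted_Levy_uniqueness:
  fixes w1 g1 :: "'a \<Rightarrow> real" and w2 g2 :: "'b \<Rightarrow> real"
  assumes M: "prob_space M1" "prob_space M2"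
    and [measurable]: "w1 \<in> borel_measurable M1" "g1 \<in> borel_measurable M1"
      "w2 \<in> borel_measurable M2" "g2 \<in> borel_measurable M2"
    and w1: "\<And>x. 0 \<le> w1 x" "\<And>x. w1 x \<le> C" and w2: "\<And>x. 0 \<le> w2 x" "\<And>x. w2 x \<le> C"
    and eq: "\<And>t. (CLINT x|M1. complex_of_real (w1 x) * iexp (t * g1 x))
                = (CLINT x|M2. complex_of_real (w2 x) * iexp (t * g2 x))"
    and B: "B \<in> sets borel"
  shows "(\<integral>x. w1 x * indicator B (g1 x) \<partial>M1) = (\<integral>x. w2 x * indicator B (g2 x) \<partial>M2)"
proof -
  interpret M1: prob_space M1 by fact
  interpret M2: prob_space M2 by fact
  have i1: "integrable M1 w1"
    by (rule M1.integrable_const_bound[where B=C]) (use w1 in auto)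
  have i2: "integrable M2 w2"
    by (rule M2.integrable_const_bound[where B=C]) (use w2 in auto)
  define c where "c = (\<integral>x. w1 x \<partial>M1)"
  have c2: "c = (\<integral>x. w2 x \<partial>M2)"
    using eq[of 0] unfolding c_def by simp
  have "c \<ge> 0" unfolding c_def using w1 by simp
  show ?thesis
  proof (cases "c = 0")
    case True
    have "AE x in M1. w1 x = 0"
      using integral_nonneg_eq_0_iff_AE[OF i1] w1 True c_def by auto
    then have "(\<integral>x. w1 x * indicator B (g1 x) \<partial>M1) = 0"
      by (intro integral_eq_zero_AE) auto
    moreover have "AE x in M2. w2 x = 0"
      using integral_nonneg_eq_0_iff_AE[OF i2] w2 True c2 by auto
    then have "(\<integral>x. w2 x * indicator B (g2 x) \<partial>M2) = 0"
      by (intro integral_eq_zero_AE) auto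
    ultimately show ?thesis by simp
  next
    case False
    then have cp: "c > 0" using \<open>c \<ge> 0\<close> by simp
    note * = weighted_distr_char[OF M(1) _ _ w1 c_def cp, of g1]
    note ** = weighted_distr_char[OF M(2) _ _ w2 c2 cp, of g2]
    have "distr (density M1 (\<lambda>x. ennreal (w1 x / c))) borel g1
        = distr (density M2 (\<lambda>x. ennreal (w2 x / c))) borel g2"
    proof (rule Levy_uniqueness)
      show "char (distr (density M1 (\<lambda>x. ennreal (w1 x / c))) borel g1)
        = char (distr (density M2 (\<lambda>x. ennreal (w2 x / c))) borel g2)"
        by (rule ext) (simp only: *(2) **(2) assms(3-6) eq)
    qed (auto intro!: * **)
    then show ?thesis
      using *(3)[OF _ _ B] **(3)[OF _ _ B] cp by simp
  qed
qed

text \<open>Rewrites \<open>t * x l + s * v\<close>, with \<open>v\<close> a linear combination, as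
  a linear combination over \<open>K\<close>, so that the induction hypothesis of
  \<open>cramer_wold\<close> applies to it; \<open>s = 0\<close> extracts one coordinate.\<close>

lemma sum_single_plus:
  fixes x c :: "'k \<Rightarrow> real"
  assumes "finite K" "l \<in> K"
  shows "(\<Sum>k\<in>K. ((if k = l then t else 0) + s * c k) * x k) = t * x l + s * (\<Sum>k\<in>K. c k * x k)"
proof -
  have "(\<Sum>k\<in>K. ((if k = l then t else 0) + s * c k) * x k)
      = (\<Sum>k\<in>K. if k = l then t * x k else 0) + s * (\<Sum>k\<in>K. c k * x k)"
    unfolding sum_distrib_left sum.distrib[symmetric] by (intro sum.cong) (auto simp: algebra_simps)
  then show ?thesis using assms by simp
qed

lemma norm_of_real_iexp: "cmod (complex_of_real p * iexp a) = \<bar>p\<bar>"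
  by (simp add: norm_mult)

lemma weight_bounds:
  fixes p a :: real
  assumes "0 \<le> p" "p \<le> 1" "- 1 \<le> a" "a \<le> 1"
  shows "0 \<le> p * (1 + a)" "p * (1 + a) \<le> 2"
  using mult_mono[of p 1 "1 + a" 2] assms by auto

lemma indicator_PiE_restrict:
  assumes "finite K"
  shows "indicator (Pi\<^sub>E K A) (\<lambda>k\<in>K. f k) = (\<Prod>k\<in>K. indicator (A k) (f k) :: real)"
proof (cases "\<forall>k\<in>K. f k \<in> A k")
  case True
  then show ?thesis by (simp add: PiE_iff)
next
  case False
  then obtain k where "k \<in> K" "f k \<notin> A k" by blast
  then have "(\<Prod>k\<in>K. indicator (A k) (f k) :: real) = 0"
    using assms by (intro prod_zero) (auto intro!: bexI[of _ k])
  moreover have "indicator (Pi\<^sub>E K A) (restrict f K) = (0::real)"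
    using \<open>k \<in> K\<close> \<open>f k \<notin> A k\<close> by (intro indicator_simps(2)) (auto simp: PiE_iff)
  ultimately show ?thesis by simp
qed

lemma emeasure_distr_restrict_PiE:
  assumes "prob_space M" "finite K" "\<And>k. k \<in> K \<Longrightarrow> X k \<in> borel_measurable M"
    and "\<And>k. k \<in> K \<Longrightarrow> A k \<in> sets borel"
  shows "emeasure (distr M (Pi\<^sub>M K (\<lambda>_. borel)) (\<lambda>x. \<lambda>k\<in>K. X k x)) (Pi\<^sub>E K A)
    = ennreal (\<integral>x. (\<Prod>k\<in>K. indicator (A k) (X k x)) \<partial>M)"
proof -
  interpret prob_space M by fact
  have X: "(\<lambda>x. \<lambda>k\<in>K. X k x) \<in> measurable M (Pi\<^sub>M K (\<lambda>_. borel))"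
    using assms by (intro measurable_restrict) auto
  have ms: "Pi\<^sub>E K A \<in> sets (Pi\<^sub>M K (\<lambda>_. borel))"
    using assms by (intro sets_PiM_I_finite) auto
  interpret D: prob_space "distr M (Pi\<^sub>M K (\<lambda>_. borel)) (\<lambda>x. \<lambda>k\<in>K. X k x)"
    by (rule prob_space_distr[OF X])
  have "D.prob (Pi\<^sub>E K A) = D.expectation (indicator (Pi\<^sub>E K A))"
    using ms by simp
  also have "\<dots> = (\<integral>x. indicator (Pi\<^sub>E K A) (\<lambda>k\<in>K. X k x) \<partial>M)"
    by (rule integral_distr[OF X]) (use ms in simp)
  finally show ?thesis
    unfolding D.emeasure_eq_measure indicator_PiE_restrict[OF assms(2)] by simp
qed

text \<open>Induction on the set \<open>L\<close> of coordinates that already appear through an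
  event. One-dimensional uniqueness in the coordinate \<open>l\<close> trades the frequencies
  \<open>t\<close> of \<open>X l\<close> for the indicator of \<open>B l\<close>, while the earlier
  indicators and the remaining exponential act as a weight. At \<open>L = K\<close> equality on
  rectangles is reached.\<close>

lemma cramer_wold:
  fixes X :: "'k \<Rightarrow> 'a \<Rightarrow> real" and Y :: "'k \<Rightarrow> 'b \<Rightarrow> real"
  assumes M: "prob_space M1" "prob_space M2" and K: "finite K"
    and X[measurable]: "\<And>k. k \<in> K \<Longrightarrow> X k \<in> borel_measurable M1"
    and Y[measurable]: "\<And>k. k \<in> K \<Longrightarrow> Y k \<in> borel_measurable M2"
    and eq: "\<And>c. (CLINT x|M1. iexp (\<Sum>k\<in>K. c k * X k x)) = (CLINT x|M2. iexp (\<Sum>k\<in>K. c k * Y k x))"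
  shows "distr M1 (Pi\<^sub>M K (\<lambda>_. borel)) (\<lambda>x. \<lambda>k\<in>K. X k x) =
         distr M2 (Pi\<^sub>M K (\<lambda>_. borel)) (\<lambda>x. \<lambda>k\<in>K. Y k x)"
proof -
  interpret M1: prob_space M1 by fact
  interpret M2: prob_space M2 by fact
  have main: "(CLINT x|M1. complex_of_real (\<Prod>k\<in>L. indicator (B k) (X k x)) * iexp (\<Sum>k\<in>K. c k * X k x))
      = (CLINT x|M2. complex_of_real (\<Prod>k\<in>L. indicator (B k) (Y k x)) * iexp (\<Sum>k\<in>K. c k * Y k x))"
    if "finite L" "L \<subseteq> K" "\<And>k. k \<in> K \<Longrightarrow> B k \<in> sets borel" for L c B
    using that(1,2)
  proof (induction L arbitrary: c)
    case empty
    then show ?case using eq by simp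
  next
    case (insert l L)
    note [measurable] = that(3)
    define p1 where "p1 x = (\<Prod>k\<in>L. indicator (B k) (X k x) :: real)" for x
    define p2 where "p2 x = (\<Prod>k\<in>L. indicator (B k) (Y k x) :: real)" for x
    have [measurable]: "p1 \<in> borel_measurable M1" "p2 \<in> borel_measurable M2"
      unfolding p1_def p2_def using insert.prems by (auto intro!: borel_measurable_prod)
    have p1: "0 \<le> p1 x" "p1 x \<le> 1" and p2: "0 \<le> p2 y" "p2 y \<le> 1" for x y
      unfolding p1_def p2_def by (auto intro!: prod_nonneg prod_le_1)
    have l: "l \<in> K" using insert.prems by simp
    have [measurable]: "X l \<in> borel_measurable M1" "Y l \<in> borel_measurable M2" "B l \<in> sets borel"
      using l by auto
    have IH: "(CLINT x|M1. complex_of_real (p1 x) * iexp (\<Sum>k\<in>K. d k * X k x))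
      = (CLINT x|M2. complex_of_real (p2 x) * iexp (\<Sum>k\<in>K. d k * Y k x))" for d
      unfolding p1_def p2_def using insert.IH insert.prems by simp
    define v1 where "v1 x = (\<Sum>k\<in>K. c k * X k x)" for x
    define v2 where "v2 x = (\<Sum>k\<in>K. c k * Y k x)" for x
    have [measurable]: "v1 \<in> borel_measurable M1" "v2 \<in> borel_measurable M2"
      unfolding v1_def v2_def by (auto intro!: borel_measurable_sum borel_measurable_times)
    have IHt: "(CLINT x|M1. complex_of_real (p1 x) * iexp (t * X l x + s * v1 x))
      = (CLINT x|M2. complex_of_real (p2 x) * iexp (t * Y l x + s * v2 x))" for t s
    proof -
      have "(\<Sum>k\<in>K. ((if k = l then t else 0) + s * c k) * X k x) = t * X l x + s * v1 x" for x
        unfolding v1_def using sum_single_plus[OF K l] by simp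
      moreover have "(\<Sum>k\<in>K. ((if k = l then t else 0) + s * c k) * Y k x) = t * Y l x + s * v2 x" for x
        unfolding v2_def using sum_single_plus[OF K l] by simp
      ultimately show ?thesis using IH[of "\<lambda>k. (if k = l then t else 0) + s * c k"] by simp
    qed
    have int1: "integrable M1 (\<lambda>x. complex_of_real (p1 x) * iexp (t * X l x + s * v1 x))" for t s
      by (rule M1.integrable_const_bound[where B=1]) (use p1 in \<open>simp_all only: norm_of_real_iexp abs_of_nonneg eventually_True simp_thms, measurable\<close>)
    have int2: "integrable M2 (\<lambda>x. complex_of_real (p2 x) * iexp (t * Y l x + s * v2 x))" for t s
      by (rule M2.integrable_const_bound[where B=1]) (use p2 in \<open>simp_all only: norm_of_real_iexp abs_of_nonneg eventually_True simp_thms, measurable\<close>)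
    have cosr: "complex_of_real (cos v) = (iexp v + iexp (- v)) / 2" for v
      using cos_exp_eq[of "complex_of_real v"] by (simp add: cos_of_real)
    have sinr: "complex_of_real (sin v) = (iexp v - iexp (- v)) / (2 * \<i>)" for v
      using sin_exp_eq[of "complex_of_real v"] by (simp add: sin_of_real)
    \<comment> \<open>A complex exponential is no admissible weight. \<open>1 + cos v\<close> and
      \<open>1 + sin v\<close> are nonnegative and are combinations of exponentials with frequencies
      0, 1 and -1, all of which \<open>IHt\<close> covers.\<close>
    have split_cos: "complex_of_real (p * (1 + cos v)) * iexp a =
        of_real p * iexp (a + 0 * v) + (of_real p * iexp (a + 1 * v) + of_real p * iexp (a + (-1) * v)) / 2" for p v a
      unfolding of_real_mult of_real_add cosr by (simp add: field_simps exp_add exp_diff exp_minus)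
    have split_sin: "complex_of_real (p * (1 + sin v)) * iexp a =
        of_real p * iexp (a + 0 * v) + (of_real p * iexp (a + 1 * v) - of_real p * iexp (a + (-1) * v)) / (2 * \<i>)" for p v a
      unfolding of_real_mult of_real_add sinr by (simp add: field_simps exp_add exp_diff exp_minus)
    have ms1: "X l \<in> borel_measurable M1" "(\<lambda>x. p1 x * (1 + cos (v1 x))) \<in> borel_measurable M1"
      "(\<lambda>x. p1 x * (1 + sin (v1 x))) \<in> borel_measurable M1" "p1 \<in> borel_measurable M1"
      by measurable
    have ms2: "Y l \<in> borel_measurable M2" "(\<lambda>x. p2 x * (1 + cos (v2 x))) \<in> borel_measurable M2"
      "(\<lambda>x. p2 x * (1 + sin (v2 x))) \<in> borel_measurable M2" "p2 \<in> borel_measurable M2"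
      by measurable
    have Bl: "B l \<in> sets borel" by measurable
    have C: "(\<integral>x. (p1 x * (1 + cos (v1 x))) * indicator (B l) (X l x) \<partial>M1)
        = (\<integral>x. (p2 x * (1 + cos (v2 x))) * indicator (B l) (Y l x) \<partial>M2)"
    proof (rule weighted_Levy_uniqueness[where C=2, OF M _ ms1(1) _ ms2(1) _ _ _ _ _ Bl])
      show "0 \<le> p1 x * (1 + cos (v1 x))" for x by (intro weight_bounds p1 cos_ge_minus_one cos_le_one)
      show "0 \<le> p2 x * (1 + cos (v2 x))" for x by (intro weight_bounds p2 cos_ge_minus_one cos_le_one)
      show "p1 x * (1 + cos (v1 x)) \<le> 2" for x by (intro weight_bounds p1 cos_ge_minus_one cos_le_one)
      show "p2 x * (1 + cos (v2 x)) \<le> 2" for x by (intro weight_bounds p2 cos_ge_minus_one cos_le_one)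
      show "(CLINT x|M1. complex_of_real (p1 x * (1 + cos (v1 x))) * iexp (t * X l x)) =
         (CLINT x|M2. complex_of_real (p2 x * (1 + cos (v2 x))) * iexp (t * Y l x))" for t
        unfolding split_cos
        using Bochner_Integration.integral_add[OF int1[of t 0] integrable_divide_zero[of 2, OF Bochner_Integration.integrable_add[OF int1[of t 1] int1[of t "-1"]]]]
          Bochner_Integration.integral_add[OF int2[of t 0] integrable_divide_zero[of 2, OF Bochner_Integration.integrable_add[OF int2[of t 1] int2[of t "-1"]]]]
          Bochner_Integration.integral_add[OF int1[of t 1] int1[of t "-1"]] Bochner_Integration.integral_add[OF int2[of t 1] int2[of t "-1"]]
        unfolding integral_divide_zero IHt by (simp only:)
    qed (fact ms1 ms2)+
    have S: "(\<integral>x. (p1 x * (1 + sin (v1 x))) * indicator (B l) (X l x) \<partial>M1)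
        = (\<integral>x. (p2 x * (1 + sin (v2 x))) * indicator (B l) (Y l x) \<partial>M2)"
    proof (rule weighted_Levy_uniqueness[where C=2, OF M _ ms1(1) _ ms2(1) _ _ _ _ _ Bl])
      show "0 \<le> p1 x * (1 + sin (v1 x))" for x by (intro weight_bounds p1 sin_ge_minus_one sin_le_one)
      show "0 \<le> p2 x * (1 + sin (v2 x))" for x by (intro weight_bounds p2 sin_ge_minus_one sin_le_one)
      show "p1 x * (1 + sin (v1 x)) \<le> 2" for x by (intro weight_bounds p1 sin_ge_minus_one sin_le_one)
      show "p2 x * (1 + sin (v2 x)) \<le> 2" for x by (intro weight_bounds p2 sin_ge_minus_one sin_le_one)
      show "(CLINT x|M1. complex_of_real (p1 x * (1 + sin (v1 x))) * iexp (t * X l x)) =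
         (CLINT x|M2. complex_of_real (p2 x * (1 + sin (v2 x))) * iexp (t * Y l x))" for t
        unfolding split_sin
        using Bochner_Integration.integral_add[OF int1[of t 0] integrable_divide_zero[of "2 * \<i>", OF Bochner_Integration.integrable_diff[OF int1[of t 1] int1[of t "-1"]]]]
          Bochner_Integration.integral_add[OF int2[of t 0] integrable_divide_zero[of "2 * \<i>", OF Bochner_Integration.integrable_diff[OF int2[of t 1] int2[of t "-1"]]]]
          Bochner_Integration.integral_diff[OF int1[of t 1] int1[of t "-1"]] Bochner_Integration.integral_diff[OF int2[of t 1] int2[of t "-1"]]
        unfolding integral_divide_zero IHt by (simp only:)
    qed (fact ms1 ms2)+
    \<comment> \<open>The summand 1 in the two previous weights, treated alone; its removal from
      \<open>C\<close> and \<open>S\<close> leaves the real and the imaginary part of the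
      exponential.\<close>
    have O: "(\<integral>x. p1 x * indicator (B l) (X l x) \<partial>M1) = (\<integral>x. p2 x * indicator (B l) (Y l x) \<partial>M2)"
    proof (rule weighted_Levy_uniqueness[where C=1, OF M _ ms1(1) _ ms2(1) _ _ _ _ _ Bl])
      show "(CLINT x|M1. complex_of_real (p1 x) * iexp (t * X l x)) =
         (CLINT x|M2. complex_of_real (p2 x) * iexp (t * Y l x))" for t
        using IHt[of t 0] by simp
    qed (fact ms1 ms2 p1 p2)+
    define q1 where "q1 x = p1 x * indicator (B l) (X l x)" for x
    define q2 where "q2 x = p2 x * indicator (B l) (Y l x)" for x
    have [measurable]: "q1 \<in> borel_measurable M1" "q2 \<in> borel_measurable M2"
      unfolding q1_def q2_def by measurable
    have q: "\<bar>q1 x\<bar> \<le> 1" "\<bar>q2 y\<bar> \<le> 1" for x y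
      using p1[of x] p2[of y] by (auto simp: q1_def q2_def indicator_def)
    have b1: "\<bar>q1 x * a\<bar> \<le> 1" if "\<bar>a\<bar> \<le> 1" for x a
      using q(1)[of x] that by (simp add: abs_mult mult_le_one)
    have b2: "\<bar>q2 x * a\<bar> \<le> 1" if "\<bar>a\<bar> \<le> 1" for x a
      using q(2)[of x] that by (simp add: abs_mult mult_le_one)
    have i1: "integrable M1 q1" "integrable M1 (\<lambda>x. q1 x * cos (v1 x))" "integrable M1 (\<lambda>x. q1 x * sin (v1 x))"
      by (rule M1.integrable_const_bound[where B=1]; auto intro!: b1 q)+
    have i2: "integrable M2 q2" "integrable M2 (\<lambda>x. q2 x * cos (v2 x))" "integrable M2 (\<lambda>x. q2 x * sin (v2 x))"
      by (rule M2.integrable_const_bound[where B=1]; auto intro!: b2 q)+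
    have C': "(\<integral>x. q1 x * cos (v1 x) \<partial>M1) = (\<integral>x. q2 x * cos (v2 x) \<partial>M2)"
    proof -
      have "(\<integral>x. q1 x + q1 x * cos (v1 x) \<partial>M1) = (\<integral>x. q2 x + q2 x * cos (v2 x) \<partial>M2)"
        using C by (simp add: q1_def q2_def algebra_simps)
      then show ?thesis using O i1 i2 by (simp add: q1_def[symmetric] q2_def[symmetric])
    qed
    have S': "(\<integral>x. q1 x * sin (v1 x) \<partial>M1) = (\<integral>x. q2 x * sin (v2 x) \<partial>M2)"
    proof -
      have "(\<integral>x. q1 x + q1 x * sin (v1 x) \<partial>M1) = (\<integral>x. q2 x + q2 x * sin (v2 x) \<partial>M2)"
        using S by (simp add: q1_def q2_def algebra_simps)
      then show ?thesis using O i1 i2 by (simp add: q1_def[symmetric] q2_def[symmetric])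
    qed
    have e: "complex_of_real q * iexp v = of_real (q * cos v) + \<i> * of_real (q * sin v)" for q v
      by (simp add: exp_Euler cos_of_real sin_of_real algebra_simps)
    have "(CLINT x|M1. complex_of_real (q1 x) * iexp (v1 x)) = (CLINT x|M2. complex_of_real (q2 x) * iexp (v2 x))"
      unfolding e using i1 i2 C' S'
      by (simp add: integrable_of_real del: of_real_mult)
    moreover have "(\<Prod>k\<in>insert l L. indicator (B k) (X k x)) = q1 x" for x
      using insert.hyps by (simp add: q1_def p1_def)
    moreover have "(\<Prod>k\<in>insert l L. indicator (B k) (Y k x)) = q2 x" for x
      using insert.hyps by (simp add: q2_def p2_def)
    ultimately show ?case
      unfolding v1_def v2_def by (simp only:)
  qed
  have X'[measurable]: "(\<lambda>x. \<lambda>k\<in>K. X k x) \<in> measurable M1 (Pi\<^sub>M K (\<lambda>_. borel))"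
    by (intro measurable_restrict) auto
  have Y'[measurable]: "(\<lambda>x. \<lambda>k\<in>K. Y k x) \<in> measurable M2 (Pi\<^sub>M K (\<lambda>_. borel))"
    by (intro measurable_restrict) auto
  show ?thesis
  proof (rule measure_eqI_PiM_finite[OF K])
    fix A :: "'k \<Rightarrow> real set" assume A: "\<And>k. k \<in> K \<Longrightarrow> A k \<in> sets borel"
    \<comment> \<open>With \<open>L = K\<close> and all coefficients zero the exponential
      disappears, and rectangles determine a measure on the finite product.\<close>
    have "complex_of_real (\<integral>x. (\<Prod>k\<in>K. indicator (A k) (X k x)) \<partial>M1)
       = complex_of_real (\<integral>x. (\<Prod>k\<in>K. indicator (A k) (Y k x)) \<partial>M2)"
      using main[of K A "\<lambda>_. 0", OF K order_refl A]
      unfolding integral_complex_of_real[symmetric] by (simp only: mult_zero_left sum.neutral_const of_real_0 mult_zero_right exp_zero mult_1_right)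
    then show "emeasure (distr M1 (Pi\<^sub>M K (\<lambda>_. borel)) (\<lambda>x. \<lambda>k\<in>K. X k x)) (Pi\<^sub>E K A)
       = emeasure (distr M2 (Pi\<^sub>M K (\<lambda>_. borel)) (\<lambda>x. \<lambda>k\<in>K. Y k x)) (Pi\<^sub>E K A)"
      using emeasure_distr_restrict_PiE[of M1 K X A, OF M(1) K X A]
        emeasure_distr_restrict_PiE[of M2 K Y A, OF M(2) K Y A]
      by (simp only: of_real_eq_iff)
  next
    show "range (\<lambda>_::nat. Pi\<^sub>E K (\<lambda>_. UNIV::real set)) \<subseteq> prod_algebra K (\<lambda>_. borel)"
      using K by (auto intro!: prod_algebraI_finite)
    show "emeasure (distr M1 (Pi\<^sub>M K (\<lambda>_. borel)) (\<lambda>x. \<lambda>k\<in>K. X k x)) (Pi\<^sub>E K (\<lambda>_. UNIV)) \<noteq> \<infinity>"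
      using finite_measure.emeasure_finite[OF prob_space.finite_measure[OF M1.prob_space_distr[OF X']]] by simp
  qed (auto simp: space_PiM)
qed

section \<open>Normal variables and Gaussian families\<close>

text \<open>Encoding the law by its characteristic function treats the degenerate variance
  \<open>q = 0\<close> like any other and turns independent sums into products.\<close>

definition normal_rv :: "'b measure \<Rightarrow> real \<Rightarrow> ('b \<Rightarrow> real) \<Rightarrow> bool" where
  "normal_rv M q f \<longleftrightarrow> f \<in> borel_measurable M \<and> 0 \<le> q \<and>
     (\<forall>t. (CLINT x|M. iexp (t * f x)) = exp (- (q * t\<^sup>2) / 2))"

lemma normal_distribution_affine:
  assumes "\<sigma> > 0"
  shows "density lborel (\<lambda>x. ennreal (normal_density 0 \<sigma> x)) = distr std_normal_distribution borel (\<lambda>x. \<sigma> * x)"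
proof -
  interpret prob_space std_normal_distribution by (rule prob_space_normal_density) simp
  have "distributed std_normal_distribution lborel (\<lambda>x. x) std_normal_density"
    by (auto simp: distributed_def distr_id2)
  then have "distributed std_normal_distribution lborel (\<lambda>x. 0 + \<sigma> * x) (normal_density (0 + \<sigma> * 0) (\<bar>\<sigma>\<bar> * 1))"
    using assms by (intro normal_density_affine) auto
  then have "distr std_normal_distribution lborel (\<lambda>x. \<sigma> * x) = density lborel (\<lambda>x. ennreal (normal_density 0 \<sigma> x))"
    using assms by (simp add: distributed_def)
  moreover have "distr std_normal_distribution lborel (\<lambda>x. \<sigma> * x) = distr std_normal_distribution borel (\<lambda>x. \<sigma> * x)"
    by (rule distr_cong) auto
  ultimately show ?thesis by simp
qed

lemma real_distribution_normal:
  assumes "\<sigma> > 0"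
  shows "real_distribution (density lborel (\<lambda>x. ennreal (normal_density 0 \<sigma> x)))"
  using prob_space_normal_density[OF assms, of 0]
  by (auto simp: real_distribution_def real_distribution_axioms_def)

lemma char_normal:
  assumes "\<sigma> > 0"
  shows "char (density lborel (\<lambda>x. ennreal (normal_density 0 \<sigma> x))) t = exp (- (\<sigma>\<^sup>2 * t\<^sup>2) / 2)"
proof -
  have "char (density lborel (\<lambda>x. ennreal (normal_density 0 \<sigma> x))) t
      = (CLINT x|std_normal_distribution. iexp (t * (\<sigma> * x)))"
    unfolding normal_distribution_affine[OF assms] char_def
    by (rule integral_distr) auto
  also have "\<dots> = char std_normal_distribution (t * \<sigma>)"
    unfolding char_def by (simp add: mult.assoc)
  finally show ?thesis
    unfolding char_std_normal_distribution by (simp add: power_mult_distrib mult.commute)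
qed

lemma char_distr:
  assumes "f \<in> borel_measurable M"
  shows "char (distr M borel f) t = (CLINT x|M. iexp (t * f x))"
  unfolding char_def by (rule integral_distr) (use assms in auto)

lemma (in prob_space) normal_rv_centered:
  assumes "f \<in> borel_measurable M" "centered_normal_real (distr M borel f)"
  shows "\<exists>q. normal_rv M q f"
  using assms(2) unfolding centered_normal_real_def
proof
  assume "distr M borel f = return borel 0"
  then have "(CLINT x|M. iexp (t * f x)) = 1" for t
    using char_distr[OF assms(1), of t] by (simp add: char_def integral_return)
  then show ?thesis using assms(1) by (intro exI[of _ 0]) (simp add: normal_rv_def)
next
  assume "\<exists>\<sigma>>0. distr M borel f = density lborel (\<lambda>x. ennreal (normal_density 0 \<sigma> x))"
  then obtain \<sigma> where s: "\<sigma> > 0" "distr M borel f = density lborel (\<lambda>x. ennreal (normal_density 0 \<sigma> x))"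
    by blast
  then show ?thesis
    using char_distr[OF assms(1)] char_normal[OF s(1)] assms(1)
    by (intro exI[of _ "\<sigma>\<^sup>2"]) (simp add: normal_rv_def)
qed

text \<open>Levy uniqueness leads back from the characteristic function to the density, from which
  \<open>normal_rv_moments\<close> computes moments.\<close>

lemma (in prob_space) normal_rv_distr:
  assumes "normal_rv M q f"
  shows "distr M borel f = (if q = 0 then return borel 0
           else density lborel (\<lambda>x. ennreal (normal_density 0 (sqrt q) x)))"
proof -
  have f: "f \<in> borel_measurable M" "0 \<le> q" using assms by (auto simp: normal_rv_def)
  have c: "char (distr M borel f) = (\<lambda>t. exp (- (q * t\<^sup>2) / 2))"
    using assms unfolding char_distr[OF f(1)] by (auto simp: normal_rv_def)
  show ?thesis
  proof (cases "q = 0")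
    case True
    have "real_distribution (return borel (0::real))"
      by (simp add: real_distribution_def real_distribution_axioms_def prob_space_return)
    moreover have "char (return borel 0) = (\<lambda>t. exp (- (q * t\<^sup>2) / 2))"
      using True by (auto simp: char_def integral_return)
    ultimately show ?thesis
      using True Levy_uniqueness[OF real_distribution_distr[OF f(1)]] c by auto
  next
    case False
    then have s: "sqrt q > 0" using f by simp
    have "char (density lborel (\<lambda>x. ennreal (normal_density 0 (sqrt q) x))) = (\<lambda>t. exp (- (q * t\<^sup>2) / 2))"
      by (rule ext) (use f char_normal[OF s] in simp)
    then show ?thesis
      using False Levy_uniqueness[OF real_distribution_distr[OF f(1)] real_distribution_normal[OF s]] c
      by auto
  qed
qed

lemma (in prob_space) normal_rv_moments:
  assumes "normal_rv M q f"
  shows "integrable M (\<lambda>x. \<bar>f x\<bar> ^ p)" "integrable M f" "expectation f = 0"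
    "expectation (\<lambda>x. (f x)\<^sup>2) = q"
proof -
  have f[measurable]: "f \<in> borel_measurable M" "0 \<le> q" using assms by (auto simp: normal_rv_def)
  note d = normal_rv_distr[OF assms]
  have *: "integrable (distr M borel f) (\<lambda>x. \<bar>x\<bar> ^ p) \<and> integrable (distr M borel f) (\<lambda>x. x) \<and>
     (\<integral>x. x \<partial>distr M borel f) = 0 \<and> (\<integral>x. x\<^sup>2 \<partial>distr M borel f) = q"
  proof (cases "q = 0")
    case True
    have i: "integrable (return borel 0) h" if [measurable]: "h \<in> borel_measurable borel" for h :: "real \<Rightarrow> real"
    proof (rule integrableI_bounded)
      have "(\<integral>\<^sup>+x. ennreal (norm (h x)) \<partial>return borel 0) = ennreal (norm (h 0))"
        by (rule nn_integral_return) auto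
      then show "(\<integral>\<^sup>+x. ennreal (norm (h x)) \<partial>return borel 0) < \<infinity>" by simp
    qed simp
    have "(\<integral>x. x \<partial>return borel (0::real)) = 0" "(\<integral>x. x\<^sup>2 \<partial>return borel (0::real)) = 0"
      by (simp_all add: integral_return)
    moreover have "integrable (return borel (0::real)) (\<lambda>x. \<bar>x\<bar> ^ p)" "integrable (return borel (0::real)) (\<lambda>x. x)"
      by (rule i, measurable)+
    moreover have "distr M borel f = return borel 0" using d by (simp only: True refl if_True)
    ultimately show ?thesis
      using True by (simp only: simp_thms)
  next
    case False
    then have s: "sqrt q > 0" using f by simp
    have d': "distr M borel f = density lborel (\<lambda>x. ennreal (normal_density 0 (sqrt q) x))"
      using d False by simp
    show ?thesis
      unfolding d' using integrable_normal_moment_abs[OF s, of 0 p] integrable_normal_moment_nz_1[OF s, of 0]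
        integral_normal_moment_nz_1[OF s, of 0] integral_normal_moment_even[OF s, of 0 1] s f(2)
      by (simp add: integrable_density integral_density)
  qed
  show "integrable M (\<lambda>x. \<bar>f x\<bar> ^ p)" using * by (subst (asm) integrable_distr_eq) auto
  show "integrable M f" using * by (subst (asm) (2) integrable_distr_eq) auto
  show "expectation f = 0" using * by (subst (asm) (1) integral_distr) auto
  show "expectation (\<lambda>x. (f x)\<^sup>2) = q" using * by (subst (asm) (2) integral_distr) auto
qed

lemma normal_rv_pair_add:
  assumes "prob_space M" "prob_space N" "normal_rv M q f" "normal_rv N r g"
  shows "normal_rv (M \<Otimes>\<^sub>M N) (q + r) (\<lambda>z. f (fst z) + g (snd z))"
proof -
  interpret M: prob_space M by fact
  interpret N: prob_space N by fact
  interpret pair_prob_space M N ..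
  have [measurable]: "f \<in> borel_measurable M" "g \<in> borel_measurable N"
    using assms by (auto simp: normal_rv_def)
  have "(CLINT z|M \<Otimes>\<^sub>M N. iexp (t * (f (fst z) + g (snd z)))) = exp (- ((q + r) * t\<^sup>2) / 2)" for t
  proof -
    have "(CLINT z|M \<Otimes>\<^sub>M N. iexp (t * (f (fst z) + g (snd z))))
        = (CLINT z|M \<Otimes>\<^sub>M N. iexp (t * f (fst z)) * iexp (t * g (snd z)))"
      by (intro Bochner_Integration.integral_cong) (auto simp: algebra_simps exp_add)
    also have "\<dots> = (CLINT x|M. CLINT y|N. iexp (t * f x) * iexp (t * g y))"
      using integral_fst'[of "\<lambda>z. iexp (t * f (fst z)) * iexp (t * g (snd z))"]
        integrable_const_bound[of "\<lambda>z. iexp (t * f (fst z)) * iexp (t * g (snd z))" 1]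
      by (simp add: norm_mult)
    also have "\<dots> = (CLINT x|M. iexp (t * f x)) * (CLINT y|N. iexp (t * g y))"
      by simp
    also have "\<dots> = complex_of_real (exp (- (q * t\<^sup>2) / 2) * exp (- (r * t\<^sup>2) / 2))"
      using assms by (simp add: normal_rv_def)
    also have "exp (- (q * t\<^sup>2) / 2) * exp (- (r * t\<^sup>2) / 2) = exp (- ((q + r) * t\<^sup>2) / 2)"
      by (simp add: exp_add[symmetric] algebra_simps add_divide_distrib[symmetric])
    finally show ?thesis .
  qed
  then show ?thesis
    using assms by (simp add: normal_rv_def)
qed

lemma (in prob_space) normal_rv_indep_sum:
  assumes "indep_vars (\<lambda>_. borel) X A" "\<And>i. i \<in> A \<Longrightarrow> normal_rv M (q i) (X i)" "finite A"
  shows "normal_rv M (\<Sum>i\<in>A. q i) (\<lambda>x. \<Sum>i\<in>A. X i x)"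
proof -
  have X: "X i \<in> borel_measurable M" if "i \<in> A" for i
    using assms(2)[OF that] by (simp add: normal_rv_def)
  have "(CLINT x|M. iexp (t * (\<Sum>i\<in>A. X i x))) = exp (- ((\<Sum>i\<in>A. q i) * t\<^sup>2) / 2)" for t
  proof -
    have "(CLINT x|M. iexp (t * (\<Sum>i\<in>A. X i x))) = char (distr M borel (\<lambda>x. \<Sum>i\<in>A. X i x)) t"
      by (rule char_distr[symmetric]) (use X in auto)
    also have "\<dots> = (\<Prod>i\<in>A. char (distr M borel (X i)) t)"
      by (rule char_distr_sum[OF assms(1)])
    also have "\<dots> = (\<Prod>i\<in>A. complex_of_real (exp (- (q i * t\<^sup>2) / 2)))"
      using assms(2) by (intro prod.cong) (auto simp: char_distr X normal_rv_def)
    also have "\<dots> = complex_of_real (exp (\<Sum>i\<in>A. - (q i * t\<^sup>2) / 2))"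
      by (simp only: of_real_prod[symmetric] exp_sum[OF assms(3)])
    also have "(\<Sum>i\<in>A. - (q i * t\<^sup>2) / 2) = - ((\<Sum>i\<in>A. q i) * t\<^sup>2) / 2"
      by (simp add: sum_distrib_right sum_divide_distrib sum_negf)
    finally show ?thesis .
  qed
  moreover have "0 \<le> q i" if "i \<in> A" for i using assms(2)[OF that] by (simp add: normal_rv_def)
  ultimately show ?thesis using X
    by (auto simp: normal_rv_def intro!: sum_nonneg)
qed

text \<open>Joint Gaussianity through linear combinations. No covariance matrix is carried along;
  variances are read off as second moments where they are compared.\<close>

definition gaussian_family :: "'b measure \<Rightarrow> 'j set \<Rightarrow> ('j \<Rightarrow> 'b \<Rightarrow> real) \<Rightarrow> bool" where
  "gaussian_family M J Z \<longleftrightarrow> finite J \<and> (\<forall>c. \<exists>q. normal_rv M q (\<lambda>x. \<Sum>j\<in>J. c j * Z j x))"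

lemma gaussian_family_finite: "gaussian_family M J Z \<Longrightarrow> finite J"
  by (simp add: gaussian_family_def)

lemma gaussian_family_normal_rv:
  assumes "prob_space M" "gaussian_family M J Z"
  shows "normal_rv M (\<integral>x. (\<Sum>j\<in>J. c j * Z j x)\<^sup>2 \<partial>M) (\<lambda>x. \<Sum>j\<in>J. c j * Z j x)"
proof -
  obtain q where q: "normal_rv M q (\<lambda>x. \<Sum>j\<in>J. c j * Z j x)"
    using assms by (auto simp: gaussian_family_def)
  then show ?thesis using prob_space.normal_rv_moments(4)[OF assms(1) q] by simp
qed

lemma gaussian_family_component:
  assumes "gaussian_family M J Z" "j \<in> J"
  shows "\<exists>q. normal_rv M q (Z j)"
proof -
  have "(\<Sum>i\<in>J. (if i = j then 1 else 0) * Z i x) = Z j x" for x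
    using assms sum_single_plus[of J j 1 0 "\<lambda>_. 0" "\<lambda>i. Z i x"] by (simp add: gaussian_family_def)
  moreover have "\<exists>q. normal_rv M q (\<lambda>x. \<Sum>i\<in>J. (if i = j then 1 else 0) * Z i x)"
    using assms(1) unfolding gaussian_family_def by (elim conjE allE)
  ultimately show ?thesis by simp
qed

lemma gaussian_family_measurable:
  assumes "gaussian_family M J Z" "j \<in> J"
  shows "Z j \<in> borel_measurable M"
  using gaussian_family_component[OF assms] by (auto simp: normal_rv_def)

lemma gaussian_family_pair_add:
  assumes "prob_space M" "prob_space N" "gaussian_family M J Z" "gaussian_family N J W"
  shows "gaussian_family (M \<Otimes>\<^sub>M N) J (\<lambda>j z. Z j (fst z) + W j (snd z))"
proof -
  have "\<exists>q. normal_rv (M \<Otimes>\<^sub>M N) q (\<lambda>z. \<Sum>j\<in>J. c j * (Z j (fst z) + W j (snd z)))" for c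
    using normal_rv_pair_add[OF assms(1,2) gaussian_family_normal_rv[OF assms(1,3), of c]
      gaussian_family_normal_rv[OF assms(2,4), of c]]
    by (auto simp: sum.distrib distrib_left)
  then show ?thesis using assms by (simp add: gaussian_family_def)
qed

lemma (in pair_sigma_finite)
  fixes f :: "'a \<Rightarrow> real" and g :: "'b \<Rightarrow> real"
  assumes f: "integrable M1 f" and g: "integrable M2 g"
  shows integrable_pair_mult: "integrable (M1 \<Otimes>\<^sub>M M2) (\<lambda>z. f (fst z) * g (snd z))"
    and integral_pair_mult: "(\<integral>z. f (fst z) * g (snd z) \<partial>(M1 \<Otimes>\<^sub>M M2)) = (\<integral>x. f x \<partial>M1) * (\<integral>y. g y \<partial>M2)"
proof -
  have [measurable]: "f \<in> borel_measurable M1" "g \<in> borel_measurable M2" using f g by auto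
  show i: "integrable (M1 \<Otimes>\<^sub>M M2) (\<lambda>z. f (fst z) * g (snd z))"
  proof (rule Fubini_integrable)
    show "integrable M1 (\<lambda>x. LINT y|M2. norm (f (fst (x, y)) * g (snd (x, y))))"
      using f by (simp add: abs_mult)
    show "AE x in M1. integrable M2 (\<lambda>y. f (fst (x, y)) * g (snd (x, y)))"
      using g by simp
  qed measurable
  show "(\<integral>z. f (fst z) * g (snd z) \<partial>(M1 \<Otimes>\<^sub>M M2)) = (\<integral>x. f x \<partial>M1) * (\<integral>y. g y \<partial>M2)"
    using integral_fst'[OF i] by simp
qed

text \<open>By \<open>cramer_wold\<close> only linear combinations have to be compared. Both are
  sums of independent centered normals, so it is enough that the total variance is preserved, which
  is the identity \<open>(a * u + b * v)\<^sup>2 + (b * u - a * v)\<^sup>2 = (a\<^sup>2 + b\<^sup>2)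
  * (u\<^sup>2 + v\<^sup>2)\<close> under the expectation.\<close>

lemma gaussian_family_rotation:
  assumes M: "prob_space M" and Z: "gaussian_family M J Z" and ab: "a\<^sup>2 + b\<^sup>2 = 1"
  shows "distr (M \<Otimes>\<^sub>M M) (Pi\<^sub>M J (\<lambda>_. borel) \<Otimes>\<^sub>M Pi\<^sub>M J (\<lambda>_. borel))
           (\<lambda>z. (\<lambda>j\<in>J. Z j (fst z), \<lambda>j\<in>J. Z j (snd z)))
       = distr (M \<Otimes>\<^sub>M M) (Pi\<^sub>M J (\<lambda>_. borel) \<Otimes>\<^sub>M Pi\<^sub>M J (\<lambda>_. borel))
           (\<lambda>z. (\<lambda>j\<in>J. a * Z j (fst z) + b * Z j (snd z), \<lambda>j\<in>J. b * Z j (fst z) - a * Z j (snd z)))"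
proof -
  interpret M: prob_space M by fact
  interpret P: pair_prob_space M M ..
  have J: "finite J" using Z by (rule gaussian_family_finite)
  note [measurable] = gaussian_family_measurable[OF Z]
  \<comment> \<open>\<open>cramer_wold\<close> speaks of one family, so the pair is flattened: the
    Boolean tells the two halves apart, and \<open>\<phi>\<close> unpacks the result.\<close>
  define K where "K = J \<times> (UNIV :: bool set)"
  have K: "finite K" unfolding K_def using J by simp
  define X where "X k z = (if snd k then Z (fst k) (fst z) else Z (fst k) (snd z))" for k :: "'b \<times> bool" and z :: "'a \<times> 'a"
  define Y where "Y k z = (if snd k then a * Z (fst k) (fst z) + b * Z (fst k) (snd z)
      else b * Z (fst k) (fst z) - a * Z (fst k) (snd z))" for k :: "'b \<times> bool" and z :: "'a \<times> 'a"
  define \<phi> where "\<phi> w = (\<lambda>j\<in>J. w (j, True), \<lambda>j\<in>J. w (j, False))" for w :: "'b \<times> bool \<Rightarrow> real"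
  have [measurable]: "\<phi> \<in> measurable (Pi\<^sub>M K (\<lambda>_. borel)) (Pi\<^sub>M J (\<lambda>_. borel) \<Otimes>\<^sub>M Pi\<^sub>M J (\<lambda>_. borel))"
    unfolding \<phi>_def K_def by (intro measurable_Pair measurable_restrict measurable_component_singleton) auto
  have [measurable]: "X k \<in> borel_measurable (M \<Otimes>\<^sub>M M)" "Y k \<in> borel_measurable (M \<Otimes>\<^sub>M M)" if "k \<in> K" for k
    using that unfolding X_def Y_def K_def by (cases "snd k"; auto)+
  define q where "q c = M.expectation (\<lambda>x. (\<Sum>j\<in>J. c j * Z j x)\<^sup>2)" for c
  have nq: "normal_rv M (q c) (\<lambda>x. \<Sum>j\<in>J. c j * Z j x)" for c
    unfolding q_def by (rule gaussian_family_normal_rv[OF M Z])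
  have iq: "integrable M (\<lambda>x. (\<Sum>j\<in>J. c j * Z j x)\<^sup>2)" for c
    using M.normal_rv_moments(1)[OF nq, of c 2] by simp
  have q_add: "q c + q d = M.expectation (\<lambda>x. (\<Sum>j\<in>J. c j * Z j x)\<^sup>2 + (\<Sum>j\<in>J. d j * Z j x)\<^sup>2)" for c d
    unfolding q_def by (rule Bochner_Integration.integral_add[OF iq iq, symmetric])
  have q_rot: "q (\<lambda>j. a * c j + b * d j) + q (\<lambda>j. b * c j - a * d j) = q c + q d" for c d
  proof -
    have "(\<Sum>j\<in>J. (a * c j + b * d j) * Z j x)\<^sup>2 + (\<Sum>j\<in>J. (b * c j - a * d j) * Z j x)\<^sup>2
        = (\<Sum>j\<in>J. c j * Z j x)\<^sup>2 + (\<Sum>j\<in>J. d j * Z j x)\<^sup>2" for x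
    proof -
      have "(\<Sum>j\<in>J. (a * c j + b * d j) * Z j x) = a * (\<Sum>j\<in>J. c j * Z j x) + b * (\<Sum>j\<in>J. d j * Z j x)"
        "(\<Sum>j\<in>J. (b * c j - a * d j) * Z j x) = b * (\<Sum>j\<in>J. c j * Z j x) - a * (\<Sum>j\<in>J. d j * Z j x)"
        by (simp_all add: sum_distrib_left sum.distrib sum_subtractf algebra_simps)
      moreover have "(a * u + b * v)\<^sup>2 + (b * u - a * v)\<^sup>2 = (a\<^sup>2 + b\<^sup>2) * (u\<^sup>2 + v\<^sup>2)" for u v
        by (simp add: power2_eq_square algebra_simps)
      ultimately show ?thesis using ab by simp
    qed
    then show ?thesis
      unfolding q_add by (simp only:)
  qed
  have KJ: "(\<Sum>k\<in>K. h k) = (\<Sum>j\<in>J. h (j, True)) + (\<Sum>j\<in>J. h (j, False))" for h :: "_ \<Rightarrow> real"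
  proof -
    have "(\<Sum>k\<in>K. h k) = (\<Sum>j\<in>J. \<Sum>e\<in>UNIV. h (j, e))"
      unfolding K_def by (simp add: sum.cartesian_product)
    then show ?thesis by (simp add: UNIV_bool sum.distrib)
  qed
  have "distr (M \<Otimes>\<^sub>M M) (Pi\<^sub>M K (\<lambda>_. borel)) (\<lambda>z. \<lambda>k\<in>K. X k z)
      = distr (M \<Otimes>\<^sub>M M) (Pi\<^sub>M K (\<lambda>_. borel)) (\<lambda>z. \<lambda>k\<in>K. Y k z)"
  proof (rule cramer_wold)
    fix c :: "'b \<times> bool \<Rightarrow> real"
    let ?c = "\<lambda>j. c (j, True)" and ?d = "\<lambda>j. c (j, False)"
    have "normal_rv (M \<Otimes>\<^sub>M M) (q ?c + q ?d) (\<lambda>z. \<Sum>k\<in>K. c k * X k z)"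
      using normal_rv_pair_add[OF M M nq[of ?c] nq[of ?d]] by (simp add: KJ X_def)
    moreover have "normal_rv (M \<Otimes>\<^sub>M M) (q ?c + q ?d) (\<lambda>z. \<Sum>k\<in>K. c k * Y k z)"
    proof -
      have "(\<Sum>j\<in>J. (a * ?c j + b * ?d j) * Z j (fst z)) + (\<Sum>j\<in>J. (b * ?c j - a * ?d j) * Z j (snd z))
          = (\<Sum>k\<in>K. c k * Y k z)" for z
        unfolding KJ Y_def sum.distrib[symmetric] by (intro sum.cong refl) (simp add: algebra_simps)
      with normal_rv_pair_add[OF M M nq[of "\<lambda>j. a * ?c j + b * ?d j"] nq[of "\<lambda>j. b * ?c j - a * ?d j"]]
      show ?thesis unfolding q_rot by simp
    qed
    ultimately have "(CLINT x|M \<Otimes>\<^sub>M M. iexp (1 * (\<Sum>k\<in>K. c k * X k x))) = (CLINT x|M \<Otimes>\<^sub>M M. iexp (1 * (\<Sum>k\<in>K. c k * Y k x)))"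
      unfolding normal_rv_def by metis
    then show "(CLINT x|M \<Otimes>\<^sub>M M. iexp (\<Sum>k\<in>K. c k * X k x)) = (CLINT x|M \<Otimes>\<^sub>M M. iexp (\<Sum>k\<in>K. c k * Y k x))"
      by simp
  qed (auto intro: K P.prob_space_axioms)
  then have "distr (distr (M \<Otimes>\<^sub>M M) (Pi\<^sub>M K (\<lambda>_. borel)) (\<lambda>z. \<lambda>k\<in>K. X k z)) (Pi\<^sub>M J (\<lambda>_. borel) \<Otimes>\<^sub>M Pi\<^sub>M J (\<lambda>_. borel)) \<phi>
    = distr (distr (M \<Otimes>\<^sub>M M) (Pi\<^sub>M K (\<lambda>_. borel)) (\<lambda>z. \<lambda>k\<in>K. Y k z)) (Pi\<^sub>M J (\<lambda>_. borel) \<Otimes>\<^sub>M Pi\<^sub>M J (\<lambda>_. borel)) \<phi>"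
    by simp
  moreover have "(\<lambda>z. \<lambda>k\<in>K. X k z) \<in> measurable (M \<Otimes>\<^sub>M M) (Pi\<^sub>M K (\<lambda>_. borel))"
    "(\<lambda>z. \<lambda>k\<in>K. Y k z) \<in> measurable (M \<Otimes>\<^sub>M M) (Pi\<^sub>M K (\<lambda>_. borel))"
    by (intro measurable_restrict, simp)+
  moreover have "\<phi> \<circ> (\<lambda>z. \<lambda>k\<in>K. X k z) = (\<lambda>z. (\<lambda>j\<in>J. Z j (fst z), \<lambda>j\<in>J. Z j (snd z)))"
    "\<phi> \<circ> (\<lambda>z. \<lambda>k\<in>K. Y k z) = (\<lambda>z. (\<lambda>j\<in>J. a * Z j (fst z) + b * Z j (snd z), \<lambda>j\<in>J. b * Z j (fst z) - a * Z j (snd z)))"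
    by (auto simp: fun_eq_iff \<phi>_def K_def X_def Y_def)
  ultimately show ?thesis
    by (simp add: distr_distr)
qed

text \<open>The laws live on functions truncated to \<open>J\<close>; \<open>res\<close> says that
  \<open>H\<close> does not notice the truncation. Integrability is transferred as well because the
  rotated integrand is afterwards estimated by \<open>integral_mono\<close>.\<close>

lemma gaussian_family_rotation_integral:
  fixes H :: "('j \<Rightarrow> real) \<Rightarrow> ('j \<Rightarrow> real) \<Rightarrow> real"
  assumes M: "prob_space M" and Z: "gaussian_family M J Z" and ab: "a\<^sup>2 + b\<^sup>2 = 1"
    and H: "(\<lambda>z. H (fst z) (snd z)) \<in> borel_measurable (Pi\<^sub>M J (\<lambda>_. borel) \<Otimes>\<^sub>M Pi\<^sub>M J (\<lambda>_. borel))"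
    and res: "\<And>x y. H (restrict x J) (restrict y J) = H x y"
  shows "integrable (M \<Otimes>\<^sub>M M) (\<lambda>z. H (\<lambda>j. a * Z j (fst z) + b * Z j (snd z)) (\<lambda>j. b * Z j (fst z) - a * Z j (snd z)))
       \<longleftrightarrow> integrable (M \<Otimes>\<^sub>M M) (\<lambda>z. H (\<lambda>j. Z j (fst z)) (\<lambda>j. Z j (snd z)))" (is "?I1 \<longleftrightarrow> ?I2")
    and "(\<integral>z. H (\<lambda>j. a * Z j (fst z) + b * Z j (snd z)) (\<lambda>j. b * Z j (fst z) - a * Z j (snd z)) \<partial>(M \<Otimes>\<^sub>M M))
       = (\<integral>z. H (\<lambda>j. Z j (fst z)) (\<lambda>j. Z j (snd z)) \<partial>(M \<Otimes>\<^sub>M M))" (is "?E1 = ?E2")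
proof -
  note [measurable] = gaussian_family_measurable[OF Z]
  let ?Q = "Pi\<^sub>M J (\<lambda>_. borel) \<Otimes>\<^sub>M Pi\<^sub>M J (\<lambda>_. borel) :: (('j \<Rightarrow> real) \<times> ('j \<Rightarrow> real)) measure"
  let ?f = "\<lambda>z. (\<lambda>j\<in>J. Z j (fst z), \<lambda>j\<in>J. Z j (snd z))"
  let ?g = "\<lambda>z. (\<lambda>j\<in>J. a * Z j (fst z) + b * Z j (snd z), \<lambda>j\<in>J. b * Z j (fst z) - a * Z j (snd z))"
  have f: "?f \<in> measurable (M \<Otimes>\<^sub>M M) ?Q" and g: "?g \<in> measurable (M \<Otimes>\<^sub>M M) ?Q"
    by (intro measurable_Pair measurable_restrict; measurable)+
  have Hf: "H (fst (?f z)) (snd (?f z)) = H (\<lambda>j. Z j (fst z)) (\<lambda>j. Z j (snd z))"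
    and Hg: "H (fst (?g z)) (snd (?g z)) = H (\<lambda>j. a * Z j (fst z) + b * Z j (snd z)) (\<lambda>j. b * Z j (fst z) - a * Z j (snd z))" for z
    using res[of "\<lambda>j. Z j (fst z)" "\<lambda>j. Z j (snd z)"]
      res[of "\<lambda>j. a * Z j (fst z) + b * Z j (snd z)" "\<lambda>j. b * Z j (fst z) - a * Z j (snd z)"] by simp_all
  note rot = gaussian_family_rotation[OF M Z ab]
  show "?I1 \<longleftrightarrow> ?I2"
    using integrable_distr_eq[OF f H] integrable_distr_eq[OF g H] unfolding rot Hf Hg by simp
  show "?E1 = ?E2"
    using integral_distr[OF f H] integral_distr[OF g H] unfolding rot Hf Hg by simp
qed

section \<open>Moments of Gaussian seminorms\<close>

text \<open>Homogeneity and the triangle inequality are merged into one inequality, the form in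
  which rotated vectors occur. The last clause makes \<open>N\<close> a function of the coordinates
  in \<open>J\<close> although its argument is a total function.\<close>

definition measurable_seminorm :: "'j set \<Rightarrow> (('j \<Rightarrow> real) \<Rightarrow> real) \<Rightarrow> bool" where
  "measurable_seminorm J N \<longleftrightarrow> N \<in> borel_measurable (Pi\<^sub>M J (\<lambda>_. borel)) \<and> (\<forall>x. 0 \<le> N x) \<and>
     (\<forall>a b x y. N (\<lambda>j. a * x j + b * y j) \<le> \<bar>a\<bar> * N x + \<bar>b\<bar> * N y) \<and> (\<forall>x. N (restrict x J) = N x)"

lemma measurable_seminorm_D:
  assumes "measurable_seminorm J N"
  shows "N \<in> borel_measurable (Pi\<^sub>M J (\<lambda>_. borel))" "0 \<le> N x"
    "N (\<lambda>j. a * x j + b * y j) \<le> \<bar>a\<bar> * N x + \<bar>b\<bar> * N y" "N (restrict x J) = N x"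
  using assms by (simp_all add: measurable_seminorm_def)

text \<open>Expansion in coordinate vectors. It makes all moments finite a priori, with a bound that
  depends on \<open>J\<close>; the estimates that follow remove this dependence.\<close>

lemma measurable_seminorm_le_sum:
  assumes N: "measurable_seminorm J N" and J: "finite J"
  shows "N x \<le> (\<Sum>j\<in>J. \<bar>x j\<bar> * N (\<lambda>i. if i = j then 1 else 0))"
proof -
  have "N (\<lambda>j. if j \<in> I then x j else 0) \<le> (\<Sum>j\<in>I. \<bar>x j\<bar> * N (\<lambda>i. if i = j then 1 else 0))"
    if "finite I" for I
    using that
  proof (induction I)
    case empty
    show ?case using measurable_seminorm_D(3)[OF N, of 0 x 0 x] by simp
  next
    case (insert l I)
    have "(\<lambda>j. if j \<in> insert l I then x j else 0)
        = (\<lambda>j. x l * (if j = l then 1 else 0) + 1 * (if j \<in> I then x j else 0))"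
      using insert.hyps by auto
    then have "N (\<lambda>j. if j \<in> insert l I then x j else 0)
        \<le> \<bar>x l\<bar> * N (\<lambda>j. if j = l then 1 else 0) + 1 * N (\<lambda>j. if j \<in> I then x j else 0)"
      using measurable_seminorm_D(3)[OF N, of "x l" "\<lambda>j. if j = l then 1 else 0" 1 "\<lambda>j. if j \<in> I then x j else 0"]
      by simp
    then show ?case using insert by simp
  qed
  from this[OF J] have "N (\<lambda>j. if j \<in> J then x j else 0) \<le> (\<Sum>j\<in>J. \<bar>x j\<bar> * N (\<lambda>i. if i = j then 1 else 0))" .
  moreover have "N (\<lambda>j. if j \<in> J then x j else 0) = N x"
    using measurable_seminorm_D(4)[OF N, of x] measurable_seminorm_D(4)[OF N, of "\<lambda>j. if j \<in> J then x j else 0"]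
    by (simp add: restrict_def cong: if_cong)
  ultimately show ?thesis by simp
qed

text \<open>The largest summand controls the sum, which is enough for integrability. The
  \<open>1 +\<close> covers \<open>J = {}\<close> with \<open>p = 0\<close>.\<close>

lemma sum_power_le:
  fixes a :: "'j \<Rightarrow> real"
  assumes "finite J" "\<And>j. j \<in> J \<Longrightarrow> 0 \<le> a j"
  shows "(\<Sum>j\<in>J. a j) ^ p \<le> real (card J) ^ p * (1 + (\<Sum>j\<in>J. a j ^ p))"
proof (cases "J = {}")
  case True
  then show ?thesis by (cases p) auto
next
  case False
  define m where "m = Max (a ` J)"
  have "m \<in> a ` J" unfolding m_def using assms False by (intro Max_in) auto
  then obtain j where j: "j \<in> J" "m = a j" by auto
  have "(\<Sum>j\<in>J. a j) \<le> real (card J) * m"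
    unfolding m_def using assms by (intro sum_bounded_above) auto
  then have "(\<Sum>j\<in>J. a j) ^ p \<le> (real (card J) * m) ^ p"
    using assms by (intro power_mono sum_nonneg) auto
  also have "\<dots> = real (card J) ^ p * a j ^ p" using j by (simp add: power_mult_distrib)
  also have "a j ^ p \<le> (\<Sum>j\<in>J. a j ^ p)"
    using assms j by (intro member_le_sum) auto
  finally show ?thesis by (simp add: distrib_left mult_left_mono) (smt (verit) mult_left_mono of_nat_0_le_iff zero_le_power)
qed

lemma power_add_le:
  fixes a b :: real
  assumes "0 \<le> a" "0 \<le> b"
  shows "(a + b) ^ r \<le> 2 ^ r * (a ^ r + b ^ r)"
proof -
  have "(a + b) ^ r \<le> (2 * max a b) ^ r" using assms by (intro power_mono) auto
  also have "\<dots> \<le> 2 ^ r * (a ^ r + b ^ r)"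
    using assms by (simp add: power_mult_distrib max_def)
  finally show ?thesis .
qed

lemma measurable_seminorm_compose:
  assumes N: "measurable_seminorm J N" and "\<And>j. j \<in> J \<Longrightarrow> Z j \<in> borel_measurable M"
  shows "(\<lambda>x. N (\<lambda>j. Z j x)) \<in> borel_measurable M"
proof -
  have "(\<lambda>x. N (\<lambda>j\<in>J. Z j x)) \<in> borel_measurable M"
    by (rule measurable_compose[OF measurable_restrict measurable_seminorm_D(1)[OF N]]) (use assms in auto)
  then show ?thesis
    using measurable_seminorm_D(4)[OF N, of "\<lambda>j. Z j x" for x] by simp
qed

lemma integrable_seminorm_power:
  assumes M: "prob_space M" and Z: "gaussian_family M J Z" and N: "measurable_seminorm J N"
  shows "integrable M (\<lambda>x. N (\<lambda>j. Z j x) ^ p)"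
proof -
  interpret prob_space M by fact
  have J: "finite J" using Z by (rule gaussian_family_finite)
  note Zm = gaussian_family_measurable[OF Z]
  define e where "e j = N (\<lambda>i. if i = j then 1 else 0)" for j
  have e: "e j \<ge> 0" for j unfolding e_def by (rule measurable_seminorm_D(2)[OF N])
  have i: "integrable M (\<lambda>x. real (card J) ^ p * (1 + (\<Sum>j\<in>J. (\<bar>Z j x\<bar> * e j) ^ p)))"
    using gaussian_family_component[OF Z] normal_rv_moments(1)
    by (intro integrable_mult_right Bochner_Integration.integrable_add Bochner_Integration.integrable_sum)
       (auto simp: power_mult_distrib)
  show ?thesis
  proof (rule Bochner_Integration.integrable_bound[OF i])
    show "(\<lambda>x. N (\<lambda>j. Z j x) ^ p) \<in> borel_measurable M"
      by (intro borel_measurable_power measurable_seminorm_compose[OF N] Zm)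
    have "norm (N (\<lambda>j. Z j x) ^ p) \<le> norm (real (card J) ^ p * (1 + (\<Sum>j\<in>J. (\<bar>Z j x\<bar> * e j) ^ p)))" for x
    proof -
      have "N (\<lambda>j. Z j x) ^ p \<le> (\<Sum>j\<in>J. \<bar>Z j x\<bar> * e j) ^ p"
        using measurable_seminorm_le_sum[OF N J, of "\<lambda>j. Z j x"] measurable_seminorm_D(2)[OF N]
        unfolding e_def by (intro power_mono) auto
      also have "\<dots> \<le> real (card J) ^ p * (1 + (\<Sum>j\<in>J. (\<bar>Z j x\<bar> * e j) ^ p))"
        using J e by (intro sum_power_le) auto
      finally show ?thesis using measurable_seminorm_D(2)[OF N] by simp
    qed
    then show "AE x in M. norm (N (\<lambda>j. Z j x) ^ p) \<le> norm (real (card J) ^ p * (1 + (\<Sum>j\<in>J. (\<bar>Z j x\<bar> * e j) ^ p)))"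
      by simp
  qed
qed

lemma truncated_power_integrable:
  assumes M: "prob_space M" and Z: "gaussian_family M J Z" and N: "measurable_seminorm J N" and t: "0 \<le> t"
  shows "integrable M (\<lambda>x. max 0 (N (\<lambda>j. Z j x) - t) ^ p)"
proof (rule Bochner_Integration.integrable_bound[OF integrable_seminorm_power[OF M Z N, of p]])
  have [measurable]: "(\<lambda>x. N (\<lambda>j. Z j x)) \<in> borel_measurable M"
    by (intro measurable_seminorm_compose[OF N] gaussian_family_measurable[OF Z])
  show "(\<lambda>x. max 0 (N (\<lambda>j. Z j x) - t) ^ p) \<in> borel_measurable M" by measurable
  show "AE x in M. norm (max 0 (N (\<lambda>j. Z j x) - t) ^ p) \<le> norm (N (\<lambda>j. Z j x) ^ p)"
    using t measurable_seminorm_D(2)[OF N] by (auto intro!: always_eventually power_mono simp: max_def)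
qed

text \<open>If \<open>x\<close>, \<open>y\<close> are independent copies then so are \<open>(x + y) / sqrt 2\<close> and \<open>(x - y) / sqrt 2\<close>.
  When the seminorm of the second one is small, that of the first one is controlled
  by both the seminorm of \<open>x\<close> and the one of \<open>y\<close>, which are independent.\<close>

lemma gaussian_seminorm_doubling:
  assumes M: "prob_space M" and Z: "gaussian_family M J Z" and N: "measurable_seminorm J N"
    and s: "0 \<le> s" and t: "0 \<le> t"
  shows "measure M {x \<in> space M. N (\<lambda>j. Z j x) \<le> s} * (\<integral>x. max 0 (N (\<lambda>j. Z j x) - (s + sqrt 2 * t)) ^ (2 * q) \<partial>M)
    \<le> 2 ^ q * (\<integral>x. max 0 (N (\<lambda>j. Z j x) - t) ^ q \<partial>M)\<^sup>2"
proof -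
  interpret M: prob_space M by fact
  interpret P: pair_prob_space M M ..
  have [measurable]: "(\<lambda>x. N (\<lambda>j. Z j x)) \<in> borel_measurable M"
    by (intro measurable_seminorm_compose[OF N] gaussian_family_measurable[OF Z])
  note [measurable] = measurable_seminorm_D(1)[OF N]
  define u where "u = s + sqrt 2 * t"
  have u: "0 \<le> u" unfolding u_def using s t by simp
  define a where "a = 1 / sqrt (2::real)"
  have a: "a\<^sup>2 + a\<^sup>2 = 1" "a > 0" "1 / a = sqrt 2" unfolding a_def by (simp_all add: power_divide)
  \<comment> \<open>The excess of the first vector on the event that the second is small. For the
    unrotated pair these are independent, so the expectation of \<open>H\<close> is the left-hand
    side.\<close>
  define H where "H x y = max 0 (N x - u) ^ (2 * q) * indicator {..s} (N y)" for x y
  let ?Z = "\<lambda>x j. Z j x"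
  have Hm: "(\<lambda>z. H (fst z) (snd z)) \<in> borel_measurable (Pi\<^sub>M J (\<lambda>_. borel) \<Otimes>\<^sub>M Pi\<^sub>M J (\<lambda>_. borel))"
    unfolding H_def by measurable
  have Hr: "H (restrict x J) (restrict y J) = H x y" for x y
    unfolding H_def by (simp add: measurable_seminorm_D(4)[OF N])
  have i1: "integrable M (\<lambda>x. max 0 (N (?Z x) - u) ^ (2 * q))"
    by (rule truncated_power_integrable[OF M Z N u])
  have i2: "integrable M (\<lambda>y. indicator {..s} (N (?Z y)) :: real)"
    by (rule M.integrable_const_bound[where B=1]) auto
  have iH: "integrable (M \<Otimes>\<^sub>M M) (\<lambda>z. H (?Z (fst z)) (?Z (snd z)))"
    unfolding H_def by (rule P.integrable_pair_mult[OF i1 i2])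
  have "measure M {x \<in> space M. N (?Z x) \<le> s} = (\<integral>y. indicat_real {..s} (N (?Z y)) \<partial>M)"
  proof -
    have "(\<integral>y. indicat_real {..s} (N (?Z y)) \<partial>M) = (\<integral>y. indicat_real {x \<in> space M. N (?Z x) \<le> s} y \<partial>M)"
      by (intro Bochner_Integration.integral_cong) (auto simp: indicator_def)
    then show ?thesis by simp
  qed
  then have "measure M {x \<in> space M. N (?Z x) \<le> s} * (\<integral>x. max 0 (N (?Z x) - u) ^ (2 * q) \<partial>M)
      = (\<integral>z. H (?Z (fst z)) (?Z (snd z)) \<partial>(M \<Otimes>\<^sub>M M))"
    unfolding H_def using P.integral_pair_mult[OF i1 i2] by simp
  also have "\<dots> = (\<integral>z. H (\<lambda>j. a * Z j (fst z) + a * Z j (snd z)) (\<lambda>j. a * Z j (fst z) - a * Z j (snd z)) \<partial>(M \<Otimes>\<^sub>M M))"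
    by (rule gaussian_family_rotation_integral(2)[where H=H and J=J and Z=Z, OF M Z a(1) Hm Hr, symmetric])
  also have "\<dots> \<le> (\<integral>z. (2 ^ q * max 0 (N (?Z (fst z)) - t) ^ q) * max 0 (N (?Z (snd z)) - t) ^ q \<partial>(M \<Otimes>\<^sub>M M))"
  proof (rule integral_mono)
    show "integrable (M \<Otimes>\<^sub>M M) (\<lambda>z. H (\<lambda>j. a * Z j (fst z) + a * Z j (snd z)) (\<lambda>j. a * Z j (fst z) - a * Z j (snd z)))"
      using gaussian_family_rotation_integral(1)[where H=H and J=J and Z=Z, OF M Z a(1) Hm Hr] iH by simp
    show "integrable (M \<Otimes>\<^sub>M M) (\<lambda>z. (2 ^ q * max 0 (N (?Z (fst z)) - t) ^ q) * max 0 (N (?Z (snd z)) - t) ^ q)"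
      by (intro P.integrable_pair_mult integrable_mult_right truncated_power_integrable[OF M Z N t])
    fix z
    define x y where "x = ?Z (fst z)" and "y = ?Z (snd z)"
    define v w where "v = (\<lambda>j. a * x j + a * y j)" and "w = (\<lambda>j. a * x j - a * y j)"
    have "H v w \<le> (2 ^ q * max 0 (N x - t) ^ q) * max 0 (N y - t) ^ q"
    proof (cases "N w \<le> s")
      case False
      then show ?thesis by (simp add: H_def)
    next
      case True
      \<comment> \<open>The rotated first vector is \<open>sqrt 2\<close> times either original
        vector up to \<open>w\<close>, whose seminorm is at most \<open>s\<close>; this accounts for
        the level \<open>s + sqrt 2 * t\<close>.\<close>
      have v1: "v = (\<lambda>j. (2 * a) * x j + (-1) * w j)" and v2: "v = (\<lambda>j. (2 * a) * y j + 1 * w j)"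
        unfolding v_def w_def by (auto simp: algebra_simps)
      have "2 * a = sqrt 2" unfolding a_def by (simp add: real_div_sqrt)
      then have "N v \<le> sqrt 2 * N x + s" "N v \<le> sqrt 2 * N y + s"
        using measurable_seminorm_D(3)[OF N, of "2 * a" x "-1" w] measurable_seminorm_D(3)[OF N, of "2 * a" y 1 w] True
        unfolding v1[symmetric] v2[symmetric] by auto
      moreover have "max 0 (N v - u) \<le> sqrt 2 * max 0 (c - t)" if "N v \<le> sqrt 2 * c + s" for c
      proof -
        have "sqrt 2 * (c - t) \<le> sqrt 2 * max 0 (c - t)" by (rule mult_left_mono) auto
        then show ?thesis using that unfolding u_def by (simp add: right_diff_distrib)
      qed
      ultimately have le: "max 0 (N v - u) \<le> sqrt 2 * max 0 (N x - t)" "max 0 (N v - u) \<le> sqrt 2 * max 0 (N y - t)"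
        by blast+
      \<comment> \<open>The even power is halved: one half is estimated by \<open>x\<close>, the
        other by \<open>y\<close>, and their independence makes the right-hand side a
        square.\<close>
      have "H v w = max 0 (N v - u) ^ q * max 0 (N v - u) ^ q"
        using True by (simp add: H_def power_add mult_2)
      also have "\<dots> \<le> (sqrt 2 * max 0 (N x - t)) ^ q * (sqrt 2 * max 0 (N y - t)) ^ q"
        using le by (intro mult_mono power_mono) auto
      also have "\<dots> = (sqrt 2 * sqrt 2) ^ q * max 0 (N x - t) ^ q * max 0 (N y - t) ^ q"
        by (simp only: power_mult_distrib mult_ac)
      finally show ?thesis by simp
    qed
    then show "H (\<lambda>j. a * Z j (fst z) + a * Z j (snd z)) (\<lambda>j. a * Z j (fst z) - a * Z j (snd z))
        \<le> (2 ^ q * max 0 (N (?Z (fst z)) - t) ^ q) * max 0 (N (?Z (snd z)) - t) ^ q"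
      unfolding v_def w_def x_def y_def .
  qed
  also have "\<dots> = (\<integral>x. 2 ^ q * max 0 (N (?Z x) - t) ^ q \<partial>M) * (\<integral>x. max 0 (N (?Z x) - t) ^ q \<partial>M)"
    by (intro P.integral_pair_mult integrable_mult_right truncated_power_integrable[OF M Z N t])
  finally show ?thesis unfolding u_def by (simp add: power2_eq_square)
qed

text \<open>Markov's inequality puts probability 1/2 on the level \<open>2 * m\<close>, and doubling
  is iterated from the first moment. Each doubling of the exponent multiplies both the threshold and
  the bound on the moment norm by about \<open>sqrt 2\<close>, so after \<open>k\<close> rounds both
  have order \<open>m * sqrt r\<close>.\<close>

lemma gaussian_seminorm_moments:
  assumes M: "prob_space M" and Z: "gaussian_family M J Z" and N: "measurable_seminorm J N"
    and r: "r = 2 ^ k"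
  shows "(\<integral>x. N (\<lambda>j. Z j x) ^ r \<partial>M) \<le> (20 * sqrt (real r) * (\<integral>x. N (\<lambda>j. Z j x) \<partial>M)) ^ r"
proof -
  interpret prob_space M by fact
  let ?N = "\<lambda>x. N (\<lambda>j. Z j x)"
  have [measurable]: "?N \<in> borel_measurable M"
    by (intro measurable_seminorm_compose[OF N] gaussian_family_measurable[OF Z])
  have N0: "0 \<le> ?N x" for x by (rule measurable_seminorm_D(2)[OF N])
  have iN: "integrable M ?N" using integrable_seminorm_power[OF M Z N, of 1] by simp
  define m where "m = expectation ?N"
  have m: "m \<ge> 0" unfolding m_def using N0 by simp
  have half: "1 / 2 \<le> prob {x \<in> space M. ?N x \<le> 2 * m}"
  proof (cases "m = 0")
    case True
    then have "AE x in M. ?N x = 0"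
      using integral_nonneg_eq_0_iff_AE[OF iN] N0 m_def by auto
    then have "prob {x \<in> space M. ?N x \<le> 2 * m} = 1"
      using True by (subst prob_eq_1) auto
    then show ?thesis by simp
  next
    case False
    then have mp: "m > 0" using m by simp
    have "prob {x \<in> space M. 2 * m \<le> ?N x} \<le> m / (2 * m)"
      unfolding m_def by (rule integral_Markov_inequality_measure[OF iN]) (use mp N0 m_def in auto)
    then have "prob {x \<in> space M. 2 * m \<le> ?N x} \<le> 1 / 2" using mp by simp
    moreover have "prob (space M - {x \<in> space M. 2 * m \<le> ?N x}) = 1 - prob {x \<in> space M. 2 * m \<le> ?N x}"
      by (rule prob_compl) measurable
    moreover have "prob (space M - {x \<in> space M. 2 * m \<le> ?N x}) \<le> prob {x \<in> space M. ?N x \<le> 2 * m}"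
      by (rule finite_measure_mono) auto
    ultimately show ?thesis by simp
  qed
  \<comment> \<open>Chosen so that \<open>2 * m + sqrt 2 * t i \<le> t (Suc i)\<close>: the
    difference of the last two terms is \<open>5 * m * (sqrt 2 - 1)\<close>, which is at least
    \<open>2 * m\<close> as \<open>sqrt 2 \<ge> 1.4\<close>. Since \<open>t 0 = 0\<close>, the
    iteration starts from the plain mean.\<close>
  define t where "t i = 5 * m * (sqrt 2 ^ i - 1)" for i :: nat
  define E where "E i = expectation (\<lambda>x. max 0 (?N x - t i) ^ (2 ^ i))" for i
  have t0: "0 \<le> t i" for i unfolding t_def using m by (intro mult_nonneg_nonneg) auto
  have s2: "sqrt 2 \<ge> 1.4" by (rule real_le_rsqrt) (simp add: power2_eq_square)
  have E0: "0 \<le> E i" for i unfolding E_def by simp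
  have step: "E (Suc i) \<le> 2 * 2 ^ 2 ^ i * (E i)\<^sup>2" for i
  proof -
    have "2 * m + sqrt 2 * t i \<le> t (Suc i)"
      unfolding t_def using s2 mult_left_mono[OF s2 m] by (simp add: algebra_simps)
    then have "E (Suc i) \<le> expectation (\<lambda>x. max 0 (?N x - (2 * m + sqrt 2 * t i)) ^ (2 * 2 ^ i))"
      unfolding E_def using m t0[of i] t0[of "Suc i"]
      by (intro integral_mono truncated_power_integrable[OF M Z N]) (auto intro!: power_mono)
    also have "\<dots> \<le> 2 * (prob {x \<in> space M. ?N x \<le> 2 * m} * expectation (\<lambda>x. max 0 (?N x - (2 * m + sqrt 2 * t i)) ^ (2 * 2 ^ i)))"
      using mult_right_mono[OF half, of "expectation (\<lambda>x. max 0 (?N x - (2 * m + sqrt 2 * t i)) ^ (2 * 2 ^ i))"]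
      by simp
    also have "\<dots> \<le> 2 * (2 ^ 2 ^ i * (E i)\<^sup>2)"
      unfolding E_def by (intro mult_left_mono gaussian_seminorm_doubling[OF M Z N]) (use m t0 in auto)
    finally show ?thesis by simp
  qed
  \<comment> \<open>The factor 2 absorbs the loss 1/2 of the probability: the recursion becomes
    \<open>2 * E (Suc i) \<le> 2 ^ 2 ^ i * (2 * E i)\<^sup>2\<close>, and
    \<open>2 ^ 2 ^ i = sqrt 2 ^ 2 ^ Suc i\<close>.\<close>
  have bound: "2 * E i \<le> (2 * m * sqrt 2 ^ i) ^ (2 ^ i)" for i
  proof (induction i)
    case 0
    have "max 0 (?N x) = ?N x" for x using N0[of x] by simp
    then show ?case by (simp add: E_def t_def m_def)
  next
    case (Suc i)
    have "2 * E (Suc i) \<le> 2 ^ 2 ^ i * (2 * E i)\<^sup>2"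
      using step[of i] by (simp add: power_mult_distrib mult_ac)
    also have "\<dots> \<le> 2 ^ 2 ^ i * ((2 * m * sqrt 2 ^ i) ^ (2 ^ i))\<^sup>2"
      using Suc E0[of i] by (intro mult_left_mono power_mono) auto
    also have "(2::real) ^ 2 ^ i = sqrt 2 ^ (2 ^ Suc i)"
      by (simp add: power_mult)
    also have "((2 * m * sqrt 2 ^ i) ^ (2 ^ i))\<^sup>2 = (2 * m * sqrt 2 ^ i) ^ (2 ^ Suc i)"
      by (simp add: power_mult[symmetric] mult.commute)
    finally show ?case
      by (simp add: power_mult_distrib[symmetric] mult_ac)
  qed
  define S where "S = m * sqrt 2 ^ k"
  have S: "S \<ge> 0" unfolding S_def using m by simp
  have rS: "sqrt (real r) * m = S" unfolding S_def r by (simp add: real_sqrt_power mult.commute)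
  have tk: "t k \<le> 5 * S" unfolding t_def S_def using m by (simp add: right_diff_distrib)
  have double_pow: "((2 * c) * S) ^ r = 2 ^ r * (c * S) ^ r" for c
    by (simp only: mult.assoc power_mult_distrib)
  have num: "(10::real) = 2 * 5" "(20::real) = 2 * 10" by simp_all
  have p10: "(10 * S) ^ r = 2 ^ r * (5 * S) ^ r" by (subst num(1)) (rule double_pow)
  have p20: "(20 * S) ^ r = 2 ^ r * (10 * S) ^ r" by (subst num(2)) (rule double_pow)
  have rpos: "r \<ge> 1" unfolding r by simp
  \<comment> \<open>The seminorm is at most the threshold, below \<open>5 * S\<close>, plus the
    excess. Splitting the power turns 5 into 10, and adding the two equal bounds turns 10 into
    20.\<close>
  have "expectation (\<lambda>x. ?N x ^ r) \<le> expectation (\<lambda>x. 2 ^ r * ((5 * S) ^ r + max 0 (?N x - t k) ^ r))"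
  proof (intro integral_mono integrable_seminorm_power[OF M Z N] integrable_mult_right Bochner_Integration.integrable_add
      truncated_power_integrable[OF M Z N] t0)
    fix x
    have "?N x \<le> 5 * S + max 0 (?N x - t k)" using tk by (auto simp: max_def)
    then have "?N x ^ r \<le> (5 * S + max 0 (?N x - t k)) ^ r" by (intro power_mono N0)
    also have "\<dots> \<le> 2 ^ r * ((5 * S) ^ r + max 0 (?N x - t k) ^ r)"
      using S by (intro power_add_le) auto
    finally show "?N x ^ r \<le> 2 ^ r * ((5 * S) ^ r + max 0 (?N x - t k) ^ r)" .
  qed simp
  also have "\<dots> = 2 ^ r * ((5 * S) ^ r + E k)"
    using truncated_power_integrable[OF M Z N t0, of k r] prob_space by (simp add: E_def r)
  also have "\<dots> \<le> 2 ^ r * ((5 * S) ^ r + (5 * S) ^ r)"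
  proof (intro mult_left_mono add_left_mono)
    have "E k \<le> (2 * S) ^ r"
      using bound[of k] E0[of k] by (simp add: S_def r mult_ac)
    also have "\<dots> \<le> (5 * S) ^ r"
      using S by (intro power_mono) auto
    finally show "E k \<le> (5 * S) ^ r" .
  qed simp
  also have "2 ^ r * ((5 * S) ^ r + (5 * S) ^ r) = 2 * (10 * S) ^ r"
    by (simp only: p10 distrib_left mult_2)
  also have "\<dots> \<le> 2 ^ r * (10 * S) ^ r"
    using rpos S by (intro mult_right_mono) (auto intro: self_le_power)
  also have "\<dots> = (20 * S) ^ r" by (simp only: p20)
  also have "20 * S = 20 * sqrt (real r) * expectation ?N"
    using rS unfolding m_def by simp
  finally show ?thesis .
qed

text \<open>Here the seminorm is controlled in probability only, and the bound does not depend on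
  \<open>J\<close>, which is what integrability of the norm of \<open>E\<close> requires. Doubling
  at \<open>t = 0\<close> bounds \<open>B\<close>, the second moment of the excess, by the squared
  mean \<open>e\<close>; conversely \<open>e\<close> is at most \<open>s\<close> plus a small
  multiple of \<open>sqrt B\<close>, as the excess lives on an event of probability at most 1/16.
  The two estimates close because \<open>B\<close> is finite a priori.\<close>

lemma gaussian_seminorm_second_moment:
  assumes M: "prob_space M" and Z: "gaussian_family M J Z" and N: "measurable_seminorm J N"
    and s: "0 \<le> s" and P: "15 / 16 \<le> measure M {x \<in> space M. N (\<lambda>j. Z j x) \<le> s}"
  shows "(\<integral>x. (N (\<lambda>j. Z j x))\<^sup>2 \<partial>M) \<le> 14 * s\<^sup>2"
proof -
  interpret prob_space M by fact
  let ?N = "\<lambda>x. N (\<lambda>j. Z j x)"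
  have [measurable]: "?N \<in> borel_measurable M"
    by (intro measurable_seminorm_compose[OF N] gaussian_family_measurable[OF Z])
  have N0: "0 \<le> ?N x" for x by (rule measurable_seminorm_D(2)[OF N])
  have iN: "integrable M ?N" using integrable_seminorm_power[OF M Z N, of 1] by simp
  let ?T = "\<lambda>x. max 0 (?N x - s)"
  have iT: "integrable M ?T" using truncated_power_integrable[OF M Z N s, of 1] by simp
  have iT2: "integrable M (\<lambda>x. (?T x)\<^sup>2)" using truncated_power_integrable[OF M Z N s, of 2] by simp
  define B where "B = expectation (\<lambda>x. (?T x)\<^sup>2)"
  have B: "B \<ge> 0" unfolding B_def by simp
  define e where "e = expectation ?N"
  have e: "e \<ge> 0" unfolding e_def using N0 by simp
  have "expectation ?T \<le> sqrt B / 4"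
  proof (cases "B = 0")
    case True
    have "AE x in M. (?T x)\<^sup>2 = 0"
      using integral_nonneg_eq_0_iff_AE[OF iT2] True B_def by auto
    then have "AE x in M. ?T x = 0" by simp
    then have "expectation ?T = 0" by (rule integral_eq_zero_AE)
    with True show ?thesis by simp
  next
    case False
    define b where "b = sqrt B"
    have b: "b > 0" "b\<^sup>2 = B" unfolding b_def using B False by auto
    let ?A = "space M - {x \<in> space M. ?N x \<le> s}"
    have iA: "integrable M (indicator ?A :: _ \<Rightarrow> real)"
      by (rule integrable_const_bound[where B=1]) auto
    have pA: "expectation (indicat_real ?A) \<le> 1 / 16"
      using P prob_compl[of "{x \<in> space M. ?N x \<le> s}"] by simp
    \<comment> \<open>Cauchy-Schwarz on an event of probability at most 1/16, in the pointwise form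
      \<open>(?T x - 4 * b)\<^sup>2 \<ge> 0\<close>.\<close>
    have "expectation ?T \<le> expectation (\<lambda>x. (?T x)\<^sup>2 / (8 * b) + 2 * b * indicator ?A x)"
    proof (intro integral_mono iT Bochner_Integration.integrable_add integrable_divide_zero iT2 integrable_mult_right iA)
      fix x assume x: "x \<in> space M"
      show "?T x \<le> (?T x)\<^sup>2 / (8 * b) + 2 * b * indicator ?A x"
      proof (cases "x \<in> ?A")
        case True
        have "0 \<le> (?T x - 4 * b)\<^sup>2" by simp
        then have "?T x * (8 * b) \<le> (?T x)\<^sup>2 + 2 * b * (8 * b)"
          by (simp add: power2_eq_square algebra_simps)
        then have "?T x \<le> ((?T x)\<^sup>2 + 2 * b * (8 * b)) / (8 * b)"
          using pos_le_divide_eq[of "8 * b" "?T x" "(?T x)\<^sup>2 + 2 * b * (8 * b)"] b by linarith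
        then show ?thesis using True b by (simp add: add_divide_distrib)
      next
        case False
        with x have "?T x = 0" by auto
        then show ?thesis using b by simp
      qed
    qed
    also have "\<dots> = B / (8 * b) + 2 * b * expectation (indicat_real ?A)"
      using iT2 iA by (simp add: B_def)
    also have "\<dots> \<le> b / 8 + 2 * b * (1 / 16)"
      using b pA by (intro add_mono mult_left_mono) (auto simp: power2_eq_square field_simps)
    finally show ?thesis unfolding b_def by simp
  qed
  moreover have "e \<le> s + expectation ?T"
  proof -
    have "e \<le> expectation (\<lambda>x. s + ?T x)"
      unfolding e_def using iN iT by (intro integral_mono) (auto simp: max_def)
    then show ?thesis using iT prob_space by simp
  qed
  ultimately have e_le: "e \<le> s + sqrt B / 4" by simp
  have "measure M {x \<in> space M. ?N x \<le> s} * B \<le> 2 * e\<^sup>2"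
  proof -
    have "max 0 (?N x) = ?N x" for x using N0[of x] by simp
    then show ?thesis
      using gaussian_seminorm_doubling[OF M Z N s order_refl, of 1] by (simp add: B_def e_def)
  qed
  moreover have "15 / 16 * B \<le> measure M {x \<in> space M. ?N x \<le> s} * B"
    using P B by (rule mult_right_mono)
  ultimately have "15 / 16 * B \<le> 2 * e\<^sup>2" by simp
  also have "\<dots> \<le> 2 * (s + sqrt B / 4)\<^sup>2"
    using e_le e by (intro mult_left_mono power_mono) auto
  finally have key: "15 / 16 * (sqrt B)\<^sup>2 \<le> 2 * (s + sqrt B / 4)\<^sup>2" using B by simp
  \<comment> \<open>Otherwise \<open>s\<close> is below 5/12 of \<open>sqrt B\<close>, and 5/12 +
    1/4 = 2/3; but twice the square of 2/3 is 8/9, which is less than 15/16. The final constant 14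
    is \<open>2 + 2 * 6\<close>, with 6 above the square of 2.4.\<close>
  have "sqrt B \<le> 2.4 * s"
  proof (rule ccontr)
    assume "\<not> sqrt B \<le> 2.4 * s"
    then have "s + sqrt B / 4 \<le> 2 / 3 * sqrt B" "0 < sqrt B" using s by linarith+
    then have "(s + sqrt B / 4)\<^sup>2 \<le> (2 / 3 * sqrt B)\<^sup>2" "0 < (sqrt B)\<^sup>2"
      using s by (auto intro!: power_mono zero_less_power simp del: real_sqrt_pow2_iff real_sqrt_pow2)
    moreover have "(2 / 3 * sqrt B)\<^sup>2 = 4 / 9 * (sqrt B)\<^sup>2" by (simp only: power_mult_distrib) (simp add: power_divide)
    ultimately show False using key by linarith
  qed
  then have "(sqrt B)\<^sup>2 \<le> (2.4 * s)\<^sup>2" using B by (intro power_mono) auto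
  also have "(2.4 * s)\<^sup>2 = 144 / 25 * s\<^sup>2" by (simp only: power_mult_distrib) (simp add: power_divide)
  finally have "B \<le> 144 / 25 * s\<^sup>2" using B by simp
  then have B_le: "B \<le> 6 * s\<^sup>2" using zero_le_power2[of s] by linarith
  have "expectation (\<lambda>x. (?N x)\<^sup>2) \<le> expectation (\<lambda>x. 2 * s\<^sup>2 + 2 * (?T x)\<^sup>2)"
  proof (intro integral_mono Bochner_Integration.integrable_add integrable_mult_right iT2)
    show "integrable M (\<lambda>x. (?N x)\<^sup>2)" by (rule integrable_seminorm_power[OF M Z N])
    fix x
    have "?N x \<le> s + ?T x" by (auto simp: max_def)
    then have "(?N x)\<^sup>2 \<le> (s + ?T x)\<^sup>2" using N0 by (intro power_mono)
    also have "\<dots> \<le> 2 * s\<^sup>2 + 2 * (?T x)\<^sup>2"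
      using zero_le_power2[of "s - ?T x"] by (simp add: power2_eq_square algebra_simps)
    finally show "(?N x)\<^sup>2 \<le> 2 * s\<^sup>2 + 2 * (?T x)\<^sup>2" .
  qed simp
  also have "\<dots> = 2 * s\<^sup>2 + 2 * B" using iT2 prob_space by (simp add: B_def)
  finally show ?thesis using B_le by simp
qed

section \<open>The Sudakov-Fernique inequality\<close>

text \<open>Log-sum-exp, the smooth maximum. Its error \<open>ln (card I)\<close> does not depend on
  \<open>z\<close>, so it becomes negligible when \<open>z\<close> is multiplied by a large
  factor.\<close>

definition lse :: "'i set \<Rightarrow> ('i \<Rightarrow> real) \<Rightarrow> real" where
  "lse I z = ln (\<Sum>i\<in>I. exp (z i))"

lemma lse_bounds:
  assumes "finite I" "I \<noteq> {}"
  shows "i \<in> I \<Longrightarrow> z i \<le> lse I z"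
    and "(\<And>i. i \<in> I \<Longrightarrow> z i \<le> b) \<Longrightarrow> lse I z \<le> b + ln (real (card I))"
proof -
  have pos: "(\<Sum>i\<in>I. exp (z i)) > 0" using assms by (intro sum_pos) auto
  show "z i \<le> lse I z" if "i \<in> I"
  proof -
    have "exp (z i) \<le> (\<Sum>i\<in>I. exp (z i))" using assms that by (intro member_le_sum) auto
    then show ?thesis unfolding lse_def using pos by (simp add: ln_ge_iff)
  qed
  show "lse I z \<le> b + ln (real (card I))" if "\<And>i. i \<in> I \<Longrightarrow> z i \<le> b"
  proof -
    have c: "real (card I) > 0" using assms by (simp add: card_gt_0_iff)
    have "(\<Sum>i\<in>I. exp (z i)) \<le> real (card I) * exp b"
      using that by (intro sum_bounded_above) auto
    then have "lse I z \<le> ln (real (card I) * exp b)"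
      unfolding lse_def using pos c by (intro ln_mono) auto
    then show ?thesis using c by (simp add: ln_mult)
  qed
qed

lemma lse_abs_le:
  assumes "finite I" "I \<noteq> {}"
  shows "\<bar>lse I z\<bar> \<le> ln (real (card I)) + (\<Sum>i\<in>I. \<bar>z i\<bar>)"
proof -
  have le: "\<bar>z i\<bar> \<le> (\<Sum>i\<in>I. \<bar>z i\<bar>)" if "i \<in> I" for i
    using assms that by (intro member_le_sum) auto
  have "lse I z \<le> (\<Sum>i\<in>I. \<bar>z i\<bar>) + ln (real (card I))"
    using le by (intro lse_bounds(2) assms) (auto intro: order_trans[OF abs_ge_self])
  moreover obtain i where i: "i \<in> I" using assms by auto
  have "- (\<Sum>i\<in>I. \<bar>z i\<bar>) \<le> lse I z"
    using lse_bounds(1)[OF assms i, of z] le[OF i] by linarith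
  moreover have "ln (real (card I)) \<ge> 0" using assms by (simp add: Suc_leI card_gt_0_iff)
  ultimately show ?thesis by linarith
qed

text \<open>Writing the variance through pairs brings in the squared differences, the only
  quantities that the hypothesis of Sudakov-Fernique compares.\<close>

lemma weighted_variance:
  fixes p x :: "'i \<Rightarrow> real"
  assumes "(\<Sum>i\<in>I. p i) = 1"
  shows "(\<Sum>i\<in>I. p i * (x i)\<^sup>2) - (\<Sum>i\<in>I. p i * x i)\<^sup>2
    = (\<Sum>i\<in>I. \<Sum>j\<in>I. p i * p j * (x i - x j)\<^sup>2) / 2"
proof -
  have "(\<Sum>i\<in>I. \<Sum>j\<in>I. p i * p j * (x i - x j)\<^sup>2)
      = (\<Sum>i\<in>I. \<Sum>j\<in>I. (p i * (x i)\<^sup>2) * p j + p i * (p j * (x j)\<^sup>2) - 2 * ((p i * x i) * (p j * x j)))"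
    by (intro sum.cong refl) (simp add: power2_eq_square algebra_simps)
  also have "\<dots> = (\<Sum>i\<in>I. p i * (x i)\<^sup>2) * (\<Sum>j\<in>I. p j) + (\<Sum>i\<in>I. p i) * (\<Sum>j\<in>I. p j * (x j)\<^sup>2)
      - 2 * ((\<Sum>i\<in>I. p i * x i) * (\<Sum>j\<in>I. p j * x j))"
    by (simp only: sum_subtractf sum.distrib sum_product sum_distrib_left[symmetric])
  finally show ?thesis using assms by (simp add: power2_eq_square)
qed

text \<open>The derivatives of \<open>t \<mapsto> lse I (z + t x)\<close> are the cumulants of \<open>x\<close> under the Gibbs weights.\<close>

lemma lse_taylor:
  fixes z x :: "'i \<Rightarrow> real"
  assumes I: "finite I" "I \<noteq> {}" and K: "\<And>i. i \<in> I \<Longrightarrow> \<bar>x i\<bar> \<le> K"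
  defines "p \<equiv> \<lambda>i. exp (z i) / (\<Sum>i\<in>I. exp (z i))"
  shows "\<bar>lse I (\<lambda>i. z i + x i) - lse I z - (\<Sum>i\<in>I. p i * x i)
      - (\<Sum>i\<in>I. \<Sum>j\<in>I. p i * p j * (x i - x j)\<^sup>2) / 4\<bar> \<le> K ^ 3"
proof -
  define S where "S t = (\<Sum>i\<in>I. exp (z i + t * x i))" for t
  define R where "R k t = (\<Sum>i\<in>I. x i ^ k * exp (z i + t * x i))" for k t
  define m where "m k t = R k t / S t" for k t
  have S: "S t > 0" for t unfolding S_def using I by (intro sum_pos) auto
  have K0: "K \<ge> 0" using I K by (metis abs_ge_zero all_not_in_conv order_trans)
  have dS: "(S has_real_derivative R 1 t) (at t)" for t
    unfolding S_def R_def by (auto intro!: derivative_eq_intros sum.cong)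
  have dR: "(R k has_real_derivative R (Suc k) t) (at t)" for k t
    unfolding R_def by (auto intro!: derivative_eq_intros sum.cong)
  have dm: "(m k has_real_derivative (m (Suc k) t - m k t * m 1 t)) (at t)" for k t
  proof -
    have "((\<lambda>t. R k t / S t) has_real_derivative (R (Suc k) t * S t - R k t * R 1 t) / (S t * S t)) (at t)"
      using DERIV_divide[OF dR[of k t] dS[of t]] S[of t] by simp
    moreover have "(R (Suc k) t * S t - R k t * R 1 t) / (S t * S t) = m (Suc k) t - m k t * m 1 t"
      unfolding m_def using S[of t] by (simp add: field_simps)
    ultimately show ?thesis unfolding m_def by simp
  qed
  have mb: "\<bar>m k t\<bar> \<le> K ^ k" for k t
  proof -
    have "\<bar>R k t\<bar> \<le> (\<Sum>i\<in>I. K ^ k * exp (z i + t * x i))"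
      unfolding R_def by (intro order_trans[OF sum_abs] sum_mono)
        (auto simp: abs_mult power_abs intro!: mult_right_mono power_mono K)
    also have "\<dots> = K ^ k * S t" unfolding S_def by (simp add: sum_distrib_left)
    finally show ?thesis unfolding m_def using S[of t] by (simp add: pos_divide_le_eq)
  qed
  define g where "g t = ln (S t)" for t
  \<comment> \<open>The last branch is the third cumulant. As \<open>m k\<close> is at most
    \<open>K ^ k\<close> in modulus, it is bounded by \<open>(1 + 3 + 2) * K ^ 3\<close>, and the
    factor 6 cancels against \<open>fact 3\<close> in the Taylor formula.\<close>
  define D where "D n = (if n = 0 then g else if n = 1 then m 1 else if n = 2 then (\<lambda>t. m 2 t - m 1 t * m 1 t)
      else (\<lambda>t. m 3 t - 3 * m 1 t * m 2 t + 2 * (m 1 t) ^ 3))" for n :: nat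
  have "DERIV (D n) t :> D (Suc n) t" if "n < 3" for n t
  proof -
    have "n = 0 \<or> n = 1 \<or> n = 2" using that by linarith
    then consider "n = 0" | "n = 1" | "n = 2" by blast
    then show ?thesis
    proof cases
      case 1
      have "(g has_real_derivative R 1 t / S t) (at t)"
        unfolding g_def using S[of t] by (auto intro!: derivative_eq_intros dS)
      then show ?thesis using 1 by (simp add: D_def m_def)
    next
      case 2
      then show ?thesis using dm[of 1 t] by (simp add: D_def numeral_2_eq_2)
    next
      case 3
      have "((\<lambda>t. m 2 t - m 1 t * m 1 t) has_real_derivative
          (m 3 t - m 2 t * m 1 t) - ((m 2 t - m 1 t * m 1 t) * m 1 t + (m 2 t - m 1 t * m 1 t) * m 1 t)) (at t)"
        using dm[of 2 t] dm[of 1 t] by (intro DERIV_diff DERIV_mult) (simp_all add: numeral_2_eq_2 numeral_3_eq_3)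
      then show ?thesis using 3 by (simp add: D_def algebra_simps power3_eq_cube)
    qed
  qed
  then obtain t where t: "g 1 = (\<Sum>n<3. D n 0 / fact n * 1 ^ n) + D 3 t / fact 3 * 1 ^ 3"
    using Maclaurin[of 1 3 D g] by (auto simp: D_def)
  have "(\<Sum>n<3. D n 0 / fact n * 1 ^ n) = g 0 + m 1 0 + (m 2 0 - m 1 0 * m 1 0) / 2"
    by (simp add: D_def numeral_3_eq_3)
  with t have e: "g 1 - g 0 - m 1 0 - (m 2 0 - (m 1 0)\<^sup>2) / 2 = D 3 t / 6"
    by (simp add: fact_numeral power2_eq_square)
  have "\<bar>D 3 t\<bar> \<le> \<bar>m 3 t\<bar> + 3 * (\<bar>m 1 t\<bar> * \<bar>m 2 t\<bar>) + 2 * \<bar>m 1 t\<bar> ^ 3"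
  proof -
    have "\<bar>a - 3 * b * c + 2 * b ^ 3\<bar> \<le> \<bar>a\<bar> + 3 * (\<bar>b\<bar> * \<bar>c\<bar>) + 2 * \<bar>b\<bar> ^ 3" for a b c :: real
      using abs_mult[of b c] power_abs[of b 3] by (simp only: mult.assoc) linarith
    then show ?thesis by (simp add: D_def)
  qed
  also have "\<dots> \<le> K ^ 3 + 3 * (K ^ 1 * K ^ 2) + 2 * (K ^ 1) ^ 3"
    using K0 by (intro add_mono mult_left_mono mult_mono power_mono mb) (simp_all del: One_nat_def power_one_right)
  also have "\<dots> = 6 * K ^ 3" by (simp add: power3_eq_cube power2_eq_square)
  finally have D3: "\<bar>D 3 t / 6\<bar> \<le> K ^ 3" by simp
  have p0: "m k 0 = (\<Sum>i\<in>I. p i * x i ^ k)" for k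
    unfolding m_def R_def S_def p_def by (simp add: sum_divide_distrib mult.commute)
  have "(\<Sum>i\<in>I. p i) = 1"
    unfolding p_def sum_divide_distrib[symmetric] using S[of 0] by (simp add: S_def)
  then have "(\<Sum>i\<in>I. p i * (x i)\<^sup>2) - (\<Sum>i\<in>I. p i * x i)\<^sup>2
    = (\<Sum>i\<in>I. \<Sum>j\<in>I. p i * p j * (x i - x j)\<^sup>2) / 2"
    by (rule weighted_variance)
  then have "(m 2 0 - (m 1 0)\<^sup>2) / 2 = (\<Sum>i\<in>I. \<Sum>j\<in>I. p i * p j * (x i - x j)\<^sup>2) / 4"
    unfolding p0 by simp
  moreover have "m 1 0 = (\<Sum>i\<in>I. p i * x i)" unfolding p0 by simp
  moreover have "g 1 = lse I (\<lambda>i. z i + x i)" "g 0 = lse I z"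
    unfolding g_def S_def lse_def by simp_all
  ultimately show ?thesis using e D3 by (simp only:)
qed

lemma lse_measurable:
  assumes "\<And>i. i \<in> I \<Longrightarrow> f i \<in> borel_measurable M"
  shows "(\<lambda>x. lse I (\<lambda>i. f i x)) \<in> borel_measurable M"
  unfolding lse_def using assms by measurable

lemma lse_integrable:
  assumes I: "finite I" "I \<noteq> {}" and "prob_space M" and i: "\<And>i. i \<in> I \<Longrightarrow> integrable M (f i)"
  shows "integrable M (\<lambda>x. lse I (\<lambda>i. f i x))"
proof -
  interpret prob_space M by fact
  have "integrable M (\<lambda>x. ln (real (card I)) + (\<Sum>i\<in>I. \<bar>f i x\<bar>))"
    using i by (intro Bochner_Integration.integrable_add Bochner_Integration.integrable_sum) auto
  then show ?thesis
    by (rule Bochner_Integration.integrable_bound)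
      (use lse_abs_le[OF I] i in \<open>auto intro!: lse_measurable always_eventually simp: abs_of_nonneg sum_nonneg intro: order_trans[OF _ abs_ge_self]\<close>)
qed

lemma gaussian_family_integrable:
  assumes "prob_space M" "gaussian_family M I X" "i \<in> I"
  shows "integrable M (X i)" "(\<integral>x. X i x \<partial>M) = 0" "integrable M (\<lambda>x. \<bar>X i x\<bar> ^ k)"
  using gaussian_family_component[OF assms(2,3)] prob_space.normal_rv_moments[OF assms(1)] by auto

lemma gaussian_family_power2_diff_integrable:
  assumes "prob_space M" "gaussian_family M I X" "i \<in> I" "j \<in> I"
  shows "integrable M (\<lambda>x. (X i x - X j x)\<^sup>2)"
proof -
  have [measurable]: "X i \<in> borel_measurable M" "X j \<in> borel_measurable M"
    using gaussian_family_measurable[OF assms(2)] assms by auto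
  have "integrable M (\<lambda>x. 2 * (X i x)\<^sup>2 + 2 * (X j x)\<^sup>2)"
    using gaussian_family_integrable(3)[OF assms(1,2), of i 2] gaussian_family_integrable(3)[OF assms(1,2), of j 2] assms
    by (intro Bochner_Integration.integrable_add integrable_mult_right) auto
  moreover have "(a - b)\<^sup>2 \<le> 2 * a\<^sup>2 + 2 * b\<^sup>2" for a b :: real
    using zero_le_power2[of "a + b"] by (simp add: power2_eq_square algebra_simps)
  ultimately show ?thesis
    by (elim Bochner_Integration.integrable_bound) auto
qed

text \<open>Integrating \<open>lse_taylor\<close> removes the linear term, since the family is
  centered. What matters is that \<open>C\<close> depends neither on \<open>z\<close> nor on
  \<open>s\<close>: the error of order \<open>s * sqrt s\<close> can then be summed over
  \<open>1 / s\<close> steps started at arbitrary random points.\<close>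

lemma lse_gaussian_expansion:
  assumes M: "prob_space M" and X: "gaussian_family M I X" and I: "I \<noteq> {}"
  defines "p \<equiv> \<lambda>z i. exp (z i) / (\<Sum>i\<in>I. exp (z i))"
  shows "\<exists>C\<ge>0. \<forall>s\<ge>0. \<forall>z. \<bar>(\<integral>x. lse I (\<lambda>i. z i + sqrt s * X i x) \<partial>M) - lse I z
      - s / 4 * (\<Sum>i\<in>I. \<Sum>j\<in>I. p z i * p z j * (\<integral>x. (X i x - X j x)\<^sup>2 \<partial>M))\<bar> \<le> s * sqrt s * C"
proof -
  interpret prob_space M by fact
  have fI: "finite I" using X by (rule gaussian_family_finite)
  note iX = gaussian_family_integrable[OF M X]
  note iX2 = gaussian_family_power2_diff_integrable[OF M X]
  have iK: "integrable M (\<lambda>x. (\<Sum>i\<in>I. \<bar>X i x\<bar>) ^ 3)"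
  proof (rule Bochner_Integration.integrable_bound)
    show "integrable M (\<lambda>x. real (card I) ^ 3 * (1 + (\<Sum>i\<in>I. \<bar>X i x\<bar> ^ 3)))"
      using iX(3) by (intro integrable_mult_right Bochner_Integration.integrable_add Bochner_Integration.integrable_sum) auto
    show "(\<lambda>x. (\<Sum>i\<in>I. \<bar>X i x\<bar>) ^ 3) \<in> borel_measurable M"
      using gaussian_family_measurable[OF X] by measurable
    show "AE x in M. norm ((\<Sum>i\<in>I. \<bar>X i x\<bar>) ^ 3) \<le> norm (real (card I) ^ 3 * (1 + (\<Sum>i\<in>I. \<bar>X i x\<bar> ^ 3)))"
      using sum_power_le[OF fI, of "\<lambda>i. \<bar>X i x\<bar>" 3 for x]
      by (intro always_eventually allI) (auto simp: abs_mult abs_of_nonneg sum_nonneg power_abs)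
  qed
  define C where "C = expectation (\<lambda>x. (\<Sum>i\<in>I. \<bar>X i x\<bar>) ^ 3)"
  have "C \<ge> 0" unfolding C_def by (simp add: sum_nonneg)
  moreover have "\<bar>(\<integral>x. lse I (\<lambda>i. z i + sqrt s * X i x) \<partial>M) - lse I z
      - s / 4 * (\<Sum>i\<in>I. \<Sum>j\<in>I. p z i * p z j * (\<integral>x. (X i x - X j x)\<^sup>2 \<partial>M))\<bar> \<le> s * sqrt s * C"
    if s: "s \<ge> 0" for s z
  proof -
    let ?P = "p z"
    let ?L = "\<lambda>x. lse I (\<lambda>i. z i + sqrt s * X i x)"
    let ?V = "\<lambda>x. (\<Sum>i\<in>I. \<Sum>j\<in>I. ?P i * ?P j * (X i x - X j x)\<^sup>2)"
    have iL: "integrable M ?L"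
      by (intro lse_integrable fI I M Bochner_Integration.integrable_add integrable_mult_right iX(1)) auto
    have iV: "integrable M ?V"
      by (intro Bochner_Integration.integrable_sum integrable_mult_right iX2)
    have il: "integrable M (\<lambda>x. \<Sum>i\<in>I. ?P i * (sqrt s * X i x))"
      by (intro Bochner_Integration.integrable_sum integrable_mult_right iX(1))
    have EV: "expectation ?V = (\<Sum>i\<in>I. \<Sum>j\<in>I. ?P i * ?P j * (\<integral>x. (X i x - X j x)\<^sup>2 \<partial>M))"
      using iX2 by (simp add: Bochner_Integration.integral_sum Bochner_Integration.integrable_sum)
    have El: "expectation (\<lambda>x. \<Sum>i\<in>I. ?P i * (sqrt s * X i x)) = 0"
      using iX by (simp add: Bochner_Integration.integral_sum)
    define rem where "rem x = ?L x - lse I z - (\<Sum>i\<in>I. ?P i * (sqrt s * X i x)) - s / 4 * ?V x" for x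
    have irem: "integrable M rem"
      unfolding rem_def using iL iV il by (intro Bochner_Integration.integrable_diff integrable_mult_right) auto
    have Erem: "expectation rem = expectation ?L - lse I z - s / 4 * expectation ?V"
      unfolding rem_def using iL iV il El prob_space by simp
    have "\<bar>rem x\<bar> \<le> (s * sqrt s) * (\<Sum>i\<in>I. \<bar>X i x\<bar>) ^ 3" for x
    proof -
      have "\<bar>sqrt s * X i x\<bar> \<le> sqrt s * (\<Sum>i\<in>I. \<bar>X i x\<bar>)" if "i \<in> I" for i
        using that fI s by (auto simp: abs_mult intro!: mult_left_mono member_le_sum)
      from lse_taylor[of I "\<lambda>i. sqrt s * X i x" _ z, OF fI I this]
      have "\<bar>?L x - lse I z - (\<Sum>i\<in>I. ?P i * (sqrt s * X i x))
        - (\<Sum>i\<in>I. \<Sum>j\<in>I. ?P i * ?P j * (sqrt s * X i x - sqrt s * X j x)\<^sup>2) / 4\<bar> \<le> (sqrt s * (\<Sum>i\<in>I. \<bar>X i x\<bar>)) ^ 3"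
        unfolding p_def by simp
      moreover have "(\<Sum>i\<in>I. \<Sum>j\<in>I. ?P i * ?P j * (sqrt s * X i x - sqrt s * X j x)\<^sup>2) / 4 = s / 4 * ?V x"
      proof -
        have "(sqrt s * X i x - sqrt s * X j x)\<^sup>2 = s * (X i x - X j x)\<^sup>2" for i j
          using s by (simp add: right_diff_distrib[symmetric] power_mult_distrib)
        then show ?thesis by (simp add: sum_distrib_left sum_divide_distrib mult_ac)
      qed
      moreover have "(sqrt s * (\<Sum>i\<in>I. \<bar>X i x\<bar>)) ^ 3 = (s * sqrt s) * (\<Sum>i\<in>I. \<bar>X i x\<bar>) ^ 3"
        using s by (simp add: power_mult_distrib power3_eq_cube)
      ultimately show ?thesis unfolding rem_def by simp
    qed
    then have "expectation (\<lambda>x. \<bar>rem x\<bar>) \<le> expectation (\<lambda>x. (s * sqrt s) * (\<Sum>i\<in>I. \<bar>X i x\<bar>) ^ 3)"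
      using irem iK by (intro integral_mono) auto
    then have "\<bar>expectation rem\<bar> \<le> s * sqrt s * C"
      unfolding C_def integral_mult_right_zero by (rule order_trans[OF integral_abs_bound])
    then show ?thesis using Erem EV by simp
  qed
  ultimately show ?thesis by blast
qed

text \<open>A Gaussian step of variance \<open>a + b\<close> is a step of variance \<open>b\<close>
  followed by an independent one of variance \<open>a\<close>. This is a rotation with cosine
  \<open>sqrt (b / (a + b))\<close>, applied to an \<open>H\<close> that ignores its second
  argument.\<close>

lemma lse_semigroup:
  assumes M: "prob_space M" and X: "gaussian_family M I X" and I: "I \<noteq> {}" and ab: "0 \<le> a" "0 < b"
  shows "(\<integral>x. lse I (\<lambda>i. z i + sqrt (a + b) * X i x) \<partial>M)
    = (\<integral>y. \<integral>x. lse I (\<lambda>i. (z i + sqrt b * X i y) + sqrt a * X i x) \<partial>M \<partial>M)"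
proof -
  interpret M: prob_space M by fact
  interpret P: pair_prob_space M M ..
  have fI: "finite I" using X by (rule gaussian_family_finite)
  note [measurable] = gaussian_family_measurable[OF X]
  note iX = gaussian_family_integrable(1)[OF M X]
  have c: "sqrt (a + b) * sqrt (a / (a + b)) = sqrt a" "sqrt (a + b) * sqrt (b / (a + b)) = sqrt b"
    using ab by (simp_all add: real_sqrt_divide)
  have u: "(sqrt (b / (a + b)))\<^sup>2 + (sqrt (a / (a + b)))\<^sup>2 = 1"
    using ab by (simp add: add_divide_distrib[symmetric])
  define H where "H v w = lse I (\<lambda>i. z i + sqrt (a + b) * v i)" for v w :: "'b \<Rightarrow> real"
  have Hm: "(\<lambda>z. H (fst z) (snd z)) \<in> borel_measurable (Pi\<^sub>M I (\<lambda>_. borel) \<Otimes>\<^sub>M Pi\<^sub>M I (\<lambda>_. borel))"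
    unfolding H_def by (intro lse_measurable) measurable
  have Hr: "H (restrict v I) (restrict w I) = H v w" for v w
    unfolding H_def lse_def by (simp cong: sum.cong)
  have ifst: "integrable (M \<Otimes>\<^sub>M M) (\<lambda>z. X i (fst z))" "integrable (M \<Otimes>\<^sub>M M) (\<lambda>z. X i (snd z))" if "i \<in> I" for i
    using P.integrable_pair_mult[OF iX[OF that] M.integrable_const[of 1]] P.integrable_pair_mult[OF M.integrable_const[of 1] iX[OF that]]
    by simp_all
  have "(\<integral>x. lse I (\<lambda>i. z i + sqrt (a + b) * X i x) \<partial>M)
      = (\<integral>x. \<integral>y. lse I (\<lambda>i. z i + sqrt (a + b) * X i (fst (x, y))) \<partial>M \<partial>M)"
    by (simp add: M.prob_space)
  also have "\<dots> = (\<integral>w. H (\<lambda>i. X i (fst w)) (\<lambda>i. X i (snd w)) \<partial>(M \<Otimes>\<^sub>M M))"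
    unfolding H_def by (rule P.integral_fst')
      (intro lse_integrable fI I P.prob_space_axioms Bochner_Integration.integrable_add integrable_mult_right ifst; simp)
  also have "\<dots> = (\<integral>w. H (\<lambda>i. sqrt (b / (a + b)) * X i (fst w) + sqrt (a / (a + b)) * X i (snd w))
      (\<lambda>i. sqrt (a / (a + b)) * X i (fst w) - sqrt (b / (a + b)) * X i (snd w)) \<partial>(M \<Otimes>\<^sub>M M))"
    by (rule gaussian_family_rotation_integral(2)[where H=H and J=I and Z=X, OF M X u Hm Hr, symmetric])
  also have "\<dots> = (\<integral>w. lse I (\<lambda>i. (z i + sqrt b * X i (fst w)) + sqrt a * X i (snd w)) \<partial>(M \<Otimes>\<^sub>M M))"
    unfolding H_def distrib_left mult.assoc[symmetric] c by (simp add: add.assoc)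
  also have "\<dots> = (\<integral>y. \<integral>x. lse I (\<lambda>i. (z i + sqrt b * X i (fst (y, x))) + sqrt a * X i (snd (y, x))) \<partial>M \<partial>M)"
    by (rule P.integral_fst'[symmetric])
      (intro lse_integrable fI I P.prob_space_axioms Bochner_Integration.integrable_add integrable_mult_right ifst; simp)
  finally show ?thesis by simp
qed


lemma lse_pair_integrable:
  assumes M: "prob_space M1" "prob_space M2" and X: "gaussian_family M1 I X" and Y: "gaussian_family M2 I Y"
    and I: "I \<noteq> {}"
  shows "integrable (M1 \<Otimes>\<^sub>M M2) (\<lambda>(x, y). lse I (\<lambda>i. (z i + a * X i x) + b * Y i y))"
    and "integrable M1 (\<lambda>x. \<integral>y. lse I (\<lambda>i. (z i + a * X i x) + b * Y i y) \<partial>M2)"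
proof -
  interpret M1: prob_space M1 by fact
  interpret M2: prob_space M2 by fact
  interpret P: pair_prob_space M1 M2 ..
  have fI: "finite I" using X by (rule gaussian_family_finite)
  note iX = gaussian_family_integrable(1)[OF M(1) X] and iY = gaussian_family_integrable(1)[OF M(2) Y]
  have iPX: "integrable (M1 \<Otimes>\<^sub>M M2) (\<lambda>w. X i (fst w))" and iPY: "integrable (M1 \<Otimes>\<^sub>M M2) (\<lambda>w. Y i (snd w))" if "i \<in> I" for i
    using P.integrable_pair_mult[OF iX[OF that] M2.integrable_const[of 1]] P.integrable_pair_mult[OF M1.integrable_const[of 1] iY[OF that]]
    by simp_all
  show i: "integrable (M1 \<Otimes>\<^sub>M M2) (\<lambda>(x, y). lse I (\<lambda>i. (z i + a * X i x) + b * Y i y))"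
    using iPX iPY unfolding split_beta
    by (intro lse_integrable fI I P.prob_space_axioms Bochner_Integration.integrable_add integrable_mult_right) auto
  show "integrable M1 (\<lambda>x. \<integral>y. lse I (\<lambda>i. (z i + a * X i x) + b * Y i y) \<partial>M2)"
    using P.integrable_fst[OF i] .
qed

text \<open>Unit time is cut into \<open>n\<close> steps, and the steps of \<open>X\<close> are
  exchanged for steps of \<open>Y\<close> one by one. An exchange costs at most
  \<open>s * sqrt s * C\<close> with \<open>s = 1 / n\<close>, hence all of them together at most
  \<open>C / sqrt n\<close>. The two families live on different spaces; the product measure makes
  them independent.\<close>

lemma lse_comparison:
  assumes M: "prob_space M1" "prob_space M2" and X: "gaussian_family M1 I X" and Y: "gaussian_family M2 I Y"
    and I: "I \<noteq> {}"
    and le: "\<And>i j. i \<in> I \<Longrightarrow> j \<in> I \<Longrightarrow> (\<integral>x. (X i x - X j x)\<^sup>2 \<partial>M1) \<le> (\<integral>x. (Y i x - Y j x)\<^sup>2 \<partial>M2)"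
  shows "(\<integral>x. lse I (\<lambda>i. X i x) \<partial>M1) \<le> (\<integral>x. lse I (\<lambda>i. Y i x) \<partial>M2)"
proof -
  interpret M1: prob_space M1 by fact
  interpret M2: prob_space M2 by fact
  interpret P: pair_prob_space M1 M2 ..
  have fI: "finite I" using X by (rule gaussian_family_finite)
  note iX = gaussian_family_integrable(1)[OF M(1) X] and iY = gaussian_family_integrable(1)[OF M(2) Y]
  define p where "p z i = exp (z i) / (\<Sum>i\<in>I. exp (z i))" for z :: "_ \<Rightarrow> real" and i
  have p0: "0 \<le> p z i" for z i unfolding p_def by (simp add: sum_nonneg)
  obtain C1 where C1: "C1 \<ge> 0" "\<And>s z. s \<ge> 0 \<Longrightarrow> \<bar>(\<integral>x. lse I (\<lambda>i. z i + sqrt s * X i x) \<partial>M1) - lse I z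
      - s / 4 * (\<Sum>i\<in>I. \<Sum>j\<in>I. p z i * p z j * (\<integral>x. (X i x - X j x)\<^sup>2 \<partial>M1))\<bar> \<le> s * sqrt s * C1"
    using lse_gaussian_expansion[OF M(1) X I] unfolding p_def by blast
  obtain C2 where C2: "C2 \<ge> 0" "\<And>s z. s \<ge> 0 \<Longrightarrow> \<bar>(\<integral>x. lse I (\<lambda>i. z i + sqrt s * Y i x) \<partial>M2) - lse I z
      - s / 4 * (\<Sum>i\<in>I. \<Sum>j\<in>I. p z i * p z j * (\<integral>x. (Y i x - Y j x)\<^sup>2 \<partial>M2))\<bar> \<le> s * sqrt s * C2"
    using lse_gaussian_expansion[OF M(2) Y I] unfolding p_def by blast
  define A where "A s z = (\<integral>x. lse I (\<lambda>i. z i + sqrt s * X i x) \<partial>M1)" for s z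
  define B where "B s z = (\<integral>x. lse I (\<lambda>i. z i + sqrt s * Y i x) \<partial>M2)" for s z
  define C where "C = C1 + C2"
  \<comment> \<open>The zeroth-order terms coincide, and the second-order terms are ordered by
    \<open>le\<close> because the Gibbs weights are nonnegative.\<close>
  have one: "A s z \<le> B s z + s * sqrt s * C" if "s \<ge> 0" for s z
  proof -
    have "s / 4 * (\<Sum>i\<in>I. \<Sum>j\<in>I. p z i * p z j * (\<integral>x. (X i x - X j x)\<^sup>2 \<partial>M1))
        \<le> s / 4 * (\<Sum>i\<in>I. \<Sum>j\<in>I. p z i * p z j * (\<integral>x. (Y i x - Y j x)\<^sup>2 \<partial>M2))"
      using that by (intro mult_left_mono sum_mono le mult_nonneg_nonneg p0) auto
    then show ?thesis
      using C1(2)[OF that, of z] C2(2)[OF that, of z] unfolding A_def B_def C_def distrib_left by linarith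
  qed
  \<comment> \<open>The starting point has to be arbitrary: the induction hypothesis is used at the
    random point reached after one step of \<open>X\<close>.\<close>
  have steps: "A (real k * s) z \<le> B (real k * s) z + real k * (s * sqrt s * C)" if s: "s > 0" for k s z
  proof (induction k arbitrary: z)
    case 0
    show ?case by (simp add: A_def B_def M1.prob_space M2.prob_space)
  next
    case (Suc k)
    let ?a = "sqrt s" and ?b = "sqrt (real k * s)" and ?e = "s * sqrt s * C"
    have ks: "real (Suc k) * s = real k * s + s" by (simp add: algebra_simps)
    have "A (real (Suc k) * s) z = (\<integral>x. A (real k * s) (\<lambda>i. z i + ?a * X i x) \<partial>M1)"
      unfolding A_def ks using lse_semigroup[OF M(1) X I, of "real k * s" s z] s by simp
    also have "\<dots> \<le> (\<integral>x. B (real k * s) (\<lambda>i. z i + ?a * X i x) + real k * ?e \<partial>M1)"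
    proof (rule integral_mono)
      show "integrable M1 (\<lambda>x. A (real k * s) (\<lambda>i. z i + ?a * X i x))"
        unfolding A_def by (rule lse_pair_integrable(2)[OF M(1,1) X X I])
      show "integrable M1 (\<lambda>x. B (real k * s) (\<lambda>i. z i + ?a * X i x) + real k * ?e)"
        unfolding B_def
        by (intro Bochner_Integration.integrable_add lse_pair_integrable(2)[OF M X Y I] M1.integrable_const)
    qed (rule Suc.IH)
    also have "\<dots> = (\<integral>x. \<integral>y. lse I (\<lambda>i. (z i + ?a * X i x) + ?b * Y i y) \<partial>M2 \<partial>M1) + real k * ?e"
      unfolding B_def using lse_pair_integrable(2)[OF M X Y I, of z ?a ?b] by (simp add: M1.prob_space)
    \<comment> \<open>With the \<open>k\<close> steps of \<open>Y\<close> moved to the outer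
      integral, the remaining step of \<open>X\<close> becomes the innermost one and can be
      exchanged by \<open>one\<close>.\<close>
    also have "(\<integral>x. \<integral>y. lse I (\<lambda>i. (z i + ?a * X i x) + ?b * Y i y) \<partial>M2 \<partial>M1)
        = (\<integral>y. \<integral>x. lse I (\<lambda>i. (z i + ?a * X i x) + ?b * Y i y) \<partial>M1 \<partial>M2)"
      by (rule P.Fubini_integral[OF lse_pair_integrable(1)[OF M X Y I], symmetric])
    also have "\<dots> = (\<integral>y. A s (\<lambda>i. z i + ?b * Y i y) \<partial>M2)"
      unfolding A_def by (simp add: add_ac)
    also have "\<dots> \<le> (\<integral>y. B s (\<lambda>i. z i + ?b * Y i y) + ?e \<partial>M2)"
    proof (rule integral_mono)
      show "integrable M2 (\<lambda>y. A s (\<lambda>i. z i + ?b * Y i y))"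
        unfolding A_def by (rule lse_pair_integrable(2)[OF M(2,1) Y X I])
      show "integrable M2 (\<lambda>y. B s (\<lambda>i. z i + ?b * Y i y) + ?e)"
        unfolding B_def
        by (intro Bochner_Integration.integrable_add lse_pair_integrable(2)[OF M(2,2) Y Y I] M2.integrable_const)
    qed (use one s in simp)
    also have "\<dots> = (\<integral>y. B s (\<lambda>i. z i + ?b * Y i y) \<partial>M2) + ?e"
      unfolding B_def using lse_pair_integrable(2)[OF M(2,2) Y Y I, of z ?b ?a] by (simp add: M2.prob_space)
    \<comment> \<open>\<open>lse_semigroup\<close> needs a positive variance for the outer step,
      hence the separate case \<open>k = 0\<close>.\<close>
    also have "(\<integral>y. B s (\<lambda>i. z i + ?b * Y i y) \<partial>M2) = B (real (Suc k) * s) z"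
    proof (cases "k = 0")
      case True
      then show ?thesis by (simp add: M2.prob_space)
    next
      case False
      then have "real k * s > 0" using s by simp
      then show ?thesis
        unfolding B_def ks using lse_semigroup[OF M(2) Y I, of s "real k * s" z] s by (simp add: add.commute)
    qed
    finally show ?case by (simp add: algebra_simps)
  qed
  have "A 1 (\<lambda>_. 0) \<le> B 1 (\<lambda>_. 0) + sqrt (1 / real n) * C" if "n \<ge> 1" for n :: nat
    using steps[of "1 / real n" n "\<lambda>_. 0"] that by simp
  then have "\<exists>N. \<forall>n\<ge>N. A 1 (\<lambda>_. 0) \<le> B 1 (\<lambda>_. 0) + sqrt (1 / real n) * C" by blast
  moreover have "(\<lambda>n. B 1 (\<lambda>_. 0) + sqrt (1 / real n) * C) \<longlonglongrightarrow> B 1 (\<lambda>_. 0) + sqrt 0 * C"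
    by (intro tendsto_intros lim_1_over_n)
  ultimately have "A 1 (\<lambda>_. 0) \<le> B 1 (\<lambda>_. 0) + sqrt 0 * C"
    by (intro LIMSEQ_le_const)
  then show ?thesis by (simp add: A_def B_def)
qed

lemma gaussian_family_Max_integrable:
  assumes "prob_space M" "gaussian_family M I Z" and I: "I \<noteq> {}"
  shows "integrable M (\<lambda>x. MAX i\<in>I. Z i x)"
proof (rule Bochner_Integration.integrable_bound)
  have fI: "finite I" using assms(2) by (rule gaussian_family_finite)
  show "integrable M (\<lambda>x. \<Sum>i\<in>I. \<bar>Z i x\<bar>)"
    using gaussian_family_integrable(1)[OF assms(1,2)] by (intro Bochner_Integration.integrable_sum) auto
  show "(\<lambda>x. MAX i\<in>I. Z i x) \<in> borel_measurable M"
    using gaussian_family_measurable[OF assms(2)] by (intro borel_measurable_Max fI) auto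
  have "\<bar>MAX i\<in>I. Z i x\<bar> \<le> (\<Sum>i\<in>I. \<bar>Z i x\<bar>)" for x
  proof -
    have "(MAX i\<in>I. Z i x) \<in> (\<lambda>i. Z i x) ` I" using fI I by (intro Max_in) auto
    then obtain i where "i \<in> I" "(MAX i\<in>I. Z i x) = Z i x" by auto
    then show ?thesis using fI by (auto intro!: member_le_sum)
  qed
  then show "AE x in M. norm (MAX i\<in>I. Z i x) \<le> norm (\<Sum>i\<in>I. \<bar>Z i x\<bar>)"
    by (intro always_eventually) (auto simp: abs_of_nonneg sum_nonneg)
qed

text \<open>\<open>\<beta>\<close> is an inverse temperature: both families are scaled by it, which
  preserves the order of the increments, and after division by \<open>\<beta>\<close> the error of
  the smooth maximum is \<open>ln (card I) / \<beta>\<close>. Letting \<open>\<beta>\<close> tend to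
  infinity along the integers removes it.\<close>

theorem sudakov_fernique:
  assumes M: "prob_space M1" "prob_space M2" and X: "gaussian_family M1 I X" and Y: "gaussian_family M2 I Y"
    and I: "I \<noteq> {}"
    and le: "\<And>i j. i \<in> I \<Longrightarrow> j \<in> I \<Longrightarrow> (\<integral>x. (X i x - X j x)\<^sup>2 \<partial>M1) \<le> (\<integral>x. (Y i x - Y j x)\<^sup>2 \<partial>M2)"
  shows "(\<integral>x. (MAX i\<in>I. X i x) \<partial>M1) \<le> (\<integral>x. (MAX i\<in>I. Y i x) \<partial>M2)"
proof -
  interpret M1: prob_space M1 by fact
  interpret M2: prob_space M2 by fact
  have fI: "finite I" using X by (rule gaussian_family_finite)
  note iM = gaussian_family_Max_integrable[OF _ _ I]
  let ?c = "ln (real (card I))"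
  have bound: "(\<integral>x. (MAX i\<in>I. X i x) \<partial>M1) \<le> (\<integral>x. (MAX i\<in>I. Y i x) \<partial>M2) + 1 / \<beta> * ?c" if b: "\<beta> > 0" for \<beta>
  proof -
    have scale: "gaussian_family M I (\<lambda>i x. \<beta> * Z i x)" if "gaussian_family M I Z" for M :: "'x measure" and Z
    proof -
      have "(\<Sum>i\<in>I. c i * (\<beta> * Z i x)) = (\<Sum>i\<in>I. (c i * \<beta>) * Z i x)" for c x by (simp add: mult.assoc)
      then show ?thesis using that unfolding gaussian_family_def by simp
    qed
    have sq: "(\<beta> * u - \<beta> * v)\<^sup>2 = \<beta>\<^sup>2 * (u - v)\<^sup>2" for u v
      by (simp only: right_diff_distrib[symmetric] power_mult_distrib)
    have "\<beta> * (\<integral>x. (MAX i\<in>I. X i x) \<partial>M1) = (\<integral>x. \<beta> * (MAX i\<in>I. X i x) \<partial>M1)" by simp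
    also have "\<dots> \<le> (\<integral>x. lse I (\<lambda>i. \<beta> * X i x) \<partial>M1)"
    proof (rule integral_mono)
      show "integrable M1 (\<lambda>x. \<beta> * (MAX i\<in>I. X i x))" using iM[OF M(1) X] by simp
      show "integrable M1 (\<lambda>x. lse I (\<lambda>i. \<beta> * X i x))"
        using gaussian_family_integrable(1)[OF M(1) X] by (intro lse_integrable fI I M) auto
      fix x
      have "(MAX i\<in>I. X i x) \<in> (\<lambda>i. X i x) ` I" using fI I by (intro Max_in) auto
      then obtain i where "i \<in> I" "(MAX i\<in>I. X i x) = X i x" by auto
      then show "\<beta> * (MAX i\<in>I. X i x) \<le> lse I (\<lambda>i. \<beta> * X i x)"
        using lse_bounds(1)[OF fI I, of i "\<lambda>i. \<beta> * X i x"] by simp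
    qed
    also have "\<dots> \<le> (\<integral>x. lse I (\<lambda>i. \<beta> * Y i x) \<partial>M2)"
      by (rule lse_comparison[OF M scale[OF X] scale[OF Y] I]) (use le in \<open>simp add: sq mult_left_mono\<close>)
    also have "\<dots> \<le> (\<integral>x. \<beta> * (MAX i\<in>I. Y i x) + ?c \<partial>M2)"
    proof (rule integral_mono)
      show "integrable M2 (\<lambda>x. \<beta> * (MAX i\<in>I. Y i x) + ?c)" using iM[OF M(2) Y] by simp
      show "integrable M2 (\<lambda>x. lse I (\<lambda>i. \<beta> * Y i x))"
        using gaussian_family_integrable(1)[OF M(2) Y] by (intro lse_integrable fI I M) auto
      fix x
      show "lse I (\<lambda>i. \<beta> * Y i x) \<le> \<beta> * (MAX i\<in>I. Y i x) + ?c"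
        using fI b by (intro lse_bounds(2) I) auto
    qed
    also have "\<dots> = \<beta> * (\<integral>x. (MAX i\<in>I. Y i x) \<partial>M2) + ?c"
      using iM[OF M(2) Y] by (simp add: M2.prob_space)
    finally show ?thesis using b by (simp add: field_simps)
  qed
  have "(\<lambda>n. (\<integral>x. (MAX i\<in>I. Y i x) \<partial>M2) + 1 / real n * ?c) \<longlonglongrightarrow> (\<integral>x. (MAX i\<in>I. Y i x) \<partial>M2) + 0 * ?c"
    by (intro tendsto_intros lim_1_over_n)
  then have "(\<integral>x. (MAX i\<in>I. X i x) \<partial>M1) \<le> (\<integral>x. (MAX i\<in>I. Y i x) \<partial>M2) + 0 * ?c"
    by (rule LIMSEQ_le_const) (use bound in \<open>auto intro!: exI[of _ 1]\<close>)
  then show ?thesis by simp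
qed

section \<open>The decoupled chaos of a Gaussian sample\<close>

lemma measurable_seminorm_Max:
  assumes K: "finite K" "K \<noteq> {}" and N: "\<And>k. k \<in> K \<Longrightarrow> measurable_seminorm J (N k)"
  shows "measurable_seminorm J (\<lambda>x. MAX k\<in>K. N k x)"
  unfolding measurable_seminorm_def
proof (intro conjI allI)
  show "(\<lambda>x. MAX k\<in>K. N k x) \<in> borel_measurable (Pi\<^sub>M J (\<lambda>_. borel))"
    using measurable_seminorm_D(1)[OF N] K by (intro borel_measurable_Max) auto
  obtain k0 where k0: "k0 \<in> K" using K by auto
  show "0 \<le> (MAX k\<in>K. N k x)" for x
    using measurable_seminorm_D(2)[OF N[OF k0], of x] K k0 by (auto simp: Max_ge_iff)
  have ge: "N k x \<le> (MAX k\<in>K. N k x)" if "k \<in> K" for k x using K that by simp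
  show "(MAX k\<in>K. N k (\<lambda>j. a * x j + b * y j)) \<le> \<bar>a\<bar> * (MAX k\<in>K. N k x) + \<bar>b\<bar> * (MAX k\<in>K. N k y)" for a b x y
  proof (subst Max_le_iff; (use K in simp)?; intro ballI)
    fix k assume k: "k \<in> K"
    show "N k (\<lambda>j. a * x j + b * y j) \<le> \<bar>a\<bar> * (MAX k\<in>K. N k x) + \<bar>b\<bar> * (MAX k\<in>K. N k y)"
      using ge[OF k]
      by (intro order_trans[OF measurable_seminorm_D(3)[OF N[OF k]]] add_mono mult_left_mono) auto
  qed
  show "(MAX k\<in>K. N k (restrict x J)) = (MAX k\<in>K. N k x)" for x
    using measurable_seminorm_D(4)[OF N] by (intro arg_cong[where f=Max] image_cong) auto
qed

lemma measurable_seminorm_abs_sum: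
  assumes A: "finite A" and j: "\<And>i. i \<in> A \<Longrightarrow> \<phi> i \<in> J"
  shows "measurable_seminorm J (\<lambda>x. \<bar>\<Sum>i\<in>A. a i * x (\<phi> i)\<bar>)"
  unfolding measurable_seminorm_def
proof (intro conjI allI)
  show "(\<lambda>x. \<bar>\<Sum>i\<in>A. a i * x (\<phi> i)\<bar>) \<in> borel_measurable (Pi\<^sub>M J (\<lambda>_. borel))"
    using j by measurable
  show "\<bar>\<Sum>i\<in>A. a i * (c * x (\<phi> i) + d * y (\<phi> i))\<bar>
      \<le> \<bar>c\<bar> * \<bar>\<Sum>i\<in>A. a i * x (\<phi> i)\<bar> + \<bar>d\<bar> * \<bar>\<Sum>i\<in>A. a i * y (\<phi> i)\<bar>" for c d x y
  proof -
    have "(\<Sum>i\<in>A. a i * (c * x (\<phi> i) + d * y (\<phi> i)))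
        = c * (\<Sum>i\<in>A. a i * x (\<phi> i)) + d * (\<Sum>i\<in>A. a i * y (\<phi> i))"
      by (simp add: sum_distrib_left sum.distrib algebra_simps)
    then show ?thesis by (simp only: abs_mult[symmetric] abs_triangle_ineq)
  qed
  show "\<bar>\<Sum>i\<in>A. a i * restrict x J (\<phi> i)\<bar> = \<bar>\<Sum>i\<in>A. a i * x (\<phi> i)\<bar>" for x
    using j by (simp cong: sum.cong)
qed simp

lemma measurable_seminorm_L2_set:
  assumes A: "finite A" and j: "\<And>i. i \<in> A \<Longrightarrow> \<phi> i \<in> J"
  shows "measurable_seminorm J (\<lambda>x. L2_set (\<lambda>i. x (\<phi> i)) A)"
  unfolding measurable_seminorm_def
proof (intro conjI allI)
  show "(\<lambda>x. L2_set (\<lambda>i. x (\<phi> i)) A) \<in> borel_measurable (Pi\<^sub>M J (\<lambda>_. borel))"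
    unfolding L2_set_def using j by measurable
  have *: "L2_set (\<lambda>i. c * f i) A = \<bar>c\<bar> * L2_set f A" for c f
  proof -
    have "L2_set (\<lambda>i. c * f i) A = L2_set (\<lambda>i. \<bar>c\<bar> * f i) A" by (simp add: L2_set_def power_mult_distrib)
    then show ?thesis by (simp add: L2_set_right_distrib)
  qed
  show "L2_set (\<lambda>i. c * x (\<phi> i) + d * y (\<phi> i)) A
      \<le> \<bar>c\<bar> * L2_set (\<lambda>i. x (\<phi> i)) A + \<bar>d\<bar> * L2_set (\<lambda>i. y (\<phi> i)) A" for c d x y
    unfolding *[symmetric] by (rule L2_set_triangle_ineq)
  show "L2_set (\<lambda>i. restrict x J (\<phi> i)) A = L2_set (\<lambda>i. x (\<phi> i)) A" for x
    using j by (intro L2_set_cong) auto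
qed (simp add: L2_set_nonneg)

text \<open>\<open>U\<close> is a finite piece of a norming set and everything derived here is
  uniform in it. \<open>u0\<close> supplies a functional of positive variance, from which standard
  normal variables are obtained by scaling.\<close>

locale gaussian_sample = prob_space M for M :: "'b measure" +
  fixes X :: "nat \<Rightarrow> 'b \<Rightarrow> 'a::{banach, second_countable_topology}" and n :: nat
    and S :: "('a \<Rightarrow>\<^sub>L real) \<Rightarrow>\<^sub>L 'a" and U :: "('a \<Rightarrow>\<^sub>L real) set" and u0 :: "'a \<Rightarrow>\<^sub>L real"
  assumes n: "n \<ge> 1"
    and indep: "indep_vars (\<lambda>_. borel) X {1..n}"
    and normal: "\<And>i u. i \<in> {1..n} \<Longrightarrow> normal_rv M (blinfun_apply u (blinfun_apply S u)) (\<lambda>\<omega>. blinfun_apply u (X i \<omega>))"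
    and sym: "\<And>u v. blinfun_apply u (blinfun_apply S v) = blinfun_apply v (blinfun_apply S u)"
    and U: "finite U" "U \<noteq> {}" "\<And>u. u \<in> U \<Longrightarrow> norm u \<le> 1"
    and u0: "0 < blinfun_apply u0 (blinfun_apply S u0)"
begin

lemma M: "prob_space M" by unfold_locales

sublocale P: pair_prob_space M M ..

definition cov :: "('a \<Rightarrow>\<^sub>L real) \<Rightarrow> ('a \<Rightarrow>\<^sub>L real) \<Rightarrow> real" where
  "cov u v = blinfun_apply u (blinfun_apply S v)"

lemma cov_nonneg: "0 \<le> cov u u"
  using normal[of 1 u] n by (simp add: normal_rv_def cov_def)

lemma cov_sym: "cov u v = cov v u"
  unfolding cov_def by (rule sym)

lemma cov_add: "cov (u + v) w = cov u w + cov v w" "cov w (u + v) = cov w u + cov w v"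
  and cov_diff: "cov (u - v) w = cov u w - cov v w" "cov w (u - v) = cov w u - cov w v"
  and cov_scale: "cov (a *\<^sub>R u) w = a * cov u w" "cov w (a *\<^sub>R u) = a * cov w u"
  unfolding cov_def by (simp_all add: blinfun.bilinear_simps)

lemma cov_zero: "cov 0 0 = 0"
  unfolding cov_def by simp

lemma cov_add_le: "cov (u + v) (u + v) \<le> 2 * cov u u + 2 * cov v v"
  using cov_nonneg[of "u - v"] by (simp add: cov_add cov_diff)

lemma cov_le: "u \<in> U \<Longrightarrow> cov u u \<le> norm S"
proof -
  assume u: "u \<in> U"
  have "cov u u \<le> norm u * norm (blinfun_apply S u)"
    unfolding cov_def using norm_blinfun[of u "blinfun_apply S u"] by simp
  also have "\<dots> \<le> norm u * (norm S * norm u)"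
    by (intro mult_left_mono norm_blinfun) auto
  also have "\<dots> \<le> 1 * (norm S * 1)"
    using U(3)[OF u] by (intro mult_mono) auto
  finally show ?thesis by simp
qed

lemma lincomb: "normal_rv M (\<Sum>i=1..n. cov (w i) (w i)) (\<lambda>\<omega>. \<Sum>i=1..n. blinfun_apply (w i) (X i \<omega>))"
proof (rule normal_rv_indep_sum)
  show "indep_vars (\<lambda>_. borel) (\<lambda>i \<omega>. blinfun_apply (w i) (X i \<omega>)) {1..n}"
    by (rule indep_vars_compose2[OF indep])
      (auto intro!: borel_measurable_continuous_onI continuous_intros)
qed (auto simp: cov_def intro: normal)

text \<open>A combination over \<open>k\<close> of sums of this form has the same form with other
  functionals, so joint normality reduces to \<open>lincomb\<close>.\<close>

lemma lincomb_family:
  assumes "finite K"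
  shows "gaussian_family M K (\<lambda>k \<omega>. \<Sum>i=1..n. blinfun_apply (W k i) (X i \<omega>))"
proof -
  have "(\<Sum>k\<in>K. c k * (\<Sum>i=1..n. blinfun_apply (W k i) (X i \<omega>)))
      = (\<Sum>i=1..n. blinfun_apply (\<Sum>k\<in>K. c k *\<^sub>R W k i) (X i \<omega>))" for c \<omega>
    unfolding sum_distrib_left blinfun.sum_left blinfun.scaleR_left
    by (subst sum.swap) simp
  then have "normal_rv M (\<Sum>i=1..n. cov (\<Sum>k\<in>K. c k *\<^sub>R W k i) (\<Sum>k\<in>K. c k *\<^sub>R W k i))
      (\<lambda>\<omega>. \<Sum>k\<in>K. c k * (\<Sum>i=1..n. blinfun_apply (W k i) (X i \<omega>)))" for c
    using lincomb[of "\<lambda>i. \<Sum>k\<in>K. c k *\<^sub>R W k i"] by simp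
  then show ?thesis
    unfolding gaussian_family_def using assms by blast
qed

text \<open>Sudakov-Fernique for a process \<open>W\<close> against the sum of two processes
  \<open>P\<close> and \<open>Q\<close> that are bounded by the envelopes \<open>F\<close> and
  \<open>G\<close>. All are built from the same sample, but \<open>P\<close> and \<open>Q\<close>
  are evaluated in different factors of the product space and are therefore independent.\<close>

lemma comparison:
  assumes K: "finite K" "K \<noteq> {}"
    and le: "\<And>k l. k \<in> K \<Longrightarrow> l \<in> K \<Longrightarrow> (\<Sum>i=1..n. cov (W k i - W l i) (W k i - W l i))
      \<le> (\<Sum>i=1..n. cov (P k i - P l i) (P k i - P l i)) + (\<Sum>i=1..n. cov (Q k i - Q l i) (Q k i - Q l i))"
    and FG: "\<And>k \<omega> \<omega>'. k \<in> K \<Longrightarrow> (\<Sum>i=1..n. blinfun_apply (P k i) (X i \<omega>)) + (\<Sum>i=1..n. blinfun_apply (Q k i) (X i \<omega>')) \<le> F \<omega> + G \<omega>'"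
    and iF: "integrable M F" and iG: "integrable M G"
  shows "(\<integral>\<omega>. (MAX k\<in>K. \<Sum>i=1..n. blinfun_apply (W k i) (X i \<omega>)) \<partial>M) \<le> (\<integral>\<omega>. F \<omega> \<partial>M) + (\<integral>\<omega>. G \<omega> \<partial>M)"
proof -
  let ?A = "\<lambda>W k \<omega>. \<Sum>i=1..n. blinfun_apply (W k i) (X i \<omega>)"
  let ?B = "\<lambda>k z. ?A P k (fst z) + ?A Q k (snd z)"
  have diff: "?A W k \<omega> - ?A W l \<omega> = (\<Sum>i=1..n. blinfun_apply (W k i - W l i) (X i \<omega>))" for W :: "_ \<Rightarrow> nat \<Rightarrow> 'a \<Rightarrow>\<^sub>L real" and k l \<omega>
    by (simp add: sum_subtractf blinfun.diff_left)
  have gB: "gaussian_family (M \<Otimes>\<^sub>M M) K ?B"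
    by (rule gaussian_family_pair_add[OF M M lincomb_family[OF K(1)] lincomb_family[OF K(1)]])
  have "(\<integral>\<omega>. (MAX k\<in>K. ?A W k \<omega>) \<partial>M) \<le> (\<integral>z. (MAX k\<in>K. ?B k z) \<partial>(M \<Otimes>\<^sub>M M))"
  proof (rule sudakov_fernique[OF M P.prob_space_axioms lincomb_family[OF K(1)] gB K(2)])
    fix k l assume kl: "k \<in> K" "l \<in> K"
    have 1: "expectation (\<lambda>x. (?A W k x - ?A W l x)\<^sup>2) = (\<Sum>i=1..n. cov (W k i - W l i) (W k i - W l i))"
      unfolding diff by (rule normal_rv_moments(4)[OF lincomb])
    have e: "?B k z - ?B l z = (\<Sum>i=1..n. blinfun_apply (P k i - P l i) (X i (fst z)))
        + (\<Sum>i=1..n. blinfun_apply (Q k i - Q l i) (X i (snd z)))" for z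
      unfolding diff[symmetric] by simp
    have 2: "(\<integral>z. (?B k z - ?B l z)\<^sup>2 \<partial>(M \<Otimes>\<^sub>M M)) = (\<Sum>i=1..n. cov (P k i - P l i) (P k i - P l i)) + (\<Sum>i=1..n. cov (Q k i - Q l i) (Q k i - Q l i))"
      unfolding e by (rule P.normal_rv_moments(4)[OF normal_rv_pair_add[OF M M lincomb lincomb]])
    show "expectation (\<lambda>x. (?A W k x - ?A W l x)\<^sup>2) \<le> (\<integral>z. (?B k z - ?B l z)\<^sup>2 \<partial>(M \<Otimes>\<^sub>M M))"
      unfolding 1 2 by (rule le[OF kl])
  qed
  also have "\<dots> \<le> (\<integral>z. F (fst z) * 1 + 1 * G (snd z) \<partial>(M \<Otimes>\<^sub>M M))"
  proof (rule integral_mono)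
    show "integrable (M \<Otimes>\<^sub>M M) (\<lambda>z. F (fst z) * 1 + 1 * G (snd z))"
      by (intro Bochner_Integration.integrable_add P.integrable_pair_mult iF iG) auto
    show "(MAX k\<in>K. ?B k z) \<le> F (fst z) * 1 + 1 * G (snd z)" for z
      using K FG[of _ "fst z" "snd z"] by (subst Max_le_iff) auto
    show "integrable (M \<Otimes>\<^sub>M M) (\<lambda>z. MAX k\<in>K. ?B k z)"
      by (rule gaussian_family_Max_integrable[OF P.prob_space_axioms gB K(2)])
  qed
  also have "\<dots> = (\<integral>z. F (fst z) * 1 \<partial>(M \<Otimes>\<^sub>M M)) + (\<integral>z. 1 * G (snd z) \<partial>(M \<Otimes>\<^sub>M M))"
    by (intro Bochner_Integration.integral_add P.integrable_pair_mult iF iG) auto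
  also have "\<dots> = (\<integral>\<omega>. F \<omega> \<partial>M) + (\<integral>\<omega>. G \<omega> \<partial>M)"
    using P.integral_pair_mult[OF iF integrable_const[of 1]] P.integral_pair_mult[OF integrable_const[of 1] iG]
    by (simp add: prob_space)
  finally show ?thesis .
qed

end

lemma gaussian_family_cong:
  assumes "\<And>j x. j \<in> J \<Longrightarrow> Z j x = Z' j x"
  shows "gaussian_family M J Z \<longleftrightarrow> gaussian_family M J Z'"
proof -
  have "(\<Sum>j\<in>J. c j * Z j x) = (\<Sum>j\<in>J. c j * Z' j x)" for c x
    using assms by (intro sum.cong) auto
  then show ?thesis unfolding gaussian_family_def by simp
qed

section \<open>Chevet's inequality for the conditional mean of the chaos\<close>

context gaussian_sample
begin

definition "J = U \<times> {1..n}"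
definition "Z = (\<lambda>(u, i) \<omega>. blinfun_apply u (X i \<omega>))"
text \<open>The \<open>h i\<close> are independent standard normal variables; taking them from the sample avoids a
  further probability space. \<open>cond_bound x\<close> bounds the mean of \<open>decoupled x (Z \<omega>)\<close> by the Chevet
  inequality: \<open>width\<close> and \<open>mean_norm\<close> are the Gaussian widths of the two index sets, \<open>radius\<close> and
  \<open>sdev\<close> their radii.\<close>

definition "h i \<omega> = blinfun_apply u0 (X i \<omega>) / sqrt (cov u0 u0)"
definition "sdev = sqrt (norm S)"
definition "mean_norm = expectation (\<lambda>\<omega>. MAX u\<in>U. \<bar>blinfun_apply u (X 1 \<omega>)\<bar>)"
definition "width x = expectation (\<lambda>\<omega>. MAX u\<in>U. \<bar>\<Sum>i=1..n. h i \<omega> * x (u, i)\<bar>)"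
definition "radius x = (MAX u\<in>U. L2_set (\<lambda>i. x (u, i)) {1..n})"
definition "cond_bound x = sdev * width x + mean_norm * radius x"
definition decoupled :: "(('a \<Rightarrow>\<^sub>L real) \<times> nat \<Rightarrow> real) \<Rightarrow> (('a \<Rightarrow>\<^sub>L real) \<times> nat \<Rightarrow> real) \<Rightarrow> real" where
  "decoupled x y = (MAX k\<in>U \<times> U. \<bar>\<Sum>i=1..n. x (fst k, i) * y (snd k, i)\<bar>)"

lemma UU: "finite (U \<times> U)" "U \<times> U \<noteq> {}"
  using U by auto

lemma sdev: "0 \<le> sdev" "sdev\<^sup>2 = norm S"
  by (simp_all add: sdev_def)

lemma Z_family: "gaussian_family M J Z"
proof -
  have "Z k \<omega> = (\<Sum>i=1..n. blinfun_apply (if i = snd k then fst k else 0) (X i \<omega>))" if "k \<in> J" for k \<omega>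
    using that unfolding Z_def J_def by (auto simp: if_distrib[of "\<lambda>a. blinfun_apply a _"] cong: if_cong)
  then have "gaussian_family M J Z \<longleftrightarrow> gaussian_family M J (\<lambda>k \<omega>. \<Sum>i=1..n. blinfun_apply (if i = snd k then fst k else 0) (X i \<omega>))"
    by (rule gaussian_family_cong)
  moreover have "finite J" using U(1) by (simp add: J_def)
  ultimately show ?thesis by (simp only: lincomb_family)
qed

lemma h_eq: "h i \<omega> = (\<Sum>j=1..n. blinfun_apply (if j = i then (1 / sqrt (cov u0 u0)) *\<^sub>R u0 else 0) (X j \<omega>))"
  if "i \<in> {1..n}"
  using that unfolding h_def by (auto simp: if_distrib[of "\<lambda>a. blinfun_apply a _"] blinfun.scaleR_left cong: if_cong)

lemma h_family: "gaussian_family M {1..n} h"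
proof -
  have "gaussian_family M {1..n} h \<longleftrightarrow> gaussian_family M {1..n} (\<lambda>i \<omega>. \<Sum>j=1..n. blinfun_apply (if j = i then (1 / sqrt (cov u0 u0)) *\<^sub>R u0 else 0) (X j \<omega>))"
    by (rule gaussian_family_cong) (rule h_eq)
  then show ?thesis by (simp only: lincomb_family finite_atLeastAtMost)
qed

lemma h_second_moment: "i \<in> {1..n} \<Longrightarrow> expectation (\<lambda>\<omega>. (h i \<omega>)\<^sup>2) = 1"
proof -
  assume i: "i \<in> {1..n}"
  have "expectation (\<lambda>\<omega>. (blinfun_apply u0 (X i \<omega>))\<^sup>2) = cov u0 u0"
    using normal_rv_moments(4)[OF normal[OF i, of u0]] by (simp add: cov_def)
  then show ?thesis using u0 by (simp add: h_def power_divide cov_def[symmetric])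
qed

lemma h_measurable[measurable]: "i \<in> {1..n} \<Longrightarrow> h i \<in> borel_measurable M"
  using gaussian_family_measurable[OF h_family] .

lemma mean_norm_seminorm: "measurable_seminorm J (\<lambda>x. MAX u\<in>U. \<bar>x (u, 1)\<bar>)"
proof -
  have "measurable_seminorm J (\<lambda>x. MAX u\<in>U. \<bar>\<Sum>i\<in>{1::nat}. 1 * x (u, i)\<bar>)"
    using n by (intro measurable_seminorm_Max U measurable_seminorm_abs_sum) (auto simp: J_def)
  then show ?thesis by simp
qed

lemma mean_norm_integrable: "integrable M (\<lambda>\<omega>. MAX u\<in>U. \<bar>blinfun_apply u (X 1 \<omega>)\<bar>)"
  using integrable_seminorm_power[OF M Z_family mean_norm_seminorm, of 1] by (simp add: Z_def)

lemma mean_norm_nonneg: "0 \<le> mean_norm"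
  unfolding mean_norm_def using measurable_seminorm_D(2)[OF mean_norm_seminorm, of "\<lambda>k. Z k \<omega>" for \<omega>]
  by (intro Bochner_Integration.integral_nonneg) (simp add: Z_def)

lemma radius_seminorm: "measurable_seminorm J radius"
  unfolding radius_def by (intro measurable_seminorm_Max U measurable_seminorm_L2_set) (auto simp: J_def)

lemma width_inner_seminorm: "measurable_seminorm J (\<lambda>x. MAX u\<in>U. \<bar>\<Sum>i=1..n. a i * x (u, i)\<bar>)"
  by (intro measurable_seminorm_Max U measurable_seminorm_abs_sum) (auto simp: J_def)

lemma width_inner_integrable: "integrable M (\<lambda>\<omega>. MAX u\<in>U. \<bar>\<Sum>i=1..n. h i \<omega> * x (u, i)\<bar>)"
proof -
  have "measurable_seminorm {1..n} (\<lambda>y. MAX u\<in>U. \<bar>\<Sum>i=1..n. x (u, i) * y i\<bar>)"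
    by (intro measurable_seminorm_Max U measurable_seminorm_abs_sum) auto
  from integrable_seminorm_power[OF M h_family this, of 1] show ?thesis by (simp add: mult.commute)
qed

text \<open>An average of seminorms is a seminorm. Measurability in \<open>x\<close> comes from
  joint measurability in \<open>x\<close> and \<open>\<omega>\<close>. This is one half of the fact
  that \<open>cond_bound\<close> is a seminorm, to which the Gaussian moment bound can be applied
  again.\<close>

lemma width_seminorm: "measurable_seminorm J width"
  unfolding measurable_seminorm_def
proof (intro conjI allI)
  let ?f = "\<lambda>x \<omega>. MAX u\<in>U. \<bar>\<Sum>i=1..n. h i \<omega> * x (u, i)\<bar>"
  have "(\<lambda>(x, \<omega>). ?f x \<omega>) \<in> borel_measurable (Pi\<^sub>M J (\<lambda>_. borel) \<Otimes>\<^sub>M M)"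
    unfolding split_beta
  proof (intro borel_measurable_Max U borel_measurable_abs borel_measurable_sum borel_measurable_times)
    fix u i assume ui: "u \<in> U" "i \<in> {1..n}"
    show "(\<lambda>z. h i (snd z)) \<in> borel_measurable (Pi\<^sub>M J (\<lambda>_. borel) \<Otimes>\<^sub>M M)" using ui by measurable
    have "(\<lambda>x. x (u, i)) \<in> borel_measurable (Pi\<^sub>M J (\<lambda>_. borel))"
      using ui by (intro measurable_component_singleton) (simp add: J_def)
    then show "(\<lambda>z. fst z (u, i)) \<in> borel_measurable (Pi\<^sub>M J (\<lambda>_. borel) \<Otimes>\<^sub>M M)"
      by (rule measurable_compose[OF measurable_fst])
  qed
  then show "width \<in> borel_measurable (Pi\<^sub>M J (\<lambda>_. borel))"
    unfolding width_def[abs_def] by (rule borel_measurable_lebesgue_integral)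
  show "0 \<le> width x" for x
    unfolding width_def by (intro Bochner_Integration.integral_nonneg measurable_seminorm_D(2)[OF width_inner_seminorm])
  show "width (\<lambda>j. a * x j + b * y j) \<le> \<bar>a\<bar> * width x + \<bar>b\<bar> * width y" for a b x y
  proof -
    have "width (\<lambda>j. a * x j + b * y j) \<le> expectation (\<lambda>\<omega>. \<bar>a\<bar> * ?f x \<omega> + \<bar>b\<bar> * ?f y \<omega>)"
      unfolding width_def
      by (intro integral_mono width_inner_integrable Bochner_Integration.integrable_add integrable_mult_right
        measurable_seminorm_D(3)[OF width_inner_seminorm])
    then show ?thesis unfolding width_def using width_inner_integrable[of x] width_inner_integrable[of y] by simp
  qed
  show "width (restrict x J) = width x" for x
    unfolding width_def using measurable_seminorm_D(4)[OF width_inner_seminorm, of "\<lambda>i. h i _" x] by simp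
qed

lemma cond_bound_seminorm: "measurable_seminorm J cond_bound"
proof -
  note 1 = measurable_seminorm_D[OF width_seminorm] and 2 = measurable_seminorm_D[OF radius_seminorm]
  note [measurable] = 1(1) 2(1)
  have "cond_bound (\<lambda>j. a * x j + b * y j) \<le> \<bar>a\<bar> * cond_bound x + \<bar>b\<bar> * cond_bound y" for a b x y
    using mult_left_mono[OF 1(3)[of a x b y] sdev(1)] mult_left_mono[OF 2(3)[of a x b y] mean_norm_nonneg]
    unfolding cond_bound_def by (simp add: algebra_simps)
  then show ?thesis
    unfolding measurable_seminorm_def using 1 2 sdev mean_norm_nonneg by (auto simp: cond_bound_def[abs_def])
qed

lemma decoupled_seminorm: "measurable_seminorm J (decoupled x)"
  unfolding decoupled_def by (intro measurable_seminorm_Max UU measurable_seminorm_abs_sum) (auto simp: J_def)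

lemma decoupled_le: "decoupled x y \<le> radius x * radius y"
proof -
  have "\<bar>\<Sum>i=1..n. x (u, i) * y (v, i)\<bar> \<le> radius x * radius y" if "u \<in> U" "v \<in> U" for u v
  proof -
    have "\<bar>\<Sum>i=1..n. x (u, i) * y (v, i)\<bar> \<le> (\<Sum>i=1..n. \<bar>x (u, i)\<bar> * \<bar>y (v, i)\<bar>)"
      by (rule order_trans[OF sum_abs]) (simp add: abs_mult)
    also have "\<dots> \<le> L2_set (\<lambda>i. x (u, i)) {1..n} * L2_set (\<lambda>i. y (v, i)) {1..n}"
      by (rule L2_set_mult_ineq)
    also have "\<dots> \<le> radius x * radius y"
      using that U measurable_seminorm_D(2)[OF radius_seminorm, of x] unfolding radius_def by (intro mult_mono) (auto simp: L2_set_nonneg)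
    finally show ?thesis .
  qed
  then show ?thesis unfolding decoupled_def using UU by (subst Max_le_iff) auto
qed

text \<open>For fixed \<open>x\<close> the chaos is a Gaussian process in \<open>(u, v)\<close>; a
  sign \<open>e\<close> is added to the index to get rid of the absolute value. Its increments are
  dominated by those of a process in \<open>u\<close> alone plus an independent one in
  \<open>v\<close> alone. The factor \<open>sqrt 2\<close> is the price of splitting an increment in
  two by \<open>cov_add_le\<close>.\<close>

lemma decoupled_expectation_le: "expectation (\<lambda>\<omega>. decoupled x (\<lambda>j. Z j \<omega>)) \<le> sqrt 2 * cond_bound x"
proof -
  define K where "K = (U \<times> U) \<times> {-1, 1::real}"
  have K: "finite K" "K \<noteq> {}" unfolding K_def using UU by auto
  define R where "R = radius x"
  have R: "0 \<le> R" unfolding R_def by (rule measurable_seminorm_D(2)[OF radius_seminorm])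
  have L2_le: "(\<Sum>i=1..n. (x (u, i))\<^sup>2) \<le> R\<^sup>2" if "u \<in> U" for u
  proof -
    have "L2_set (\<lambda>i. x (u, i)) {1..n} \<le> R" unfolding R_def radius_def using that U by simp
    then have "(L2_set (\<lambda>i. x (u, i)) {1..n})\<^sup>2 \<le> R\<^sup>2" by (intro power_mono) (auto simp: L2_set_nonneg)
    then show ?thesis by (simp add: L2_set_def sum_nonneg)
  qed
  \<comment> \<open>\<open>W\<close> is the chaos itself. \<open>P\<close> puts the normalised
    \<open>u0\<close> in place of \<open>v\<close> and so pairs the vector \<open>x\<close> at
    \<open>u\<close> with the standard normals \<open>h\<close>, at scale \<open>sdev\<close>.
    \<open>Q\<close> uses the first observation alone, at scale \<open>R\<close>, so its increments
    do not see \<open>u\<close>.\<close>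
  define W where "W k i = (snd k * x (fst (fst k), i)) *\<^sub>R snd (fst k)" for k :: "(('a \<Rightarrow>\<^sub>L real) \<times> ('a \<Rightarrow>\<^sub>L real)) \<times> real" and i
  define P where "P k i = (sqrt 2 * sdev / sqrt (cov u0 u0) * (snd k * x (fst (fst k), i))) *\<^sub>R u0" for k :: "(('a \<Rightarrow>\<^sub>L real) \<times> ('a \<Rightarrow>\<^sub>L real)) \<times> real" and i
  define Q where "Q k i = (if i = 1 then (sqrt 2 * R) *\<^sub>R snd (fst k) else 0)" for k :: "(('a \<Rightarrow>\<^sub>L real) \<times> ('a \<Rightarrow>\<^sub>L real)) \<times> real" and i :: nat
  define F where "F \<omega> = sqrt 2 * sdev * (MAX u\<in>U. \<bar>\<Sum>i=1..n. h i \<omega> * x (u, i)\<bar>)" for \<omega>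
  define G where "G \<omega> = sqrt 2 * R * (MAX u\<in>U. \<bar>blinfun_apply u (X 1 \<omega>)\<bar>)" for \<omega>
  have "expectation (\<lambda>\<omega>. decoupled x (\<lambda>j. Z j \<omega>)) \<le> expectation (\<lambda>\<omega>. MAX k\<in>K. \<Sum>i=1..n. blinfun_apply (W k i) (X i \<omega>))"
  proof (rule integral_mono)
    show "integrable M (\<lambda>\<omega>. decoupled x (\<lambda>j. Z j \<omega>))"
      using integrable_seminorm_power[OF M Z_family decoupled_seminorm[of x], of 1] by simp
    have gW: "gaussian_family M K (\<lambda>k \<omega>. \<Sum>i=1..n. blinfun_apply (W k i) (X i \<omega>))"
      by (rule lincomb_family[OF K(1)])
    show "integrable M (\<lambda>\<omega>. MAX k\<in>K. \<Sum>i=1..n. blinfun_apply (W k i) (X i \<omega>))"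
      by (rule gaussian_family_Max_integrable[OF M gW K(2)])
    fix \<omega>
    let ?R = "MAX k\<in>K. \<Sum>i=1..n. blinfun_apply (W k i) (X i \<omega>)"
    have "\<bar>\<Sum>i=1..n. x (fst k, i) * Z (snd k, i) \<omega>\<bar> \<le> ?R" if k: "k \<in> U \<times> U" for k
    proof -
      let ?s = "\<Sum>i=1..n. x (fst k, i) * Z (snd k, i) \<omega>"
      let ?e = "if ?s \<ge> 0 then 1 else -1 :: real"
      have "\<bar>?s\<bar> = ?e * ?s" by simp
      also have "\<dots> = (\<Sum>i=1..n. blinfun_apply (W (k, ?e) i) (X i \<omega>))"
        unfolding W_def Z_def sum_distrib_left by (simp add: blinfun.scaleR_left mult.assoc)
      also have "\<dots> \<le> ?R"
        using K k by (intro Max_ge) (auto simp: K_def)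
      finally show ?thesis .
    qed
    then show "decoupled x (\<lambda>j. Z j \<omega>) \<le> ?R"
      unfolding decoupled_def using UU by (subst Max_le_iff) auto
  qed
  also have "\<dots> \<le> expectation F + expectation G"
  proof (rule comparison[OF K])
    fix k l assume k: "k \<in> K" and l: "l \<in> K"
    obtain u v e where k': "k = ((u, v), e)" "u \<in> U" "v \<in> U" "e\<^sup>2 = 1" using k unfolding K_def by auto
    obtain u' v' e' where l': "l = ((u', v'), e')" "u' \<in> U" "v' \<in> U" "e'\<^sup>2 = 1" using l unfolding K_def by auto
    define a b where "a i = e * x (u, i)" and "b i = e' * x (u', i)" for i
    let ?d = "cov (v - v') (v - v')"
    have sb: "(\<Sum>i=1..n. (b i)\<^sup>2) \<le> R\<^sup>2"
      using L2_le[OF l'(2)] l'(4) by (simp add: b_def power_mult_distrib)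
    have "(\<Sum>i=1..n. cov (W k i - W l i) (W k i - W l i)) \<le> (\<Sum>i=1..n. 2 * norm S * (a i - b i)\<^sup>2 + 2 * ?d * (b i)\<^sup>2)"
    proof (rule sum_mono)
      fix i
      \<comment> \<open>Changing one argument at a time: the first term moves only the vector of
        coefficients, the second only the functional. The sums over \<open>i\<close> of their
        variances match \<open>P\<close> and \<open>Q\<close>.\<close>
      have "W k i - W l i = (a i - b i) *\<^sub>R v + b i *\<^sub>R (v - v')"
        unfolding W_def k' l' a_def b_def by (simp add: algebra_simps)
      then have "cov (W k i - W l i) (W k i - W l i) \<le> 2 * ((a i - b i)\<^sup>2 * cov v v) + 2 * ((b i)\<^sup>2 * ?d)"
        using cov_add_le[of "(a i - b i) *\<^sub>R v" "b i *\<^sub>R (v - v')"] by (simp add: cov_scale power2_eq_square mult.assoc)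
      also have "\<dots> \<le> 2 * ((a i - b i)\<^sup>2 * norm S) + 2 * ((b i)\<^sup>2 * ?d)"
        using cov_le[OF k'(3)] by (intro add_mono mult_left_mono) auto
      finally show "cov (W k i - W l i) (W k i - W l i) \<le> 2 * norm S * (a i - b i)\<^sup>2 + 2 * ?d * (b i)\<^sup>2"
        by (simp add: mult_ac)
    qed
    also have "\<dots> = 2 * norm S * (\<Sum>i=1..n. (a i - b i)\<^sup>2) + 2 * ?d * (\<Sum>i=1..n. (b i)\<^sup>2)"
      by (simp add: sum.distrib sum_distrib_left)
    also have "\<dots> \<le> 2 * norm S * (\<Sum>i=1..n. (a i - b i)\<^sup>2) + 2 * ?d * R\<^sup>2"
      using sb cov_nonneg by (intro add_left_mono mult_left_mono) auto
    also have "2 * norm S * (\<Sum>i=1..n. (a i - b i)\<^sup>2) = (\<Sum>i=1..n. cov (P k i - P l i) (P k i - P l i))"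
    proof -
      have "cov (P k i - P l i) (P k i - P l i) = 2 * norm S * (a i - b i)\<^sup>2" for i
      proof -
        have "P k i - P l i = (sqrt 2 * sdev / sqrt (cov u0 u0) * (a i - b i)) *\<^sub>R u0"
          unfolding P_def k' l' a_def b_def by (simp only: fst_conv snd_conv scaleR_left_diff_distrib right_diff_distrib)
        then have "cov (P k i - P l i) (P k i - P l i) = (sqrt 2 * sdev / sqrt (cov u0 u0) * (a i - b i))\<^sup>2 * cov u0 u0"
          by (simp add: cov_scale power2_eq_square)
        also have "\<dots> = 2 * sdev\<^sup>2 * (a i - b i)\<^sup>2"
          using u0 by (simp add: power_mult_distrib power_divide cov_def[symmetric])
        finally show ?thesis by (simp add: sdev)
      qed
      then show ?thesis by (simp add: sum_distrib_left)
    qed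
    also have "2 * ?d * R\<^sup>2 = (\<Sum>i=1..n. cov (Q k i - Q l i) (Q k i - Q l i))"
    proof -
      have "cov (Q k i - Q l i) (Q k i - Q l i) = (if i = 1 then 2 * ?d * R\<^sup>2 else 0)" for i
      proof -
        have "cov (Q k i - Q l i) (Q k i - Q l i) = (if i = 1 then (sqrt 2 * R)\<^sup>2 * ?d else 0)"
          unfolding Q_def k' l' fst_conv snd_conv
          by (simp add: cov_zero cov_scale scaleR_right_diff_distrib[symmetric] power2_eq_square)
        then show ?thesis by (simp add: power_mult_distrib)
      qed
      then show ?thesis using n by simp
    qed
    finally show "(\<Sum>i=1..n. cov (W k i - W l i) (W k i - W l i))
      \<le> (\<Sum>i=1..n. cov (P k i - P l i) (P k i - P l i)) + (\<Sum>i=1..n. cov (Q k i - Q l i) (Q k i - Q l i))" .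
  next
    fix k \<omega> \<omega>' assume k: "k \<in> K"
    obtain u v e where k': "k = ((u, v), e)" "u \<in> U" "v \<in> U" "\<bar>e\<bar> = 1" using k unfolding K_def by auto
    have "(\<Sum>i=1..n. blinfun_apply (P k i) (X i \<omega>)) = sqrt 2 * sdev * (e * (\<Sum>i=1..n. h i \<omega> * x (u, i)))"
      unfolding sum_distrib_left by (intro sum.cong refl) (simp add: P_def k'(1) h_def blinfun.scaleR_left)
    also have "\<dots> \<le> F \<omega>"
    proof -
      have "e * (\<Sum>i=1..n. h i \<omega> * x (u, i)) \<le> \<bar>\<Sum>i=1..n. h i \<omega> * x (u, i)\<bar>"
        using abs_ge_self[of "e * (\<Sum>i=1..n. h i \<omega> * x (u, i))"] k'(4) by (simp only: abs_mult mult_1_left)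
      also have "\<dots> \<le> (MAX u\<in>U. \<bar>\<Sum>i=1..n. h i \<omega> * x (u, i)\<bar>)" using U k'(2) by simp
      finally show ?thesis unfolding F_def using sdev by (intro mult_left_mono) auto
    qed
    finally have 1: "(\<Sum>i=1..n. blinfun_apply (P k i) (X i \<omega>)) \<le> F \<omega>" .
    have "(\<Sum>i=1..n. blinfun_apply (Q k i) (X i \<omega>')) = sqrt 2 * R * blinfun_apply v (X 1 \<omega>')"
      unfolding Q_def k'(1) fst_conv snd_conv using n by (simp add: if_distrib[of "\<lambda>a. blinfun_apply a _"] blinfun.scaleR_left cong: if_cong)
    also have "\<dots> \<le> G \<omega>'"
    proof -
      have "blinfun_apply v (X 1 \<omega>') \<le> \<bar>blinfun_apply v (X 1 \<omega>')\<bar>" by simp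
      also have "\<dots> \<le> (MAX u\<in>U. \<bar>blinfun_apply u (X 1 \<omega>')\<bar>)" using U k'(3) by simp
      finally show ?thesis unfolding G_def using R by (intro mult_left_mono) auto
    qed
    finally show "(\<Sum>i=1..n. blinfun_apply (P k i) (X i \<omega>)) + (\<Sum>i=1..n. blinfun_apply (Q k i) (X i \<omega>')) \<le> F \<omega> + G \<omega>'"
      using 1 by simp
  next
    show "integrable M F" "integrable M G"
      unfolding F_def[abs_def] G_def[abs_def] using width_inner_integrable mean_norm_integrable by auto
  qed
  also have "\<dots> = sqrt 2 * cond_bound x"
    unfolding F_def G_def cond_bound_def width_def mean_norm_def R_def using width_inner_integrable mean_norm_integrable by (simp add: algebra_simps)
  finally show ?thesis .
qed

end

text \<open>Jensen's inequality. The exponent is 1 for \<open>k = 0\<close> and even otherwise, so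
  that the power is convex on the whole line.\<close>

lemma (in prob_space) expectation_power_le:
  fixes f :: "'a \<Rightarrow> real"
  assumes "r = 2 ^ k" "integrable M f" "integrable M (\<lambda>x. f x ^ r)"
  shows "(expectation f) ^ r \<le> expectation (\<lambda>x. f x ^ r)"
proof (cases "k = 0")
  case True
  then show ?thesis using assms by simp
next
  case False
  then have "even r" using assms by simp
  then show ?thesis
    using jensens_inequality[of f UNIV 0 0 "\<lambda>x. x ^ r"] convex_power_even[of r] assms by simp
qed

section \<open>The mean of the Gaussian width over the sample\<close>

context gaussian_sample
begin

lemma Z_measurable[measurable]: "j \<in> J \<Longrightarrow> Z j \<in> borel_measurable M"
  by (rule gaussian_family_measurable[OF Z_family])

lemma Z_pair_measurable:
  assumes "u \<in> U" "i \<in> {1..n}"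
  shows "(\<lambda>z. Z (u, i) (fst z)) \<in> borel_measurable (M \<Otimes>\<^sub>M M)" "(\<lambda>z. Z (u, i) (snd z)) \<in> borel_measurable (M \<Otimes>\<^sub>M M)"
  using assms measurable_compose[OF measurable_fst Z_measurable[of "(u, i)"]]
    measurable_compose[OF measurable_snd Z_measurable[of "(u, i)"]] by (auto simp: J_def)

lemma radius_integrable: "integrable M (\<lambda>\<omega>. radius (\<lambda>j. Z j \<omega>) ^ p)"
  by (rule integrable_seminorm_power[OF M Z_family radius_seminorm])

lemma L2_le_radius: "u \<in> U \<Longrightarrow> L2_set (\<lambda>i. x (u, i)) {1..n} \<le> radius x"
  unfolding radius_def using U by simp

lemma radius_nonneg: "0 \<le> radius x"
  by (rule measurable_seminorm_D(2)[OF radius_seminorm])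

lemma abs_sum_le_radius:
  assumes "u \<in> U"
  shows "\<bar>\<Sum>i=1..n. a i * x (u, i)\<bar> \<le> L2_set a {1..n} * radius x"
proof -
  have "\<bar>\<Sum>i=1..n. a i * x (u, i)\<bar> \<le> (\<Sum>i=1..n. \<bar>a i\<bar> * \<bar>x (u, i)\<bar>)"
    by (rule order_trans[OF sum_abs]) (simp add: abs_mult)
  also have "\<dots> \<le> L2_set a {1..n} * L2_set (\<lambda>i. x (u, i)) {1..n}"
    by (rule L2_set_mult_ineq)
  also have "\<dots> \<le> L2_set a {1..n} * radius x"
    by (intro mult_left_mono L2_le_radius assms L2_set_nonneg)
  finally show ?thesis .
qed

lemma L2_h_integrable: "integrable M (\<lambda>\<omega>. L2_set (\<lambda>i. h i \<omega>) {1..n})"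
proof -
  have "measurable_seminorm {1..n} (\<lambda>y. L2_set (\<lambda>i. y i) {1..n})"
    by (rule measurable_seminorm_L2_set) auto
  from integrable_seminorm_power[OF M h_family this, of 1] show ?thesis by simp
qed

text \<open>The mean of the Euclidean length is at most the root of its mean square, which is
  \<open>n\<close>; carried out pointwise from \<open>(?L - sqrt n)\<^sup>2 \<ge> 0\<close>.\<close>

lemma L2_h_expectation: "expectation (\<lambda>\<omega>. L2_set (\<lambda>i. h i \<omega>) {1..n}) \<le> sqrt n"
proof -
  have sn: "sqrt n > 0" using n by simp
  have i2: "integrable M (\<lambda>\<omega>. (h i \<omega>)\<^sup>2)" if "i \<in> {1..n}" for i
    using gaussian_family_integrable(3)[OF M h_family that, of 2] by simp
  have "expectation (\<lambda>\<omega>. L2_set (\<lambda>i. h i \<omega>) {1..n}) \<le> expectation (\<lambda>\<omega>. (\<Sum>i=1..n. (h i \<omega>)\<^sup>2) / (2 * sqrt n) + sqrt n / 2)"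
  proof (rule integral_mono[OF L2_h_integrable])
    show "integrable M (\<lambda>\<omega>. (\<Sum>i=1..n. (h i \<omega>)\<^sup>2) / (2 * sqrt n) + sqrt n / 2)"
      using i2 by (intro Bochner_Integration.integrable_add integrable_divide_zero Bochner_Integration.integrable_sum) auto
    fix \<omega>
    let ?L = "L2_set (\<lambda>i. h i \<omega>) {1..n}"
    have L: "?L\<^sup>2 = (\<Sum>i=1..n. (h i \<omega>)\<^sup>2)" by (simp add: L2_set_def sum_nonneg)
    have "0 \<le> (?L - sqrt n)\<^sup>2" by simp
    then have "?L * (2 * sqrt n) \<le> ?L\<^sup>2 + sqrt n * sqrt n"
      by (simp add: power2_eq_square algebra_simps)
    then have "?L \<le> (?L\<^sup>2 + sqrt n * sqrt n) / (2 * sqrt n)"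
      using pos_le_divide_eq[of "2 * sqrt n" ?L "?L\<^sup>2 + sqrt n * sqrt n"] sn by linarith
    moreover have "sqrt n * sqrt n / (2 * sqrt n) = sqrt n / 2"
      using sn by (subst mult.commute[of 2]) (rule nonzero_mult_divide_mult_cancel_left, simp)
    ultimately show "?L \<le> (\<Sum>i=1..n. (h i \<omega>)\<^sup>2) / (2 * sqrt n) + sqrt n / 2"
      unfolding L add_divide_distrib by linarith
  qed
  also have "\<dots> = (\<Sum>i=1..n. expectation (\<lambda>\<omega>. (h i \<omega>)\<^sup>2)) / (2 * sqrt n) + sqrt n / 2"
    using Bochner_Integration.integrable_sum[of "{1..n}" M "\<lambda>i \<omega>. (h i \<omega>)\<^sup>2", OF i2]
      Bochner_Integration.integral_sum[of "{1..n}" M "\<lambda>i \<omega>. (h i \<omega>)\<^sup>2", OF i2] by (simp add: prob_space)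
  also have "\<dots> = real n / (2 * sqrt n) + sqrt n / 2"
    using h_second_moment by simp
  also have "\<dots> = sqrt n" using sn by (simp add: field_simps)
  finally show ?thesis .
qed

text \<open>After exchanging the integrals the standard normals are fixed, and the sum of the
  observations with coefficients \<open>h i \<omega>\<close> behaves like one observation multiplied
  by the length of the coefficient vector. An upper bound suffices, so this is obtained from
  Sudakov-Fernique with equal increments instead of an identity of laws.\<close>

lemma width_expectation: "expectation (\<lambda>\<omega>. width (\<lambda>j. Z j \<omega>)) \<le> sqrt n * mean_norm"
proof -
  let ?f = "\<lambda>\<omega> \<omega>'. MAX u\<in>U. \<bar>\<Sum>i=1..n. h i \<omega> * Z (u, i) \<omega>'\<bar>"
  let ?L = "\<lambda>\<omega>. L2_set (\<lambda>i. h i \<omega>) {1..n}"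
  have fm: "(\<lambda>z. ?f (fst z) (snd z)) \<in> borel_measurable (M \<Otimes>\<^sub>M M)"
    by (intro borel_measurable_Max U borel_measurable_abs borel_measurable_sum borel_measurable_times
        Z_pair_measurable measurable_compose[OF measurable_fst h_measurable])
  have f0: "0 \<le> ?f \<omega> \<omega>'" for \<omega> \<omega>'
    by (rule measurable_seminorm_D(2)[OF width_inner_seminorm])
  have "integrable (M \<Otimes>\<^sub>M M) (\<lambda>z. ?f (fst z) (snd z))"
  proof (rule Bochner_Integration.integrable_bound[OF _ fm])
    show "integrable (M \<Otimes>\<^sub>M M) (\<lambda>z. ?L (fst z) * radius (\<lambda>j. Z j (snd z)))"
      using radius_integrable[of 1] by (intro P.integrable_pair_mult L2_h_integrable) simp
    have "?f \<omega> \<omega>' \<le> ?L \<omega> * radius (\<lambda>j. Z j \<omega>')" for \<omega> \<omega>'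
      using U abs_sum_le_radius[of _ "\<lambda>i. h i \<omega>" "\<lambda>j. Z j \<omega>'"] by (subst Max_le_iff) auto
    then show "AE z in M \<Otimes>\<^sub>M M. norm (?f (fst z) (snd z)) \<le> norm (?L (fst z) * radius (\<lambda>j. Z j (snd z)))"
      using f0 by (intro always_eventually allI) (simp add: abs_mult L2_set_nonneg radius_nonneg)
  qed
  then have int: "integrable (M \<Otimes>\<^sub>M M) (\<lambda>(\<omega>, \<omega>'). ?f \<omega> \<omega>')" by (simp add: case_prod_beta')
  have inner: "expectation (?f \<omega>) \<le> ?L \<omega> * mean_norm" for \<omega>
  proof -
    define K where "K = U \<times> {-1, 1::real}"
    have K: "finite K" "K \<noteq> {}" unfolding K_def using U by auto
    define W where "W k i = (snd k * h i \<omega>) *\<^sub>R fst k" for k :: "('a \<Rightarrow>\<^sub>L real) \<times> real" and i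
    \<comment> \<open>All the mass of the coefficient vector is moved to the first observation; the
      increments have the same variance as those of \<open>W\<close>, so \<open>comparison\<close>
      applies with \<open>Q = 0\<close>.\<close>
    define P where "P k i = (if i = 1 then (?L \<omega> * snd k) *\<^sub>R fst k else 0)" for k :: "('a \<Rightarrow>\<^sub>L real) \<times> real" and i :: nat
    have L: "(?L \<omega>)\<^sup>2 = (\<Sum>i=1..n. (h i \<omega>)\<^sup>2)" by (simp add: L2_set_def sum_nonneg)
    have "expectation (?f \<omega>) \<le> expectation (\<lambda>\<omega>'. MAX k\<in>K. \<Sum>i=1..n. blinfun_apply (W k i) (X i \<omega>'))"
    proof (rule integral_mono)
      show "integrable M (?f \<omega>)"
        using integrable_seminorm_power[OF M Z_family width_inner_seminorm[of "\<lambda>i. h i \<omega>"], of 1] by simp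
      show "integrable M (\<lambda>\<omega>'. MAX k\<in>K. \<Sum>i=1..n. blinfun_apply (W k i) (X i \<omega>'))"
        by (rule gaussian_family_Max_integrable[OF M lincomb_family[OF K(1)] K(2)])
      fix \<omega>'
      let ?R = "MAX k\<in>K. \<Sum>i=1..n. blinfun_apply (W k i) (X i \<omega>')"
      have "\<bar>\<Sum>i=1..n. h i \<omega> * Z (u, i) \<omega>'\<bar> \<le> ?R" if u: "u \<in> U" for u
      proof -
        let ?s = "\<Sum>i=1..n. h i \<omega> * Z (u, i) \<omega>'"
        let ?e = "if ?s \<ge> 0 then 1 else -1 :: real"
        have "\<bar>?s\<bar> = ?e * ?s" by simp
        also have "\<dots> = (\<Sum>i=1..n. blinfun_apply (W (u, ?e) i) (X i \<omega>'))"
          unfolding W_def Z_def sum_distrib_left by (simp add: blinfun.scaleR_left mult.assoc)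
        also have "\<dots> \<le> ?R"
          using K u by (intro Max_ge) (auto simp: K_def)
        finally show ?thesis .
      qed
      then show "?f \<omega> \<omega>' \<le> ?R" using U by (subst Max_le_iff) auto
    qed
    also have "\<dots> \<le> expectation (\<lambda>\<omega>'. ?L \<omega> * (MAX u\<in>U. \<bar>blinfun_apply u (X 1 \<omega>')\<bar>)) + expectation (\<lambda>_. 0)"
    proof (rule comparison[OF K, where P = P and Q = "\<lambda>_ _. 0"])
      fix k l assume "k \<in> K" "l \<in> K"
      let ?d = "cov (snd k *\<^sub>R fst k - snd l *\<^sub>R fst l) (snd k *\<^sub>R fst k - snd l *\<^sub>R fst l)"
      have "W k i - W l i = h i \<omega> *\<^sub>R (snd k *\<^sub>R fst k - snd l *\<^sub>R fst l)" for i
        unfolding W_def by (simp add: scaleR_right_diff_distrib mult.commute)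
      then have "cov (W k i - W l i) (W k i - W l i) = (h i \<omega>)\<^sup>2 * ?d" for i
        by (simp only: cov_scale power2_eq_square mult.assoc)
      then have "(\<Sum>i=1..n. cov (W k i - W l i) (W k i - W l i)) = (?L \<omega>)\<^sup>2 * ?d"
        unfolding L by (simp add: sum_distrib_right)
      moreover have "P k i - P l i = (if i = 1 then ?L \<omega> *\<^sub>R (snd k *\<^sub>R fst k - snd l *\<^sub>R fst l) else 0)" for i
        unfolding P_def by (simp add: scaleR_right_diff_distrib)
      then have "cov (P k i - P l i) (P k i - P l i) = (if i = 1 then (?L \<omega>)\<^sup>2 * ?d else 0)" for i
        by (simp only: cov_scale power2_eq_square mult.assoc cov_zero split: if_split) simp
      then have "(\<Sum>i=1..n. cov (P k i - P l i) (P k i - P l i)) = (?L \<omega>)\<^sup>2 * ?d" using n by simp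
      ultimately show "(\<Sum>i=1..n. cov (W k i - W l i) (W k i - W l i))
        \<le> (\<Sum>i=1..n. cov (P k i - P l i) (P k i - P l i)) + (\<Sum>i=1..n. cov (0 - 0) (0 - 0))"
        by (simp add: cov_zero)
    next
      fix k \<omega>1 \<omega>2 assume k: "k \<in> K"
      obtain u e where k': "k = (u, e)" "u \<in> U" "\<bar>e\<bar> = 1" using k unfolding K_def by auto
      have "(\<Sum>i=1..n. blinfun_apply (P k i) (X i \<omega>1)) = ?L \<omega> * (e * blinfun_apply u (X 1 \<omega>1))"
        unfolding P_def k'(1) fst_conv snd_conv using n
        by (simp add: if_distrib[of "\<lambda>a. blinfun_apply a _"] blinfun.scaleR_left cong: if_cong)
      also have "\<dots> \<le> ?L \<omega> * (MAX u\<in>U. \<bar>blinfun_apply u (X 1 \<omega>1)\<bar>)"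
      proof (intro mult_left_mono L2_set_nonneg)
        have "e * blinfun_apply u (X 1 \<omega>1) \<le> \<bar>blinfun_apply u (X 1 \<omega>1)\<bar>"
          using abs_ge_self[of "e * blinfun_apply u (X 1 \<omega>1)"] k'(3) by (simp only: abs_mult mult_1_left)
        also have "\<dots> \<le> (MAX u\<in>U. \<bar>blinfun_apply u (X 1 \<omega>1)\<bar>)" using U k'(2) by simp
        finally show "e * blinfun_apply u (X 1 \<omega>1) \<le> (MAX u\<in>U. \<bar>blinfun_apply u (X 1 \<omega>1)\<bar>)" .
      qed
      finally show "(\<Sum>i=1..n. blinfun_apply (P k i) (X i \<omega>1)) + (\<Sum>i=1..n. blinfun_apply 0 (X i \<omega>2))
        \<le> ?L \<omega> * (MAX u\<in>U. \<bar>blinfun_apply u (X 1 \<omega>1)\<bar>) + 0" by simp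
    qed (use mean_norm_integrable in auto)
    also have "\<dots> = ?L \<omega> * mean_norm" unfolding mean_norm_def by simp
    finally show ?thesis .
  qed
  have "expectation (\<lambda>\<omega>'. width (\<lambda>j. Z j \<omega>')) = (\<integral>\<omega>'. \<integral>\<omega>. ?f \<omega> \<omega>' \<partial>M \<partial>M)"
    unfolding width_def ..
  also have "\<dots> = (\<integral>\<omega>. \<integral>\<omega>'. ?f \<omega> \<omega>' \<partial>M \<partial>M)"
    by (rule P.Fubini_integral[OF int])
  also have "\<dots> \<le> (\<integral>\<omega>. ?L \<omega> * mean_norm \<partial>M)"
    by (intro integral_mono P.integrable_fst[OF int] inner integrable_mult_left L2_h_integrable)
  also have "\<dots> = (\<integral>\<omega>. ?L \<omega> \<partial>M) * mean_norm" by simp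
  also have "\<dots> \<le> sqrt n * mean_norm"
    by (intro mult_right_mono L2_h_expectation mean_norm_nonneg)
  finally show ?thesis .
qed

section \<open>Symmetrisation and decoupling of the quadratic forms\<close>

definition sym_deviation :: "(('a \<Rightarrow>\<^sub>L real) \<times> nat \<Rightarrow> real) \<Rightarrow> (('a \<Rightarrow>\<^sub>L real) \<times> nat \<Rightarrow> real) \<Rightarrow> real" where
  "sym_deviation x y = (MAX k\<in>U \<times> U. \<bar>\<Sum>i=1..n. x (fst k, i) * x (snd k, i) - y (fst k, i) * y (snd k, i)\<bar>)"
text \<open>At \<open>x = (\<lambda>j. Z j \<omega>)\<close> this is \<open>n\<close> times the
  error of the sample covariance, tested on pairs from \<open>U\<close>;
  \<open>sym_deviation\<close> has an independent copy in place of the mean.\<close>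

definition "deviation x = (MAX k\<in>U \<times> U. \<bar>(\<Sum>i=1..n. x (fst k, i) * x (snd k, i)) - n * cov (fst k) (snd k)\<bar>)"

text \<open>Polarisation: products are differences of squares of single functionals, whose variances
  are known from \<open>normal\<close>.\<close>

lemma Z_product:
  assumes "u \<in> U" "v \<in> U" "i \<in> {1..n}"
  shows "integrable M (\<lambda>\<omega>. Z (u, i) \<omega> * Z (v, i) \<omega>)" "expectation (\<lambda>\<omega>. Z (u, i) \<omega> * Z (v, i) \<omega>) = cov u v"
proof -
  have sq: "integrable M (\<lambda>\<omega>. (blinfun_apply w (X i \<omega>))\<^sup>2)" "expectation (\<lambda>\<omega>. (blinfun_apply w (X i \<omega>))\<^sup>2) = cov w w" for w
    using normal_rv_moments(1)[OF normal[OF assms(3), of w], of 2] normal_rv_moments(4)[OF normal[OF assms(3), of w]]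
    by (simp_all add: cov_def)
  have e: "Z (u, i) \<omega> * Z (v, i) \<omega> = ((blinfun_apply (u + v) (X i \<omega>))\<^sup>2 - (blinfun_apply (u - v) (X i \<omega>))\<^sup>2) / 4" for \<omega>
    unfolding Z_def by (simp add: blinfun.add_left blinfun.diff_left power2_eq_square algebra_simps)
  show "integrable M (\<lambda>\<omega>. Z (u, i) \<omega> * Z (v, i) \<omega>)"
    unfolding e by (intro integrable_divide_zero Bochner_Integration.integrable_diff sq)
  have "expectation (\<lambda>\<omega>. Z (u, i) \<omega> * Z (v, i) \<omega>) = (cov (u + v) (u + v) - cov (u - v) (u - v)) / 4"
    unfolding e using sq by simp
  then show "expectation (\<lambda>\<omega>. Z (u, i) \<omega> * Z (v, i) \<omega>) = cov u v"
    by (simp add: cov_add cov_diff cov_sym[of v u])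
qed

lemma sym_deviation_le: "sym_deviation x y \<le> (radius x)\<^sup>2 + (radius y)\<^sup>2"
proof -
  have "\<bar>\<Sum>i=1..n. x (u, i) * x (v, i) - y (u, i) * y (v, i)\<bar> \<le> (radius x)\<^sup>2 + (radius y)\<^sup>2" if "u \<in> U" "v \<in> U" for u v
  proof -
    have "\<bar>\<Sum>i=1..n. z (u, i) * z (v, i)\<bar> \<le> (radius z)\<^sup>2" for z
      using abs_sum_le_radius[OF that(2), of "\<lambda>i. z (u, i)" z]
        mult_right_mono[OF L2_le_radius[OF that(1), of z] radius_nonneg[of z]] by (simp add: power2_eq_square)
    from this[of x] this[of y] show ?thesis unfolding sum_subtractf by linarith
  qed
  then show ?thesis unfolding sym_deviation_def using UU by (subst Max_le_iff) auto
qed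

lemma MAX_abs_nonneg:
  fixes f :: "_ \<Rightarrow> real"
  shows "0 \<le> (MAX k\<in>U \<times> U. \<bar>f k\<bar>)"
proof -
  obtain k where "k \<in> U \<times> U" using UU by auto
  then show ?thesis using UU by (auto simp: Max_ge_iff)
qed

lemma sym_deviation_measurable:
  assumes "\<And>u i. u \<in> U \<Longrightarrow> i \<in> {1..n} \<Longrightarrow> (\<lambda>z. x z (u, i)) \<in> borel_measurable L"
    and "\<And>u i. u \<in> U \<Longrightarrow> i \<in> {1..n} \<Longrightarrow> (\<lambda>z. y z (u, i)) \<in> borel_measurable L"
  shows "(\<lambda>z. sym_deviation (x z) (y z)) \<in> borel_measurable L"
  unfolding sym_deviation_def
  by (intro borel_measurable_Max UU borel_measurable_abs borel_measurable_sum borel_measurable_times borel_measurable_diff assms) auto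

lemma decoupled_measurable:
  assumes "\<And>u i. u \<in> U \<Longrightarrow> i \<in> {1..n} \<Longrightarrow> (\<lambda>z. x z (u, i)) \<in> borel_measurable L"
    and "\<And>u i. u \<in> U \<Longrightarrow> i \<in> {1..n} \<Longrightarrow> (\<lambda>z. y z (u, i)) \<in> borel_measurable L"
  shows "(\<lambda>z. decoupled (x z) (y z)) \<in> borel_measurable L"
  unfolding decoupled_def
  by (intro borel_measurable_Max UU borel_measurable_abs borel_measurable_sum borel_measurable_times assms) auto

lemma sym_deviation_power_le: "sym_deviation x y ^ r \<le> 2 ^ r * (radius x ^ (2 * r) + radius y ^ (2 * r))"
proof -
  have "sym_deviation x y ^ r \<le> ((radius x)\<^sup>2 + (radius y)\<^sup>2) ^ r"
    using sym_deviation_le MAX_abs_nonneg by (intro power_mono) (auto simp: sym_deviation_def)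
  also have "\<dots> \<le> 2 ^ r * (((radius x)\<^sup>2) ^ r + ((radius y)\<^sup>2) ^ r)"
    by (intro power_add_le) auto
  finally show ?thesis by (simp add: power_mult)
qed

lemma sym_deviation_integrable:
  "integrable (M \<Otimes>\<^sub>M M) (\<lambda>z. sym_deviation (\<lambda>j. Z j (fst z)) (\<lambda>j. Z j (snd z)) ^ r)"
  "integrable M (\<lambda>\<omega>. sym_deviation x (\<lambda>j. Z j \<omega>) ^ r)"
proof -
  have D0: "0 \<le> sym_deviation x y" for x y unfolding sym_deviation_def by (rule MAX_abs_nonneg)
  have n2: "norm (sym_deviation x y ^ r) \<le> norm (2 ^ r * (radius x ^ (2 * r) + radius y ^ (2 * r)))" for x y
    using sym_deviation_power_le[of x y r] D0 radius_nonneg by simp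
  show "integrable (M \<Otimes>\<^sub>M M) (\<lambda>z. sym_deviation (\<lambda>j. Z j (fst z)) (\<lambda>j. Z j (snd z)) ^ r)"
  proof (rule Bochner_Integration.integrable_bound)
    show "integrable (M \<Otimes>\<^sub>M M) (\<lambda>z. 2 ^ r * (radius (\<lambda>j. Z j (fst z)) ^ (2 * r) + radius (\<lambda>j. Z j (snd z)) ^ (2 * r)))"
      using P.integrable_pair_mult[OF radius_integrable[of "2 * r"] integrable_const[of 1]]
        P.integrable_pair_mult[OF integrable_const[of 1] radius_integrable[of "2 * r"]]
      by (intro integrable_mult_right Bochner_Integration.integrable_add) simp_all
    show "(\<lambda>z. sym_deviation (\<lambda>j. Z j (fst z)) (\<lambda>j. Z j (snd z)) ^ r) \<in> borel_measurable (M \<Otimes>\<^sub>M M)"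
      by (intro borel_measurable_power sym_deviation_measurable Z_pair_measurable)
  qed (use n2 in simp)
  show "integrable M (\<lambda>\<omega>. sym_deviation x (\<lambda>j. Z j \<omega>) ^ r)"
  proof (rule Bochner_Integration.integrable_bound)
    show "integrable M (\<lambda>\<omega>. 2 ^ r * (radius x ^ (2 * r) + radius (\<lambda>j. Z j \<omega>) ^ (2 * r)))"
      by (intro integrable_mult_right Bochner_Integration.integrable_add radius_integrable integrable_const)
    show "(\<lambda>\<omega>. sym_deviation x (\<lambda>j. Z j \<omega>) ^ r) \<in> borel_measurable M"
      by (intro borel_measurable_power sym_deviation_measurable Z_measurable) (auto simp: J_def)
  qed (use n2 in simp)
qed

text \<open>Averaging over the copy in \<open>sym_deviation\<close> restores
  \<open>n * cov u v\<close>, and the maximum of absolute means is at most the mean of the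
  maximum.\<close>

lemma deviation_le: "deviation x \<le> expectation (\<lambda>\<omega>. sym_deviation x (\<lambda>j. Z j \<omega>))"
proof -
  have "\<bar>(\<Sum>i=1..n. x (u, i) * x (v, i)) - n * cov u v\<bar> \<le> expectation (\<lambda>\<omega>. sym_deviation x (\<lambda>j. Z j \<omega>))"
    if uv: "u \<in> U" "v \<in> U" for u v
  proof -
    let ?g = "\<lambda>\<omega>. \<Sum>i=1..n. x (u, i) * x (v, i) - Z (u, i) \<omega> * Z (v, i) \<omega>"
    have ig: "integrable M ?g"
      using Z_product(1)[OF uv] by (intro Bochner_Integration.integrable_sum Bochner_Integration.integrable_diff integrable_const)
    have "expectation ?g = (\<Sum>i=1..n. x (u, i) * x (v, i) - cov u v)"
      using Z_product[OF uv] by (simp add: Bochner_Integration.integral_sum prob_space)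
    then have "\<bar>(\<Sum>i=1..n. x (u, i) * x (v, i)) - n * cov u v\<bar> = \<bar>expectation ?g\<bar>"
      by (simp add: sum_subtractf)
    also have "\<dots> \<le> expectation (\<lambda>\<omega>. \<bar>?g \<omega>\<bar>)" by (rule integral_abs_bound)
    also have "\<dots> \<le> expectation (\<lambda>\<omega>. sym_deviation x (\<lambda>j. Z j \<omega>))"
    proof (rule integral_mono)
      show "integrable M (\<lambda>\<omega>. sym_deviation x (\<lambda>j. Z j \<omega>))" using sym_deviation_integrable(2)[of x 1] by simp
      show "\<bar>?g \<omega>\<bar> \<le> sym_deviation x (\<lambda>j. Z j \<omega>)" for \<omega>
        unfolding sym_deviation_def using UU uv by (intro Max_ge) (auto intro!: image_eqI[where x="(u, v)"])
    qed (use ig in simp)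
    finally show ?thesis .
  qed
  then show ?thesis unfolding deviation_def using UU by (subst Max_le_iff) auto
qed

lemma decoupled_integrable: "integrable (M \<Otimes>\<^sub>M M) (\<lambda>z. decoupled (\<lambda>j. Z j (fst z)) (\<lambda>j. Z j (snd z)) ^ r)"
proof (rule Bochner_Integration.integrable_bound)
  show "integrable (M \<Otimes>\<^sub>M M) (\<lambda>z. radius (\<lambda>j. Z j (fst z)) ^ r * radius (\<lambda>j. Z j (snd z)) ^ r)"
    by (intro P.integrable_pair_mult radius_integrable)
  show "(\<lambda>z. decoupled (\<lambda>j. Z j (fst z)) (\<lambda>j. Z j (snd z)) ^ r) \<in> borel_measurable (M \<Otimes>\<^sub>M M)"
    by (intro borel_measurable_power decoupled_measurable Z_pair_measurable)
  have V0: "0 \<le> decoupled x y" for x y unfolding decoupled_def by (rule MAX_abs_nonneg)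
  have "norm (decoupled x y ^ r) \<le> norm (radius x ^ r * radius y ^ r)" for x y
    using power_mono[OF decoupled_le[of x y] V0, of r] V0 radius_nonneg by (simp add: power_mult_distrib)
  then show "AE z in M \<Otimes>\<^sub>M M. norm (decoupled (\<lambda>j. Z j (fst z)) (\<lambda>j. Z j (snd z)) ^ r)
      \<le> norm (radius (\<lambda>j. Z j (fst z)) ^ r * radius (\<lambda>j. Z j (snd z)) ^ r)" by simp
qed

text \<open>A rotation by 45 degrees turns a difference of quadratic forms into a bilinear form:
  with \<open>a\<^sup>2 = 1 / 2\<close>, the difference of the products for
  \<open>a * x + a * y\<close> and \<open>a * x - a * y\<close> is
  \<open>x (u, i) * y (v, i) + x (v, i) * y (u, i)\<close>. Each of the two sums over
  \<open>i\<close> is at most \<open>decoupled x y\<close>, which gives the factor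
  \<open>2 ^ r\<close>.\<close>

lemma decoupling:
  assumes r: "r = 2 ^ k"
  shows "integrable M (\<lambda>\<omega>. deviation (\<lambda>j. Z j \<omega>) ^ r)"
    and "expectation (\<lambda>\<omega>. deviation (\<lambda>j. Z j \<omega>) ^ r)
      \<le> 2 ^ r * (\<integral>\<omega>. \<integral>\<omega>'. decoupled (\<lambda>j. Z j \<omega>) (\<lambda>j. Z j \<omega>') ^ r \<partial>M \<partial>M)"
proof -
  let ?Z = "\<lambda>\<omega> j. Z j \<omega>"
  have W0: "0 \<le> deviation x" for x unfolding deviation_def by (rule MAX_abs_nonneg)
  have le: "deviation x ^ r \<le> expectation (\<lambda>\<omega>. sym_deviation x (?Z \<omega>) ^ r)" for x
  proof -
    have "deviation x ^ r \<le> (expectation (\<lambda>\<omega>. sym_deviation x (?Z \<omega>))) ^ r"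
      by (intro power_mono deviation_le W0)
    also have "\<dots> \<le> expectation (\<lambda>\<omega>. sym_deviation x (?Z \<omega>) ^ r)"
      using sym_deviation_integrable(2)[of x 1] by (intro expectation_power_le[OF r] sym_deviation_integrable) simp
    finally show ?thesis .
  qed
  have iD: "integrable (M \<Otimes>\<^sub>M M) (\<lambda>(\<omega>, \<omega>'). sym_deviation (?Z \<omega>) (?Z \<omega>') ^ r)"
    using sym_deviation_integrable(1)[of r] by (simp add: case_prod_beta')
  show iW: "integrable M (\<lambda>\<omega>. deviation (?Z \<omega>) ^ r)"
  proof (rule Bochner_Integration.integrable_bound[OF P.integrable_fst[OF iD]])
    show "(\<lambda>\<omega>. deviation (?Z \<omega>) ^ r) \<in> borel_measurable M"
      unfolding deviation_def
      by (intro borel_measurable_power borel_measurable_Max UU borel_measurable_abs borel_measurable_sum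
        borel_measurable_times borel_measurable_diff Z_measurable borel_measurable_const) (auto simp: J_def)
    show "AE \<omega> in M. norm (deviation (?Z \<omega>) ^ r) \<le> norm (\<integral>\<omega>'. sym_deviation (?Z \<omega>) (?Z \<omega>') ^ r \<partial>M)"
      using le W0 by (intro always_eventually allI) (auto intro: order_trans[OF _ abs_ge_self])
  qed
  define a where "a = 1 / sqrt (2::real)"
  have a: "a\<^sup>2 + a\<^sup>2 = 1" unfolding a_def by (simp add: power_divide)
  define H where "H x y = sym_deviation x y ^ r" for x y
  have comp: "(\<lambda>z. fst z (u, i)) \<in> borel_measurable (Pi\<^sub>M J (\<lambda>_. borel) \<Otimes>\<^sub>M Pi\<^sub>M J (\<lambda>_. borel))"
    "(\<lambda>z. snd z (u, i)) \<in> borel_measurable (Pi\<^sub>M J (\<lambda>_. borel) \<Otimes>\<^sub>M Pi\<^sub>M J (\<lambda>_. borel))"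
    if "u \<in> U" "i \<in> {1..n}" for u i
  proof -
    have "(\<lambda>x. x (u, i)) \<in> borel_measurable (Pi\<^sub>M J (\<lambda>_. borel))"
      using that by (intro measurable_component_singleton) (simp add: J_def)
    from measurable_compose[OF measurable_fst this] measurable_compose[OF measurable_snd this]
    show "(\<lambda>z. fst z (u, i)) \<in> borel_measurable (Pi\<^sub>M J (\<lambda>_. borel) \<Otimes>\<^sub>M Pi\<^sub>M J (\<lambda>_. borel))"
      "(\<lambda>z. snd z (u, i)) \<in> borel_measurable (Pi\<^sub>M J (\<lambda>_. borel) \<Otimes>\<^sub>M Pi\<^sub>M J (\<lambda>_. borel))" .
  qed
  have Hm: "(\<lambda>z. H (fst z) (snd z)) \<in> borel_measurable (Pi\<^sub>M J (\<lambda>_. borel) \<Otimes>\<^sub>M Pi\<^sub>M J (\<lambda>_. borel))"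
    unfolding H_def by (intro borel_measurable_power sym_deviation_measurable comp)
  have Hr: "H (restrict x J) (restrict y J) = H x y" for x y
  proof -
    have "sym_deviation (restrict x J) (restrict y J) = sym_deviation x y"
      unfolding sym_deviation_def J_def by (intro arg_cong[where f=Max] image_cong refl arg_cong[where f=abs] sum.cong) auto
    then show ?thesis unfolding H_def by simp
  qed
  have rot: "H (\<lambda>j. a * x j + a * y j) (\<lambda>j. a * x j - a * y j) \<le> 2 ^ r * decoupled x y ^ r" for x y
  proof -
    have "\<bar>\<Sum>i=1..n. (a * x (u, i) + a * y (u, i)) * (a * x (v, i) + a * y (v, i))
        - (a * x (u, i) - a * y (u, i)) * (a * x (v, i) - a * y (v, i))\<bar> \<le> 2 * decoupled x y" if "u \<in> U" "v \<in> U" for u v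
    proof -
      have V: "\<bar>\<Sum>i=1..n. x (u', i) * y (v', i)\<bar> \<le> decoupled x y" if "u' \<in> U" "v' \<in> U" for u' v'
        unfolding decoupled_def using UU that by (intro Max_ge) (auto intro!: image_eqI[where x="(u', v')"])
      have "(\<Sum>i=1..n. (a * x (u, i) + a * y (u, i)) * (a * x (v, i) + a * y (v, i))
        - (a * x (u, i) - a * y (u, i)) * (a * x (v, i) - a * y (v, i)))
        = (\<Sum>i=1..n. (a\<^sup>2 + a\<^sup>2) * (x (u, i) * y (v, i) + x (v, i) * y (u, i)))"
        by (intro sum.cong refl) (simp add: power2_eq_square algebra_simps)
      also have "\<dots> = (\<Sum>i=1..n. x (u, i) * y (v, i)) + (\<Sum>i=1..n. x (v, i) * y (u, i))"
        unfolding a by (simp add: sum.distrib)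
      finally show ?thesis using V[OF that] V[OF that(2,1)] by linarith
    qed
    then have "sym_deviation (\<lambda>j. a * x j + a * y j) (\<lambda>j. a * x j - a * y j) \<le> 2 * decoupled x y"
      unfolding sym_deviation_def using UU by (subst Max_le_iff) auto
    then have "H (\<lambda>j. a * x j + a * y j) (\<lambda>j. a * x j - a * y j) \<le> (2 * decoupled x y) ^ r"
      unfolding H_def using MAX_abs_nonneg by (intro power_mono) (auto simp: sym_deviation_def)
    then show ?thesis by (simp add: power_mult_distrib)
  qed
  have "expectation (\<lambda>\<omega>. deviation (?Z \<omega>) ^ r) \<le> (\<integral>\<omega>. \<integral>\<omega>'. sym_deviation (?Z \<omega>) (?Z \<omega>') ^ r \<partial>M \<partial>M)"
    by (intro integral_mono iW P.integrable_fst[OF iD] le)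
  also have "\<dots> = (\<integral>z. H (?Z (fst z)) (?Z (snd z)) \<partial>(M \<Otimes>\<^sub>M M))"
    using P.integral_fst[OF iD] by (simp add: H_def case_prod_beta')
  also have "\<dots> = (\<integral>z. H (\<lambda>j. a * Z j (fst z) + a * Z j (snd z)) (\<lambda>j. a * Z j (fst z) - a * Z j (snd z)) \<partial>(M \<Otimes>\<^sub>M M))"
    by (rule gaussian_family_rotation_integral(2)[where H=H and J=J and Z=Z, OF M Z_family a Hm Hr, symmetric])
  also have "\<dots> \<le> (\<integral>z. 2 ^ r * decoupled (?Z (fst z)) (?Z (snd z)) ^ r \<partial>(M \<Otimes>\<^sub>M M))"
  proof (rule integral_mono)
    show "integrable (M \<Otimes>\<^sub>M M) (\<lambda>z. H (\<lambda>j. a * Z j (fst z) + a * Z j (snd z)) (\<lambda>j. a * Z j (fst z) - a * Z j (snd z)))"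
      using gaussian_family_rotation_integral(1)[where H=H and J=J and Z=Z, OF M Z_family a Hm Hr] sym_deviation_integrable(1)[of r]
      by (simp add: H_def)
    show "integrable (M \<Otimes>\<^sub>M M) (\<lambda>z. 2 ^ r * decoupled (?Z (fst z)) (?Z (snd z)) ^ r)"
      by (intro integrable_mult_right decoupled_integrable)
  qed (rule rot)
  also have "\<dots> = 2 ^ r * (\<integral>\<omega>. \<integral>\<omega>'. decoupled (?Z \<omega>) (?Z \<omega>') ^ r \<partial>M \<partial>M)"
    using P.integral_fst'[OF decoupled_integrable[of r]] by simp
  finally show "expectation (\<lambda>\<omega>. deviation (?Z \<omega>) ^ r) \<le> 2 ^ r * (\<integral>\<omega>. \<integral>\<omega>'. decoupled (?Z \<omega>) (?Z \<omega>') ^ r \<partial>M \<partial>M)" .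
qed


lemma cond_bound_integrable: "integrable M (\<lambda>\<omega>. cond_bound (\<lambda>j. Z j \<omega>) ^ p)"
  by (rule integrable_seminorm_power[OF M Z_family cond_bound_seminorm])

lemma decoupled_integrable_outer: "integrable M (\<lambda>\<omega>. \<integral>\<omega>'. decoupled (\<lambda>j. Z j \<omega>) (\<lambda>j. Z j \<omega>') ^ r \<partial>M)"
  by (rule P.integrable_fst) (use decoupled_integrable[of r] in \<open>simp add: case_prod_beta'\<close>)

lemma decoupled_first_moment:
  "(\<integral>\<omega>. \<integral>\<omega>'. decoupled (\<lambda>j. Z j \<omega>) (\<lambda>j. Z j \<omega>') \<partial>M \<partial>M) \<le> sqrt 2 * expectation (\<lambda>\<omega>. cond_bound (\<lambda>j. Z j \<omega>))"
proof -
  have "(\<integral>\<omega>. \<integral>\<omega>'. decoupled (\<lambda>j. Z j \<omega>) (\<lambda>j. Z j \<omega>') \<partial>M \<partial>M) \<le> expectation (\<lambda>\<omega>. sqrt 2 * cond_bound (\<lambda>j. Z j \<omega>))"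
    using decoupled_integrable_outer[of 1] cond_bound_integrable[of 1]
    by (intro integral_mono decoupled_expectation_le integrable_mult_right) simp_all
  then show ?thesis by simp
qed

text \<open>The second use of the moment bound is possible because \<open>cond_bound\<close>, which
  dominates the conditional mean, is again a seminorm of the sample. The two factors
  \<open>20 * sqrt r\<close> multiply to \<open>400 * r\<close>.\<close>

lemma decoupled_moments:
  assumes r: "r = 2 ^ k"
  shows "(\<integral>\<omega>. \<integral>\<omega>'. decoupled (\<lambda>j. Z j \<omega>) (\<lambda>j. Z j \<omega>') ^ r \<partial>M \<partial>M)
    \<le> (400 * sqrt 2 * real r * expectation (\<lambda>\<omega>. cond_bound (\<lambda>j. Z j \<omega>))) ^ r"
proof -
  let ?Z = "\<lambda>\<omega> j. Z j \<omega>"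
  let ?c = "20 * sqrt (real r)"
  have inner: "(\<integral>\<omega>'. decoupled x (?Z \<omega>') ^ r \<partial>M) \<le> (?c * sqrt 2) ^ r * cond_bound x ^ r" for x
  proof -
    have "(\<integral>\<omega>'. decoupled x (?Z \<omega>') ^ r \<partial>M) \<le> (?c * expectation (\<lambda>\<omega>'. decoupled x (?Z \<omega>'))) ^ r"
      by (rule gaussian_seminorm_moments[OF M Z_family decoupled_seminorm r])
    also have "\<dots> \<le> (?c * (sqrt 2 * cond_bound x)) ^ r"
      using measurable_seminorm_D(2)[OF decoupled_seminorm]
      by (intro power_mono mult_left_mono decoupled_expectation_le mult_nonneg_nonneg Bochner_Integration.integral_nonneg) auto
    finally show ?thesis by (simp only: power_mult_distrib mult.assoc)
  qed
  have "(\<integral>\<omega>. \<integral>\<omega>'. decoupled (?Z \<omega>) (?Z \<omega>') ^ r \<partial>M \<partial>M) \<le> expectation (\<lambda>\<omega>. (?c * sqrt 2) ^ r * cond_bound (?Z \<omega>) ^ r)"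
    by (intro integral_mono decoupled_integrable_outer inner integrable_mult_right cond_bound_integrable)
  also have "\<dots> = (?c * sqrt 2) ^ r * expectation (\<lambda>\<omega>. cond_bound (?Z \<omega>) ^ r)" by simp
  also have "\<dots> \<le> (?c * sqrt 2) ^ r * (?c * expectation (\<lambda>\<omega>. cond_bound (?Z \<omega>))) ^ r"
    by (intro mult_left_mono gaussian_seminorm_moments[OF M Z_family cond_bound_seminorm r]) simp
  also have "\<dots> = ((?c * sqrt 2) * (?c * expectation (\<lambda>\<omega>. cond_bound (?Z \<omega>)))) ^ r"
    by (simp only: power_mult_distrib)
  also have "(?c * sqrt 2) * (?c * expectation (\<lambda>\<omega>. cond_bound (?Z \<omega>))) = 400 * sqrt 2 * real r * expectation (\<lambda>\<omega>. cond_bound (?Z \<omega>))"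
  proof -
    have "(20 * s * t) * (20 * s * e) = 400 * t * (s * s) * e" for s t e :: real by simp
    then show ?thesis by (simp only: real_sqrt_mult_self abs_of_nat)
  qed
  finally show ?thesis .
qed

text \<open>The mean of \<open>cond_bound\<close> involves the mean \<open>a\<close> of
  \<open>radius\<close>, and \<open>a\<^sup>2\<close> is at most \<open>n * norm S\<close> plus the
  mean deviation, which decoupling bounds by the mean of \<open>cond_bound\<close> again. All these
  means are finite, so the circle is a quadratic inequality for \<open>a\<close>, solved by
  \<open>a \<le> s + 5 * mean_norm\<close>.\<close>

lemma cond_bound_expectation:
  "0 \<le> expectation (\<lambda>\<omega>. cond_bound (\<lambda>j. Z j \<omega>))"
  "expectation (\<lambda>\<omega>. cond_bound (\<lambda>j. Z j \<omega>)) \<le> 2 * (sdev * sqrt n * mean_norm) + 5 * mean_norm\<^sup>2"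
proof -
  let ?Z = "\<lambda>\<omega> j. Z j \<omega>"
  define a where "a = expectation (\<lambda>\<omega>. radius (?Z \<omega>))"
  define E where "E = expectation (\<lambda>\<omega>. cond_bound (?Z \<omega>))"
  have a0: "0 \<le> a" unfolding a_def by (intro Bochner_Integration.integral_nonneg radius_nonneg)
  show "0 \<le> expectation (\<lambda>\<omega>. cond_bound (?Z \<omega>))"
    by (intro Bochner_Integration.integral_nonneg measurable_seminorm_D(2)[OF cond_bound_seminorm])
  have i1: "integrable M (\<lambda>\<omega>. width (?Z \<omega>))"
    using integrable_seminorm_power[OF M Z_family width_seminorm, of 1] by simp
  have i2: "integrable M (\<lambda>\<omega>. radius (?Z \<omega>))" using radius_integrable[of 1] by simp
  have "E = sdev * expectation (\<lambda>\<omega>. width (?Z \<omega>)) + mean_norm * a"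
    unfolding E_def a_def cond_bound_def using i1 i2 by simp
  also have "\<dots> \<le> sdev * (sqrt n * mean_norm) + mean_norm * a"
    using width_expectation sdev by (intro add_right_mono mult_left_mono)
  finally have E: "E \<le> sdev * sqrt n * mean_norm + mean_norm * a" by (simp add: mult.assoc)
  have "a\<^sup>2 \<le> expectation (\<lambda>\<omega>. (radius (?Z \<omega>))\<^sup>2)"
    unfolding a_def by (rule expectation_power_le[of 2 1]) (use i2 radius_integrable in auto)
  \<comment> \<open>The squared radius is attained at some \<open>u\<close> and is the quadratic
    form at \<open>(u, u)\<close>, a pair that \<open>deviation\<close> takes into account.\<close>
  also have "\<dots> \<le> expectation (\<lambda>\<omega>. n * norm S + deviation (?Z \<omega>))"
  proof (rule integral_mono[OF radius_integrable])
    show "integrable M (\<lambda>\<omega>. n * norm S + deviation (?Z \<omega>))"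
      using decoupling(1)[of 1 0] by simp
    fix \<omega>
    let ?x = "?Z \<omega>"
    have "radius ?x \<in> (\<lambda>u. L2_set (\<lambda>i. ?x (u, i)) {1..n}) ` U"
      unfolding radius_def using U by (intro Max_in) auto
    then obtain u where u: "u \<in> U" "radius ?x = L2_set (\<lambda>i. ?x (u, i)) {1..n}" by auto
    have "(radius ?x)\<^sup>2 = (\<Sum>i=1..n. ?x (u, i) * ?x (u, i))"
      unfolding u(2) L2_set_def by (simp add: sum_nonneg power2_eq_square)
    moreover have "\<bar>(\<Sum>i=1..n. ?x (u, i) * ?x (u, i)) - n * cov u u\<bar> \<le> deviation ?x"
      unfolding deviation_def using UU u(1) by (intro Max_ge) (auto intro!: image_eqI[where x="(u, u)"])
    moreover have "n * cov u u \<le> n * norm S"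
      using cov_le[OF u(1)] by (intro mult_left_mono) auto
    ultimately show "(radius ?x)\<^sup>2 \<le> n * norm S + deviation ?x" by linarith
  qed
  also have "\<dots> = n * norm S + expectation (\<lambda>\<omega>. deviation (?Z \<omega>))"
    using decoupling(1)[of 1 0] by (simp add: prob_space)
  also have "expectation (\<lambda>\<omega>. deviation (?Z \<omega>)) \<le> 2 * (sqrt 2 * E)"
    using decoupling(2)[of 1 0] decoupled_first_moment unfolding E_def by simp
  finally have "a\<^sup>2 \<le> n * norm S + 2 * (sqrt 2 * E)" by simp
  moreover have "sqrt 2 \<le> 1.5" by (rule real_le_lsqrt) (simp_all add: power2_eq_square)
  then have "sqrt 2 * E \<le> 1.5 * E"
    using \<open>0 \<le> expectation (\<lambda>\<omega>. cond_bound (?Z \<omega>))\<close> unfolding E_def by (rule mult_right_mono)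
  moreover define s where "s = sdev * sqrt n"
  have s: "0 \<le> s" "s\<^sup>2 = n * norm S" unfolding s_def using sdev by (auto simp: power_mult_distrib)
  ultimately have a2: "a\<^sup>2 \<le> s\<^sup>2 + 3 * (s * mean_norm + mean_norm * a)"
    using E unfolding s_def by simp
  \<comment> \<open>The coefficient 3 in \<open>a2\<close> is \<open>2 * 1.5\<close>, and 5 leaves
    room above it: a larger \<open>a\<close> would satisfy
    \<open>a\<^sup>2 > s * a + 5 * mean_norm * a\<close> together with
    \<open>s * a \<ge> s\<^sup>2 + 5 * s * mean_norm\<close>, against \<open>a2\<close>.\<close>
  have "a \<le> s + 5 * mean_norm"
  proof (rule ccontr)
    assume "\<not> a \<le> s + 5 * mean_norm"
    then have g: "s + 5 * mean_norm < a" by simp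
    have ap: "0 < a" using g s mean_norm_nonneg by linarith
    have "(s + 5 * mean_norm) * a < a * a" using g ap by simp
    moreover have "s * (s + 5 * mean_norm) \<le> s * a" using g s by (intro mult_left_mono) auto
    moreover have "0 \<le> s * mean_norm" "0 \<le> mean_norm * a" using s mean_norm_nonneg a0 by auto
    ultimately show False using a2 by (simp add: power2_eq_square algebra_simps)
  qed
  then have "mean_norm * a \<le> mean_norm * (s + 5 * mean_norm)" using mean_norm_nonneg by (rule mult_left_mono)
  then show "expectation (\<lambda>\<omega>. cond_bound (?Z \<omega>)) \<le> 2 * (sdev * sqrt n * mean_norm) + 5 * mean_norm\<^sup>2"
    using E unfolding E_def s_def by (simp add: power2_eq_square algebra_simps)
qed

text \<open>Collects the constants: 2 from decoupling and \<open>400 * sqrt 2\<close> from the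
  chaos, with \<open>sqrt 2 \<le> 1.5\<close>. The factor 5 belongs to the mean of
  \<open>cond_bound\<close>.\<close>

theorem deviation_moments:
  assumes r: "r = 2 ^ k"
  shows "integrable M (\<lambda>\<omega>. deviation (\<lambda>j. Z j \<omega>) ^ r)"
    and "expectation (\<lambda>\<omega>. deviation (\<lambda>j. Z j \<omega>) ^ r) \<le> (1200 * real r * (2 * (sdev * sqrt n * mean_norm) + 5 * mean_norm\<^sup>2)) ^ r"
proof -
  let ?E = "expectation (\<lambda>\<omega>. cond_bound (\<lambda>j. Z j \<omega>))"
  show "integrable M (\<lambda>\<omega>. deviation (\<lambda>j. Z j \<omega>) ^ r)" by (rule decoupling(1)[OF r])
  have "expectation (\<lambda>\<omega>. deviation (\<lambda>j. Z j \<omega>) ^ r) \<le> 2 ^ r * (400 * sqrt 2 * real r * ?E) ^ r"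
    by (rule order_trans[OF decoupling(2)[OF r]]) (rule mult_left_mono[OF decoupled_moments[OF r]], simp)
  also have "\<dots> = (800 * sqrt 2 * real r * ?E) ^ r"
    unfolding power_mult_distrib[symmetric] by (simp only: mult.assoc[symmetric]) simp
  also have "\<dots> \<le> (1200 * real r * (2 * (sdev * sqrt n * mean_norm) + 5 * mean_norm\<^sup>2)) ^ r"
  proof (intro power_mono mult_mono)
    have "sqrt 2 \<le> 1.5" by (rule real_le_lsqrt) (simp_all add: power2_eq_square)
    then show "800 * sqrt 2 \<le> 1200" by simp
  qed (use cond_bound_expectation in auto)
  finally show "expectation (\<lambda>\<omega>. deviation (\<lambda>j. Z j \<omega>) ^ r) \<le> (1200 * real r * (2 * (sdev * sqrt n * mean_norm) + 5 * mean_norm\<^sup>2)) ^ r" .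
qed

end

section \<open>Norming functionals\<close>

definition sublinear :: "('a::real_vector \<Rightarrow> real) \<Rightarrow> bool" where
  "sublinear p \<longleftrightarrow> (\<forall>x y. p (x + y) \<le> p x + p y) \<and> (\<forall>c x. 0 \<le> c \<longrightarrow> p (c *\<^sub>R x) = c * p x)"

lemma sublinearD:
  assumes "sublinear p"
  shows "p (x + y) \<le> p x + p y" "0 \<le> c \<Longrightarrow> p (c *\<^sub>R x) = c * p x" "p 0 = 0" "- p (- x) \<le> p x"
proof -
  show 1: "p (x + y) \<le> p x + p y" for x y using assms by (simp add: sublinear_def)
  show 2: "0 \<le> c \<Longrightarrow> p (c *\<^sub>R x) = c * p x" for c x using assms by (simp add: sublinear_def)
  show 3: "p 0 = 0" using 2[of 0 0] by simp
  show "- p (- x) \<le> p x" using 1[of x "- x"] 3 by simp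
qed

text \<open>The lowering of \<open>p\<close> along the ray of \<open>x\<close> from the proof of the
  Hahn-Banach theorem. It stays below \<open>p\<close> by \<open>t = 0\<close>, and
  \<open>t = 1\<close> shows that its value at \<open>- x\<close> is at most \<open>- p x\<close>,
  so a linear functional below it attains \<open>p\<close> at \<open>x\<close>.\<close>

definition sublinear_shift :: "('a::real_vector \<Rightarrow> real) \<Rightarrow> 'a \<Rightarrow> 'a \<Rightarrow> real" where
  "sublinear_shift p x y = (INF t\<in>{0..}. p (y + t *\<^sub>R x) - t * p x)"

lemma sublinear_shift_bdd:
  assumes "sublinear p"
  shows "bdd_below ((\<lambda>t. p (y + t *\<^sub>R x) - t * p x) ` {0..})"
proof (rule bdd_belowI2)
  fix t :: real assume "t \<in> {0..}"
  then show "- p (- y) \<le> p (y + t *\<^sub>R x) - t * p x"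
    using sublinearD(1)[OF assms, of "y + t *\<^sub>R x" "- y"] sublinearD(2)[OF assms, of t x] by simp
qed

lemma sublinear_shift_le:
  assumes "sublinear p" "0 \<le> t"
  shows "sublinear_shift p x y \<le> p (y + t *\<^sub>R x) - t * p x"
  unfolding sublinear_shift_def by (rule cINF_lower[OF sublinear_shift_bdd[OF assms(1)]]) (use assms in auto)

lemma sublinear_shift_sublinear:
  assumes p: "sublinear p"
  shows "sublinear (sublinear_shift p x)"
  unfolding sublinear_def
proof (intro conjI allI impI)
  let ?q = "sublinear_shift p x"
  show "?q (y + z) \<le> ?q y + ?q z" for y z
  proof -
    have "?q (y + z) - (p (z + t *\<^sub>R x) - t * p x) \<le> p (y + s *\<^sub>R x) - s * p x" if "0 \<le> s" "0 \<le> t" for s t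
    proof -
      have "?q (y + z) \<le> p ((y + z) + (s + t) *\<^sub>R x) - (s + t) * p x"
        by (rule sublinear_shift_le[OF p]) (use that in simp)
      also have "p ((y + z) + (s + t) *\<^sub>R x) \<le> p (y + s *\<^sub>R x) + p (z + t *\<^sub>R x)"
        using sublinearD(1)[OF p, of "y + s *\<^sub>R x" "z + t *\<^sub>R x"] by (simp add: algebra_simps)
      finally show ?thesis by (simp add: algebra_simps)
    qed
    then have "?q (y + z) - (p (z + t *\<^sub>R x) - t * p x) \<le> ?q y" if "0 \<le> t" for t
      unfolding sublinear_shift_def[of p x y] using that by (intro cINF_greatest) auto
    then have "?q (y + z) - ?q y \<le> p (z + t *\<^sub>R x) - t * p x" if "0 \<le> t" for t
      using that by (simp add: algebra_simps)
    then have "?q (y + z) - ?q y \<le> ?q z"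
      unfolding sublinear_shift_def[of p x z] by (intro cINF_greatest) auto
    then show ?thesis by simp
  qed
  show "?q (c *\<^sub>R y) = c * ?q y" if c: "0 \<le> c" for c y
  proof -
    have le: "?q (c *\<^sub>R y) \<le> c * ?q y" if c: "0 < c" for c y
    proof -
      have "?q (c *\<^sub>R y) / c \<le> p (y + t *\<^sub>R x) - t * p x" if "0 \<le> t" for t
      proof -
        have "?q (c *\<^sub>R y) \<le> p (c *\<^sub>R y + (c * t) *\<^sub>R x) - (c * t) * p x"
          by (rule sublinear_shift_le[OF p]) (use c that in simp)
        also have "p (c *\<^sub>R y + (c * t) *\<^sub>R x) = c * p (y + t *\<^sub>R x)"
          using sublinearD(2)[OF p, of c "y + t *\<^sub>R x"] c by (simp add: scaleR_add_right)
        finally show ?thesis using c by (simp add: field_simps)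
      qed
      then have "?q (c *\<^sub>R y) / c \<le> ?q y"
        unfolding sublinear_shift_def[of p x y] by (intro cINF_greatest) auto
      then show ?thesis using c by (simp add: field_simps)
    qed
    show ?thesis
    proof (cases "c = 0")
      case True
      have "?q 0 \<le> 0" using sublinear_shift_le[OF p order_refl, of x 0] sublinearD(3)[OF p] by simp
      moreover have "0 \<le> ?q 0"
        unfolding sublinear_shift_def using sublinearD(2)[OF p] by (intro cINF_greatest) auto
      ultimately show ?thesis using True by simp
    next
      case False
      then have c: "0 < c" using that by simp
      have "?q y \<le> (1 / c) * ?q (c *\<^sub>R y)" using le[of "1 / c" "c *\<^sub>R y"] c by simp
      then have "c * ?q y \<le> ?q (c *\<^sub>R y)" using c by (simp add: field_simps)
      then show ?thesis using le[OF c, of y] by simp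
    qed
  qed
qed

text \<open>A pointwise minimal sublinear functional \<open>p\<close> equals all its \<open>sublinear_shift p x\<close>, which makes it additive.\<close>

lemma minimal_sublinear_below:
  assumes p: "sublinear p"
  obtains f where "linear f" "\<And>x. f x \<le> p x"
proof -
  define A where "A = {q. sublinear q \<and> (\<forall>x. q x \<le> p x)}"
  define R where "R q r \<longleftrightarrow> (\<forall>x. r x \<le> q x)" for q r :: "'a \<Rightarrow> real"
  have "\<exists>m\<in>A. \<forall>a\<in>A. R m a \<longrightarrow> a = m"
  proof (rule predicate_Zorn)
    show "partial_order_on A (relation_of R A)"
      by (rule partial_order_on_relation_ofI) (auto simp: R_def fun_eq_iff intro: order_trans antisym)
    fix C assume C: "C \<in> Chains (relation_of R A)"
    show "\<exists>u\<in>A. \<forall>a\<in>C. R a u"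
    proof (cases "C = {}")
      case True
      have "p \<in> A" unfolding A_def using p by simp
      then show ?thesis using True by auto
    next
      case False
      have CA: "q \<in> A" if "q \<in> C" for q
        using C that unfolding Chains_def relation_of_def by auto
      have cmp: "(\<forall>x. q x \<le> r x) \<or> (\<forall>x. r x \<le> q x)" if "q \<in> C" "r \<in> C" for q r
        using C that unfolding Chains_def relation_of_def R_def by auto
      define u where "u x = (INF q\<in>C. q x)" for x
      have bdd: "bdd_below ((\<lambda>q. q x) ` C)" for x
      proof (rule bdd_belowI2)
        fix q assume "q \<in> C"
        then have q: "sublinear q" "q (- x) \<le> p (- x)" using CA[of q] by (auto simp: A_def)
        show "- p (- x) \<le> q x" using sublinearD(4)[OF q(1), of x] q(2) by simp
      qed
      have le: "u x \<le> q x" if "q \<in> C" for q x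
        unfolding u_def by (rule cINF_lower[OF bdd that])
      have "sublinear u"
        unfolding sublinear_def
      proof (intro conjI allI impI)
        show "u (x + y) \<le> u x + u y" for x y
        proof -
          \<comment> \<open>An infimum of sublinear functionals is not subadditive in general; in a
            chain the smaller of \<open>q\<close> and \<open>r\<close> can be used at both
            points.\<close>
          have "u (x + y) \<le> q x + r y" if qr: "q \<in> C" "r \<in> C" for q r
          proof -
            have sq: "sublinear q" "sublinear r" using CA qr by (auto simp: A_def)
            from cmp[OF qr] show ?thesis
            proof
              assume "\<forall>x. q x \<le> r x"
              then show ?thesis using le[OF qr(1), of "x + y"] sublinearD(1)[OF sq(1), of x y]
                by (smt (verit))
            next
              assume "\<forall>x. r x \<le> q x"
              then show ?thesis using le[OF qr(2), of "x + y"] sublinearD(1)[OF sq(2), of x y]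
                by (smt (verit))
            qed
          qed
          then have "u (x + y) - r y \<le> u x" if "r \<in> C" for r
            unfolding u_def[of x] using that False by (intro cINF_greatest) (auto simp: algebra_simps)
          then have "u (x + y) - u x \<le> u y"
            unfolding u_def[of y] using False by (intro cINF_greatest) (auto simp: algebra_simps)
          then show ?thesis by simp
        qed
        show "u (c *\<^sub>R x) = c * u x" if c: "0 \<le> c" for c x
        proof -
          have q: "q (c *\<^sub>R x) = c * q x" if "q \<in> C" for q
            using CA[OF that] c sublinearD(2) by (auto simp: A_def)
          show ?thesis
          proof (cases "c = 0")
            case True
            then have "(\<lambda>q. q (c *\<^sub>R x)) ` C = (\<lambda>_. 0) ` C" using q by (intro image_cong) auto
            also have "\<dots> = {0}" using False by auto
            finally have "(\<lambda>q. q (c *\<^sub>R x)) ` C = {0}" .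
            then show ?thesis unfolding u_def using True by simp
          next
            case c': False
            show ?thesis
            proof (rule antisym)
              have "u (c *\<^sub>R x) / c \<le> u x"
                unfolding u_def[of x] using False le[of _ "c *\<^sub>R x"] q c c'
                by (intro cINF_greatest) (auto simp: pos_divide_le_eq mult.commute)
              then show "u (c *\<^sub>R x) \<le> c * u x" using c c' by (simp add: pos_divide_le_eq mult.commute)
              show "c * u x \<le> u (c *\<^sub>R x)"
                unfolding u_def[of "c *\<^sub>R x"] using False q mult_left_mono[OF le[of _ x] c]
                by (intro cINF_greatest) auto
            qed
          qed
        qed
      qed
      moreover obtain q where "q \<in> C" using False by auto
      then have "\<forall>x. u x \<le> p x" using le CA[of q] by (auto simp: A_def intro: order_trans)
      ultimately have "u \<in> A" unfolding A_def by simp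
      then show ?thesis using le unfolding R_def by auto
    qed
  qed
  then obtain f where f: "sublinear f" "\<And>x. f x \<le> p x"
    and min: "\<And>q. sublinear q \<Longrightarrow> (\<And>x. q x \<le> f x) \<Longrightarrow> q = f"
    unfolding A_def R_def by (auto) (meson order_trans)
  have shift: "sublinear_shift f x = f" for x
  proof (rule min[OF sublinear_shift_sublinear[OF f(1)]])
    show "sublinear_shift f x y \<le> f y" for y
      using sublinear_shift_le[OF f(1) order_refl, of x y] by simp
  qed
  have add: "f (y + x) = f y + f x" for x y
  proof (rule antisym)
    show "f (y + x) \<le> f y + f x" by (rule sublinearD(1)[OF f(1)])
    \<comment> \<open>As the shift of a minimal \<open>f\<close> is \<open>f\<close> itself,
      \<open>t = 1\<close> in its definition reads \<open>f y \<le> f (y + x) - f x\<close>.\<close>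
    show "f y + f x \<le> f (y + x)"
      using sublinear_shift_le[OF f(1), of 1 x y] unfolding shift by simp
  qed
  have neg: "f (- x) = - f x" for x
    using add[of x "- x"] sublinearD(3)[OF f(1)] by simp
  have "linear f"
  proof (rule linearI)
    show "f (c *\<^sub>R x) = c *\<^sub>R f x" for c x
    proof (cases "0 \<le> c")
      case True
      then show ?thesis using sublinearD(2)[OF f(1)] by simp
    next
      case False
      then have "f ((- c) *\<^sub>R x) = - c * f x" by (intro sublinearD(2)[OF f(1)]) simp
      then show ?thesis using neg[of "c *\<^sub>R x"] by simp
    qed
  qed (rule add)
  then show thesis using that f(2) by blast
qed

text \<open>Applied to the norm itself, \<open>minimal_sublinear_below\<close> could return the zero
  functional on some line; applied to the norm lowered along \<open>x\<close> it returns one with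
  \<open>f (- x) \<le> - norm x\<close>, which forces equality at \<open>x\<close>.\<close>

theorem norming_functional:
  fixes x :: "'a::real_normed_vector"
  obtains u :: "'a \<Rightarrow>\<^sub>L real" where "norm u \<le> 1" "blinfun_apply u x = norm x"
proof -
  have n: "sublinear (norm :: 'a \<Rightarrow> real)"
    unfolding sublinear_def by (simp add: norm_triangle_ineq)
  obtain f where f: "linear f" "\<And>y. f y \<le> sublinear_shift norm x y"
    using minimal_sublinear_below[OF sublinear_shift_sublinear[OF n]] by blast
  have le: "f y \<le> norm y" for y
    using f(2)[of y] sublinear_shift_le[OF n order_refl, of x y] by simp
  have ab: "\<bar>f y\<bar> \<le> 1 * norm y" for y
    using le[of y] le[of "- y"] linear_neg[OF f(1), of y] by simp
  have "f (- x) \<le> - norm x"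
    using f(2)[of "- x"] sublinear_shift_le[OF n, of 1 x "- x"] by simp
  then have fx: "f x = norm x" using le[of x] linear_neg[OF f(1), of x] by simp
  have bl: "bounded_linear f"
    using f(1) ab by (intro bounded_linear_intro[where K=1]) (auto simp: linear_add linear_scale mult.commute)
  have "norm (Blinfun f) \<le> 1"
    using ab by (intro norm_blinfun_bound) (auto simp: bounded_linear_Blinfun_apply[OF bl])
  then show thesis
    using that[of "Blinfun f"] fx by (simp add: bounded_linear_Blinfun_apply[OF bl])
qed

text \<open>One functional for each point of a countable dense subset of \<open>E\<close>; the norm
  of any other point is approximated since the functionals are 1-Lipschitz. The set is norming for
  \<open>E\<close>, although the dual may be nonseparable.\<close>

lemma countable_norming_set:
  obtains D :: "('a::{real_normed_vector, second_countable_topology} \<Rightarrow>\<^sub>L real) set"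
  where "countable D" "D \<noteq> {}" "\<And>u. u \<in> D \<Longrightarrow> norm u \<le> 1"
    "\<And>x c. (\<And>u. u \<in> D \<Longrightarrow> \<bar>blinfun_apply u x\<bar> \<le> c) \<Longrightarrow> norm x \<le> c"
proof -
  obtain Q :: "'a set" where Q: "countable Q" "\<And>X. open X \<Longrightarrow> X \<noteq> {} \<Longrightarrow> \<exists>q\<in>Q. q \<in> X"
    using countable_dense_exists by blast
  have "\<exists>u::'a \<Rightarrow>\<^sub>L real. norm u \<le> 1 \<and> blinfun_apply u q = norm q" for q
    using norming_functional[of q] by metis
  then obtain \<phi> :: "'a \<Rightarrow> 'a \<Rightarrow>\<^sub>L real" where \<phi>: "\<And>q. norm (\<phi> q) \<le> 1" "\<And>q. blinfun_apply (\<phi> q) q = norm q"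
    by metis
  have "norm x \<le> c" if c: "\<And>u. u \<in> \<phi> ` Q \<Longrightarrow> \<bar>blinfun_apply u x\<bar> \<le> c" for x c
  proof (rule field_le_epsilon)
    fix e :: real assume e: "0 < e"
    obtain q where q: "q \<in> Q" "q \<in> ball x (e / 2)" using Q(2)[of "ball x (e / 2)"] e by auto
    have d: "norm (q - x) < e / 2" using q by (simp add: dist_norm norm_minus_commute)
    have "norm q = blinfun_apply (\<phi> q) x + blinfun_apply (\<phi> q) (q - x)"
      using \<phi>(2)[of q] by (simp add: blinfun.diff_right)
    also have "\<dots> \<le> c + norm (q - x)"
    proof (rule add_mono)
      show "blinfun_apply (\<phi> q) x \<le> c" using c[of "\<phi> q"] q by auto
      have "\<bar>blinfun_apply (\<phi> q) (q - x)\<bar> \<le> norm (\<phi> q) * norm (q - x)"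
        using norm_blinfun[of "\<phi> q" "q - x"] by simp
      also have "\<dots> \<le> 1 * norm (q - x)" using \<phi>(1) by (intro mult_right_mono) auto
      finally show "blinfun_apply (\<phi> q) (q - x) \<le> norm (q - x)" by simp
    qed
    finally have "norm q \<le> c + norm (q - x)" .
    moreover have "norm x \<le> norm q + norm (q - x)"
      by (metis norm_minus_commute norm_triangle_sub add.commute)
    ultimately show "norm x \<le> c + e" using d by simp
  qed
  moreover have "Q \<noteq> {}" using Q(2)[of UNIV] by auto
  ultimately show thesis
    using Q(1) \<phi>(1) by (intro that[of "\<phi> ` Q"]) auto
qed

section \<open>Moments of the sample covariance and the Taylor remainder\<close>

text \<open>Fatou's lemma along an increasing sequence. That \<open>F\<close> is the pointwise
  supremum is expressed by \<open>le\<close> and \<open>sup\<close>, the form in which norming sets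
  deliver it. Measurability of \<open>F\<close> is a conclusion, which spares a separate argument
  for the operator norm.\<close>

lemma nn_integral_power_sup_le:
  fixes f :: "nat \<Rightarrow> 'a \<Rightarrow> real" and F :: "'a \<Rightarrow> real"
  assumes m: "\<And>k. f k \<in> borel_measurable M" and f0: "\<And>k x. 0 \<le> f k x"
    and inc: "\<And>x. incseq (\<lambda>k. f k x)" and le: "\<And>k x. f k x \<le> F x"
    and sup: "\<And>x c. (\<And>k. f k x \<le> c) \<Longrightarrow> F x \<le> c"
    and B: "\<And>k. (\<integral>\<^sup>+x. ennreal (f k x ^ r) \<partial>M) \<le> B"
  shows "F \<in> borel_measurable M" and "(\<integral>\<^sup>+x. ennreal (F x ^ r) \<partial>M) \<le> B"
proof -
  have lim: "(\<lambda>k. f k x) \<longlonglongrightarrow> F x" for x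
  proof -
    have b: "bdd_above (range (\<lambda>k. f k x))" using le by (intro bdd_aboveI2)
    have "(\<lambda>k. f k x) \<longlonglongrightarrow> (SUP k. f k x)" by (rule LIMSEQ_incseq_SUP[OF b inc])
    moreover have "(SUP k. f k x) = F x"
    proof (rule antisym)
      show "(SUP k. f k x) \<le> F x" using le by (intro cSUP_least) auto
      show "F x \<le> (SUP k. f k x)" by (intro sup cSUP_upper b) auto
    qed
    ultimately show ?thesis by simp
  qed
  show "F \<in> borel_measurable M" by (rule borel_measurable_LIMSEQ_real[OF lim m])
  have "(\<integral>\<^sup>+x. ennreal (F x ^ r) \<partial>M) = (\<integral>\<^sup>+x. liminf (\<lambda>k. ennreal (f k x ^ r)) \<partial>M)"
    by (intro nn_integral_cong lim_imp_Liminf[symmetric] tendsto_ennrealI tendsto_power lim) simp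
  also have "\<dots> \<le> liminf (\<lambda>k. \<integral>\<^sup>+x. ennreal (f k x ^ r) \<partial>M)"
    using m by (intro nn_integral_liminf) auto
  also have "\<dots> \<le> B"
    by (rule order_trans[OF Liminf_le_Limsup]) (auto intro!: Limsup_bounded B always_eventually)
  finally show "(\<integral>\<^sup>+x. ennreal (F x ^ r) \<partial>M) \<le> B" .
qed

lemma blinfun_apply_measurable:
  fixes u :: "'a::{banach, second_countable_topology} \<Rightarrow>\<^sub>L real"
  shows "blinfun_apply u \<in> borel_measurable borel"
  by (intro borel_measurable_continuous_onI continuous_intros)

text \<open>Testing the Bochner integral that defines \<open>\<Sigma> u\<close> with
  \<open>v\<close> gives the mean of the product of \<open>u\<close> and \<open>v\<close>. Symmetry
  of \<open>\<Sigma>\<close> follows, and \<open>u = v\<close> identifies the variance.\<close>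

lemma normal_law_facts:
  fixes \<Sigma> :: "('a::{banach, second_countable_topology} \<Rightarrow>\<^sub>L real) \<Rightarrow>\<^sub>L 'a"
  assumes "normal_law \<Sigma> \<gamma>"
  shows "prob_space \<gamma>" "sets \<gamma> = sets borel"
    and "normal_rv \<gamma> (blinfun_apply u (blinfun_apply \<Sigma> u)) (blinfun_apply u)"
    and "blinfun_apply u (blinfun_apply \<Sigma> v) = blinfun_apply v (blinfun_apply \<Sigma> u)"
proof -
  show p: "prob_space \<gamma>" and s: "sets \<gamma> = sets borel" using assms by (auto simp: normal_law_def)
  interpret prob_space \<gamma> by fact
  have m: "blinfun_apply u \<in> borel_measurable \<gamma>" for u :: "'a \<Rightarrow>\<^sub>L real"
    using blinfun_apply_measurable by (simp add: measurable_cong_sets[OF s refl])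
  have E: "expectation (\<lambda>x. blinfun_apply u x * blinfun_apply v x) = blinfun_apply v (blinfun_apply \<Sigma> u)" for u v
  proof -
    have "has_bochner_integral \<gamma> (\<lambda>x. blinfun_apply u x *\<^sub>R x) (blinfun_apply \<Sigma> u)"
      using assms by (simp add: normal_law_def)
    from has_bochner_integral_bounded_linear[OF blinfun.bounded_linear_right this, of v]
    show ?thesis by (intro has_bochner_integral_integral_eq) (simp add: blinfun.scaleR_right)
  qed
  show "blinfun_apply u (blinfun_apply \<Sigma> v) = blinfun_apply v (blinfun_apply \<Sigma> u)"
    unfolding E[symmetric] by (simp add: mult.commute)
  have "centered_normal_real (distr \<gamma> borel (blinfun_apply u))" using assms by (simp add: normal_law_def)
  then obtain q where q: "normal_rv \<gamma> q (blinfun_apply u)"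
    using normal_rv_centered[OF m] by blast
  have "q = blinfun_apply u (blinfun_apply \<Sigma> u)"
    using normal_rv_moments(4)[OF q] E[of u u] by (simp add: power2_eq_square)
  with q show "normal_rv \<gamma> (blinfun_apply u (blinfun_apply \<Sigma> u)) (blinfun_apply u)" by simp
qed

lemma abs_blinfun_le_norm:
  assumes "norm (u :: 'a::real_normed_vector \<Rightarrow>\<^sub>L real) \<le> 1"
  shows "\<bar>blinfun_apply u x\<bar> \<le> norm x"
proof -
  have "\<bar>blinfun_apply u x\<bar> \<le> norm u * norm x" using norm_blinfun[of u x] by simp
  also have "\<dots> \<le> 1 * norm x" using assms by (intro mult_right_mono) auto
  finally show ?thesis by simp
qed

text \<open>A weak form of Fernique's theorem. The norm is finite everywhere, so some ball of radius
  \<open>s\<close> has probability above 15/16. The maxima \<open>f k\<close> over finitely many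
  norming functionals are Gaussian seminorms below the norm, hence have second moment at most
  \<open>14 * s\<^sup>2\<close>, independently of \<open>k\<close>.\<close>

lemma normal_law_norm_square_integrable:
  fixes \<Sigma> :: "('a::{banach, second_countable_topology} \<Rightarrow>\<^sub>L real) \<Rightarrow>\<^sub>L 'a"
  assumes law: "normal_law \<Sigma> \<gamma>"
  shows "integrable \<gamma> (\<lambda>x. (norm x)\<^sup>2)"
proof -
  note L = normal_law_facts[OF law]
  interpret prob_space \<gamma> by (rule L(1))
  have m: "f \<in> borel_measurable \<gamma>" if "f \<in> borel_measurable borel" for f :: "'a \<Rightarrow> real"
    using that by (simp add: measurable_cong_sets[OF L(2) refl])
  have nm: "norm \<in> borel_measurable \<gamma>" by (rule m) simp
  obtain D :: "('a \<Rightarrow>\<^sub>L real) set" where D: "countable D" "D \<noteq> {}" "\<And>u. u \<in> D \<Longrightarrow> norm u \<le> 1"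
    "\<And>x c. (\<And>u. u \<in> D \<Longrightarrow> \<bar>blinfun_apply u x\<bar> \<le> c) \<Longrightarrow> norm x \<le> c"
    using countable_norming_set by blast
  define e where "e = from_nat_into D"
  have e: "range e = D" unfolding e_def using D by (simp add: range_from_nat_into)
  define f where "f k x = (MAX i\<in>{..k}. \<bar>blinfun_apply (e i) x\<bar>)" for k :: nat and x
  have fge: "\<bar>blinfun_apply (e i) x\<bar> \<le> f k x" if "i \<le> k" for i k x
    unfolding f_def using that by (intro Max_ge) auto
  have fle: "f k x \<le> norm x" for k x
    unfolding f_def using e D(3) by (subst Max_le_iff) (auto intro!: abs_blinfun_le_norm)
  have "(\<lambda>k::nat. prob {x \<in> space \<gamma>. norm x \<le> real k}) \<longlonglongrightarrow> prob (\<Union>k::nat. {x \<in> space \<gamma>. norm x \<le> real k})"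
  proof (rule finite_Lim_measure_incseq)
    show "range (\<lambda>k::nat. {x \<in> space \<gamma>. norm x \<le> real k}) \<subseteq> events" using nm by auto
    show "incseq (\<lambda>k::nat. {x \<in> space \<gamma>. norm x \<le> real k})" by (auto simp: incseq_def)
  qed
  moreover have "(\<Union>k::nat. {x \<in> space \<gamma>. norm x \<le> real k}) = space \<gamma>"
    using real_arch_simple by auto
  ultimately have "(\<lambda>k::nat. prob {x \<in> space \<gamma>. norm x \<le> real k}) \<longlonglongrightarrow> 1" by (simp add: prob_space)
  then have "\<forall>\<^sub>F k in sequentially. 15 / 16 < prob {x \<in> space \<gamma>. norm x \<le> real k}"
    by (rule order_tendstoD) simp
  then obtain s :: nat where s: "15 / 16 < prob {x \<in> space \<gamma>. norm x \<le> real s}"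
    by (auto simp: eventually_sequentially)
  have fm: "f k \<in> borel_measurable \<gamma>" for k
    unfolding f_def[abs_def] by (intro m borel_measurable_Max borel_measurable_abs blinfun_apply_measurable) auto
  have bound: "(\<integral>\<^sup>+x. ennreal ((f k x)\<^sup>2) \<partial>\<gamma>) \<le> ennreal (14 * (real s)\<^sup>2)" for k
  proof -
    have gf: "gaussian_family \<gamma> {..k} (\<lambda>i x. blinfun_apply (e i) x)"
      unfolding gaussian_family_def
    proof (intro conjI allI)
      fix c :: "nat \<Rightarrow> real"
      have "(\<Sum>i\<in>{..k}. c i * blinfun_apply (e i) x) = blinfun_apply (\<Sum>i\<in>{..k}. c i *\<^sub>R e i) x" for x
        by (simp add: blinfun.sum_left blinfun.scaleR_left)
      then show "\<exists>q. normal_rv \<gamma> q (\<lambda>x. \<Sum>i\<in>{..k}. c i * blinfun_apply (e i) x)"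
        using L(3)[of "\<Sum>i\<in>{..k}. c i *\<^sub>R e i"] by auto
    qed simp
    define N where "N y = (MAX i\<in>{..k}. \<bar>y i\<bar>)" for y :: "nat \<Rightarrow> real"
    have N: "measurable_seminorm {..k} N"
    proof -
      have "measurable_seminorm {..k} (\<lambda>y. MAX i\<in>{..k}. \<bar>\<Sum>j\<in>{i}. 1 * y j\<bar>)"
        by (intro measurable_seminorm_Max measurable_seminorm_abs_sum) auto
      then show ?thesis unfolding N_def[abs_def] by simp
    qed
    have fN: "N (\<lambda>i. blinfun_apply (e i) x) = f k x" for x unfolding N_def f_def ..
    have "prob {x \<in> space \<gamma>. norm x \<le> real s} \<le> prob {x \<in> space \<gamma>. f k x \<le> real s}"
      using fm[of k] fle by (intro finite_measure_mono) (auto intro: order_trans)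
    then have "expectation (\<lambda>x. (f k x)\<^sup>2) \<le> 14 * (real s)\<^sup>2"
      using gaussian_seminorm_second_moment[OF L(1) gf N, of "real s"] s unfolding fN by simp
    moreover have "integrable \<gamma> (\<lambda>x. (f k x)\<^sup>2)"
      using integrable_seminorm_power[OF L(1) gf N, of 2] unfolding fN .
    ultimately show ?thesis
      by (subst nn_integral_eq_integral) (auto intro: ennreal_leI)
  qed
  have "(\<integral>\<^sup>+x. ennreal ((norm x)\<^sup>2) \<partial>\<gamma>) \<le> ennreal (14 * (real s)\<^sup>2)"
  proof (rule nn_integral_power_sup_le(2)[OF fm _ _ fle _ bound])
    show "0 \<le> f k x" for k x using fge[of 0 k x] by linarith
    show "incseq (\<lambda>k. f k x)" for x
    proof (rule incseq_SucI)
      show "f k x \<le> f (Suc k) x" for k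
        unfolding f_def by (intro Max_mono) auto
    qed
    show "norm x \<le> c" if "\<And>k. f k x \<le> c" for x c
    proof (rule D(4))
      fix u assume "u \<in> D"
      then obtain i where "u = e i" using e by auto
      then show "\<bar>blinfun_apply u x\<bar> \<le> c" using fge[of i i x] that[of i] by simp
    qed
  qed
  then show ?thesis
    using nm by (intro integrableI_bounded) (auto simp: less_top[symmetric] top_unique)
qed


text \<open>The maxima \<open>f k\<close> over pairs from the finite sets \<open>U k\<close> are
  \<open>deviation\<close> divided by \<open>n\<close>, and they increase to the operator norm. The
  bound passes to the limit because \<open>mean_norm\<close>, which depends on \<open>k\<close>, is
  replaced by \<open>\<tau>\<close>.\<close>

lemma sample_cov_moments:
  fixes X :: "nat \<Rightarrow> 'b \<Rightarrow> 'a::{banach, second_countable_topology}"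
  assumes M: "prob_space M" and n: "n \<ge> 1" and law: "normal_law \<Sigma> \<gamma>"
    and indep: "prob_space.indep_vars M (\<lambda>_. borel) X {1..n}"
    and distr: "\<And>j. j \<in> {1..n} \<Longrightarrow> distr M borel (X j) = \<gamma>"
    and u0: "0 < blinfun_apply u0 (blinfun_apply \<Sigma> u0)" and r: "r = 2 ^ l"
  defines "\<tau> \<equiv> sqrt (\<integral>x. (norm x)\<^sup>2 \<partial>\<gamma>)"
  shows "(\<lambda>\<omega>. norm (sample_cov n X \<omega> - \<Sigma>)) \<in> borel_measurable M"
    and "(\<integral>\<^sup>+\<omega>. ennreal (norm (sample_cov n X \<omega> - \<Sigma>) ^ r) \<partial>M)
      \<le> ennreal ((1200 * real r * (2 * (sqrt (norm \<Sigma>) * sqrt n * \<tau>) + 5 * \<tau>\<^sup>2) / n) ^ r)"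
proof -
  interpret prob_space M by fact
  note L = normal_law_facts[OF law]
  interpret G: prob_space \<gamma> by (rule L(1))
  have Xm: "X j \<in> borel_measurable M" if "j \<in> {1..n}" for j
    using indep that by (simp add: indep_vars_def2)
  have normal: "normal_rv M (blinfun_apply u (blinfun_apply \<Sigma> u)) (\<lambda>\<omega>. blinfun_apply u (X j \<omega>))" if "j \<in> {1..n}" for j u
  proof -
    have "(CLINT x|\<gamma>. iexp (t * blinfun_apply u x)) = (CLINT \<omega>|M. iexp (t * blinfun_apply u (X j \<omega>)))" for t
      unfolding distr[OF that, symmetric] using Xm[OF that] blinfun_apply_measurable[of u] by (intro integral_distr) auto
    then show ?thesis
      using L(3)[of u] measurable_compose[OF Xm[OF that] blinfun_apply_measurable[of u]] by (simp add: normal_rv_def)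
  qed
  obtain D :: "('a \<Rightarrow>\<^sub>L real) set" where D: "countable D" "D \<noteq> {}" "\<And>u. u \<in> D \<Longrightarrow> norm u \<le> 1"
    "\<And>x c. (\<And>u. u \<in> D \<Longrightarrow> \<bar>blinfun_apply u x\<bar> \<le> c) \<Longrightarrow> norm x \<le> c"
    using countable_norming_set by blast
  define e where "e = from_nat_into D"
  have e: "range e = D" unfolding e_def using D by (simp add: range_from_nat_into)
  define \<Delta> where "\<Delta> \<omega> = sample_cov n X \<omega> - \<Sigma>" for \<omega>
  define U where "U k = e ` {..k}" for k :: nat
  define f where "f k \<omega> = (MAX p\<in>U k \<times> U k. \<bar>(\<Sum>i=1..n. blinfun_apply (fst p) (X i \<omega>) * blinfun_apply (snd p) (X i \<omega>))
      - n * blinfun_apply (fst p) (blinfun_apply \<Sigma> (snd p))\<bar>) / n" for k \<omega>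
  have U: "finite (U k)" "U k \<noteq> {}" "u \<in> U k \<Longrightarrow> norm u \<le> 1" for k u
    unfolding U_def using e D(3) by auto
  have eD: "(\<Sum>i=1..n. blinfun_apply u (X i \<omega>) * blinfun_apply v (X i \<omega>)) - n * blinfun_apply u (blinfun_apply \<Sigma> v)
      = n * blinfun_apply u (blinfun_apply (\<Delta> \<omega>) v)" for u v \<omega>
    unfolding \<Delta>_def using n
    by (simp add: blinfun.diff_left blinfun.diff_right sample_cov_apply blinfun.scaleR_right blinfun.sum_right right_diff_distrib mult.commute)
  have f_eq: "f k \<omega> = (MAX p\<in>U k \<times> U k. n * \<bar>blinfun_apply (fst p) (blinfun_apply (\<Delta> \<omega>) (snd p))\<bar>) / n" for k \<omega>
    unfolding f_def eD by (simp add: abs_mult)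
  have fge: "\<bar>blinfun_apply u (blinfun_apply (\<Delta> \<omega>) v)\<bar> \<le> f k \<omega>" if "u \<in> U k" "v \<in> U k" for u v k \<omega>
  proof -
    have "n * \<bar>blinfun_apply u (blinfun_apply (\<Delta> \<omega>) v)\<bar> \<le> (MAX p\<in>U k \<times> U k. n * \<bar>blinfun_apply (fst p) (blinfun_apply (\<Delta> \<omega>) (snd p))\<bar>)"
      using U(1) that by (intro Max_ge) (auto intro!: image_eqI[where x="(u, v)"])
    then show ?thesis unfolding f_eq using n by (simp add: pos_le_divide_eq mult.commute)
  qed
  have f0: "0 \<le> f k \<omega>" for k \<omega>
    using fge[of "e 0" k "e 0" \<omega>] by (auto simp: U_def intro: order_trans[OF abs_ge_zero])
  have dsym: "blinfun_apply u (blinfun_apply (\<Delta> \<omega>) v) = blinfun_apply v (blinfun_apply (\<Delta> \<omega>) u)" for u v \<omega>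
    unfolding \<Delta>_def
    by (simp add: blinfun.diff_left blinfun.diff_right sample_cov_apply blinfun.scaleR_right blinfun.sum_right L(4)[of u v] mult.commute)
  have fle: "f k \<omega> \<le> norm (\<Delta> \<omega>)" for k \<omega>
  proof -
    have "\<bar>blinfun_apply u (blinfun_apply (\<Delta> \<omega>) v)\<bar> \<le> norm (\<Delta> \<omega>)" if "u \<in> U k" "v \<in> U k" for u v
    proof -
      have "\<bar>blinfun_apply u (blinfun_apply (\<Delta> \<omega>) v)\<bar> \<le> norm (blinfun_apply (\<Delta> \<omega>) v)"
        by (rule abs_blinfun_le_norm[OF U(3)[OF that(1)]])
      also have "\<dots> \<le> norm (\<Delta> \<omega>) * norm v" by (rule norm_blinfun)
      also have "\<dots> \<le> norm (\<Delta> \<omega>) * 1" using U(3)[OF that(2)] by (intro mult_left_mono) auto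
      finally show ?thesis by simp
    qed
    then have "(MAX p\<in>U k \<times> U k. n * \<bar>blinfun_apply (fst p) (blinfun_apply (\<Delta> \<omega>) (snd p))\<bar>) \<le> n * norm (\<Delta> \<omega>)"
      using U(1,2)[of k] by (subst Max_le_iff) (auto intro!: mult_left_mono)
    then show ?thesis unfolding f_eq using n by (simp add: pos_divide_le_eq mult.commute)
  qed
  \<comment> \<open>The set \<open>D\<close> norms points of \<open>E\<close>, whereas the operator
    acts on the dual, so testing with pairs from \<open>D\<close> bounds it only on
    \<open>D\<close>. Symmetry extends this: an arbitrary argument \<open>w\<close> is moved to the
    outside, where only its norm matters, and the norming functional \<open>u\<close> becomes the
    argument.\<close>
  have sup: "norm (\<Delta> \<omega>) \<le> c" if c: "\<And>k. f k \<omega> \<le> c" for \<omega> c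
  proof -
    have uv: "\<bar>blinfun_apply u (blinfun_apply (\<Delta> \<omega>) v)\<bar> \<le> c" if "u \<in> D" "v \<in> D" for u v
    proof -
      have "u \<in> range e" "v \<in> range e" using that e by auto
      then obtain i j where "u = e i" "v = e j" by blast
      then show ?thesis
        using order_trans[OF fge[of u "max i j" v \<omega>] c] by (auto simp: U_def)
    qed
    have v: "norm (blinfun_apply (\<Delta> \<omega>) v) \<le> c" if "v \<in> D" for v
      by (rule D(4)) (rule uv[OF _ that])
    have "norm (blinfun_apply (\<Delta> \<omega>) w) \<le> c * norm w" for w
    proof (rule D(4))
      fix u assume u: "u \<in> D"
      have "\<bar>blinfun_apply u (blinfun_apply (\<Delta> \<omega>) w)\<bar> \<le> norm w * norm (blinfun_apply (\<Delta> \<omega>) u)"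
        unfolding dsym[of u \<omega> w] using norm_blinfun[of w "blinfun_apply (\<Delta> \<omega>) u"] by simp
      also have "\<dots> \<le> norm w * c" by (intro mult_left_mono v u) simp
      finally show "\<bar>blinfun_apply u (blinfun_apply (\<Delta> \<omega>) w)\<bar> \<le> c * norm w" by (simp add: mult.commute)
    qed
    then show ?thesis using order_trans[OF f0 c] by (intro norm_blinfun_bound)
  qed
  have inc: "incseq (\<lambda>k. f k \<omega>)" for \<omega>
  proof (rule incseq_SucI)
    fix k
    have "U k \<times> U k \<subseteq> U (Suc k) \<times> U (Suc k)" unfolding U_def by auto
    then show "f k \<omega> \<le> f (Suc k) \<omega>"
      unfolding f_def using U(1,2) by (intro divide_right_mono Max_mono image_mono) auto
  qed
  have inorm: "integrable \<gamma> (\<lambda>x. (norm x)\<^sup>2)" by (rule normal_law_norm_square_integrable[OF law])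
  have nm: "norm \<in> borel_measurable \<gamma>" by (simp add: measurable_cong_sets[OF L(2) refl])
  have inorm1: "integrable \<gamma> norm"
    by (rule G.square_integrable_imp_integrable[OF nm inorm])
  have t0: "0 \<le> \<tau>" unfolding \<tau>_def by simp
  have t1: "G.expectation norm \<le> \<tau>"
    unfolding \<tau>_def using G.expectation_power_le[of 2 1 norm] inorm inorm1
    by (intro real_le_rsqrt) simp
  have moments: "f k \<in> borel_measurable M \<and> (\<integral>\<^sup>+\<omega>. ennreal (f k \<omega> ^ r) \<partial>M)
      \<le> ennreal ((1200 * real r * (2 * (sqrt (norm \<Sigma>) * sqrt n * \<tau>) + 5 * \<tau>\<^sup>2) / n) ^ r)" for k
  proof -
    interpret S: gaussian_sample M X n \<Sigma> "U k" u0
      by unfold_locales (fact n indep normal L(4) U u0)+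
    have fW: "f k \<omega> = S.deviation (\<lambda>j. S.Z j \<omega>) / n" for \<omega>
      unfolding f_def S.deviation_def S.Z_def S.cov_def by simp
    \<comment> \<open>The maximum over \<open>U k\<close> is below the norm of one observation,
      whose mean is at most \<open>\<tau>\<close> by Jensen's inequality.\<close>
    have m: "S.mean_norm \<le> \<tau>"
    proof -
      have "1 \<in> {1..n}" using n by simp
      note X1 = Xm[OF this] distr[OF this]
      have iX: "integrable M (\<lambda>\<omega>. norm (X 1 \<omega>))"
        using inorm1 X1(1) unfolding X1(2)[symmetric] by (subst (asm) integrable_distr_eq) auto
      have "S.mean_norm \<le> expectation (\<lambda>\<omega>. norm (X 1 \<omega>))"
        unfolding S.mean_norm_def
      proof (rule integral_mono[OF S.mean_norm_integrable iX])
        show "(MAX u\<in>U k. \<bar>blinfun_apply u (X 1 \<omega>)\<bar>) \<le> norm (X 1 \<omega>)" for \<omega>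
          using U(1,2)[of k] U(3)[of _ k] by (subst Max_le_iff) (auto intro!: abs_blinfun_le_norm)
      qed
      also have "\<dots> = G.expectation norm"
        using X1(1) unfolding X1(2)[symmetric] by (subst integral_distr) auto
      finally show ?thesis using t1 by simp
    qed
    have "expectation (\<lambda>\<omega>. f k \<omega> ^ r) = expectation (\<lambda>\<omega>. S.deviation (\<lambda>j. S.Z j \<omega>) ^ r) / real n ^ r"
      unfolding fW power_divide by simp
    also have "\<dots> \<le> (1200 * real r * (2 * (S.sdev * sqrt n * S.mean_norm) + 5 * S.mean_norm\<^sup>2)) ^ r / real n ^ r"
      by (intro divide_right_mono S.deviation_moments(2)[OF r]) simp
    also have "\<dots> \<le> (1200 * real r * (2 * (sqrt (norm \<Sigma>) * sqrt n * \<tau>) + 5 * \<tau>\<^sup>2)) ^ r / real n ^ r"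
      unfolding S.sdev_def using m S.mean_norm_nonneg t0
      by (intro divide_right_mono power_mono mult_left_mono add_mono mult_nonneg_nonneg add_nonneg_nonneg) auto
    finally have "expectation (\<lambda>\<omega>. f k \<omega> ^ r) \<le> (1200 * real r * (2 * (sqrt (norm \<Sigma>) * sqrt n * \<tau>) + 5 * \<tau>\<^sup>2) / n) ^ r"
      by (simp only: power_divide)
    moreover have "integrable M (\<lambda>\<omega>. f k \<omega> ^ r)"
      unfolding fW power_divide using S.deviation_moments(1)[OF r] by simp
    ultimately have "(\<integral>\<^sup>+\<omega>. ennreal (f k \<omega> ^ r) \<partial>M)
      \<le> ennreal ((1200 * real r * (2 * (sqrt (norm \<Sigma>) * sqrt n * \<tau>) + 5 * \<tau>\<^sup>2) / n) ^ r)"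
      using f0 by (subst nn_integral_eq_integral) (auto intro: ennreal_leI)
    moreover have "f k \<in> borel_measurable M"
      using S.deviation_moments(1)[of 1 0] unfolding fW[abs_def] by auto
    ultimately show ?thesis by simp
  qed
  note * = nn_integral_power_sup_le[of f M "\<lambda>\<omega>. norm (\<Delta> \<omega>)",
      OF conjunct1[OF moments] f0 inc fle sup conjunct2[OF moments]]
  show "(\<lambda>\<omega>. norm (sample_cov n X \<omega> - \<Sigma>)) \<in> borel_measurable M"
    using *(1) unfolding \<Delta>_def .
  show "(\<integral>\<^sup>+\<omega>. ennreal (norm (sample_cov n X \<omega> - \<Sigma>) ^ r) \<partial>M)
      \<le> ennreal ((1200 * real r * (2 * (sqrt (norm \<Sigma>) * sqrt n * \<tau>) + 5 * \<tau>\<^sup>2) / n) ^ r)"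
    using *(2) unfolding \<Delta>_def .
qed

section \<open>The Taylor remainder and the passage to arbitrary exponents\<close>

lemma lip_seminorm_bound:
  fixes g :: "'c::real_normed_vector \<Rightarrow> 'd::real_normed_vector"
  assumes "hoelder_condition \<rho> g"
  shows "norm (g A - g B) \<le> lip_seminorm \<rho> g * norm (A - B) powr \<rho>"
proof (cases "A = B")
  case False
  obtain L where L: "\<And>A B. norm (g A - g B) \<le> L * norm (A - B) powr \<rho>"
    using assms by (auto simp: hoelder_condition_def)
  have "bdd_above ((\<lambda>(A, B). norm (g A - g B) / norm (A - B) powr \<rho>) ` {(A, B). A \<noteq> B})"
    using L by (intro bdd_aboveI2[where M=L]) (auto simp: pos_divide_le_eq)
  then have "(\<lambda>(A, B). norm (g A - g B) / norm (A - B) powr \<rho>) (A, B) \<le> lip_seminorm \<rho> g"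
    unfolding lip_seminorm_def using False by (intro cSUP_upper) auto
  then show ?thesis using False by (simp add: pos_divide_le_eq)
qed simp

text \<open>Subtracting the linear part along the segment before using the mean value theorem leaves
  an increment of \<open>f'\<close>, to which the Hoelder bound applies. The intermediate
  \<open>t\<close> enters through \<open>t powr \<rho> \<le> 1\<close>, hence the constant
  1.\<close>

lemma taylor_remainder_bound:
  fixes f :: "'c::real_normed_vector \<Rightarrow> real" and f' :: "'c \<Rightarrow> 'c \<Rightarrow>\<^sub>L real"
  assumes f: "\<And>A. (f has_derivative blinfun_apply (f' A)) (at A)"
    and h: "hoelder_condition \<rho> f'" and \<rho>: "0 < \<rho>" and L: "0 \<le> lip_seminorm \<rho> f'"
  shows "\<bar>f B - f A - blinfun_apply (f' A) (B - A)\<bar> \<le> lip_seminorm \<rho> f' * norm (B - A) powr (1 + \<rho>)"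
proof -
  let ?H = "B - A"
  define \<phi> where "\<phi> t = f (A + t *\<^sub>R ?H) - t * blinfun_apply (f' A) ?H" for t :: real
  have d: "(\<phi> has_real_derivative (blinfun_apply (f' (A + t *\<^sub>R ?H)) ?H - blinfun_apply (f' A) ?H)) (at t)" for t
  proof -
    have "((\<lambda>t. A + t *\<^sub>R ?H) has_derivative (\<lambda>s. s *\<^sub>R ?H)) (at t)"
      by (auto intro!: derivative_eq_intros)
    from diff_chain_at[OF this f[of "A + t *\<^sub>R ?H"]]
    have "((\<lambda>t. f (A + t *\<^sub>R ?H)) has_derivative (\<lambda>s. blinfun_apply (f' (A + t *\<^sub>R ?H)) (s *\<^sub>R ?H))) (at t)"
      by (simp add: o_def)
    then have "((\<lambda>t. f (A + t *\<^sub>R ?H)) has_real_derivative blinfun_apply (f' (A + t *\<^sub>R ?H)) ?H) (at t)"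
      by (simp add: has_field_derivative_def blinfun.scaleR_right mult.commute[of _ "blinfun_apply _ _"])
    then show ?thesis unfolding \<phi>_def by (auto intro!: derivative_eq_intros)
  qed
  obtain t where t: "0 < t" "t < 1" "\<phi> 1 - \<phi> 0 = (1 - 0) * (blinfun_apply (f' (A + t *\<^sub>R ?H)) ?H - blinfun_apply (f' A) ?H)"
    using MVT2[of 0 1 \<phi> "\<lambda>t. blinfun_apply (f' (A + t *\<^sub>R ?H)) ?H - blinfun_apply (f' A) ?H"] d by auto
  have "\<bar>f B - f A - blinfun_apply (f' A) ?H\<bar> = \<bar>blinfun_apply (f' (A + t *\<^sub>R ?H) - f' A) ?H\<bar>"
    using t(3) unfolding \<phi>_def by (simp add: blinfun.diff_left)
  also have "\<dots> \<le> norm (f' (A + t *\<^sub>R ?H) - f' A) * norm ?H"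
    using norm_blinfun[of "f' (A + t *\<^sub>R ?H) - f' A" ?H] by simp
  also have "\<dots> \<le> (lip_seminorm \<rho> f' * norm (t *\<^sub>R ?H) powr \<rho>) * norm ?H"
    using lip_seminorm_bound[OF h, of "A + t *\<^sub>R ?H" A] by (intro mult_right_mono) auto
  also have "\<dots> \<le> (lip_seminorm \<rho> f' * norm ?H powr \<rho>) * norm ?H"
    using t(1,2) \<rho> L by (intro mult_right_mono mult_left_mono powr_mono2) (auto simp: mult_left_le_one_le)
  also have "\<dots> = lip_seminorm \<rho> f' * norm ?H powr (1 + \<rho>)"
    by (cases "?H = 0") (auto simp: powr_add mult_ac)
  finally show ?thesis .
qed

lemma Lp_norm_le:
  assumes "0 < p" "0 \<le> B" "(\<integral>\<^sup>+\<omega>. ennreal (\<bar>\<eta> \<omega>\<bar> powr p) \<partial>M) \<le> ennreal B"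
  shows "Lp_norm M p \<eta> \<le> ennreal (B powr (1 / p))"
proof -
  let ?m = "\<integral>\<^sup>+\<omega>. ennreal (\<bar>\<eta> \<omega>\<bar> powr p) \<partial>M"
  have "?m \<noteq> \<infinity>" using assms(3) by (auto simp: top_unique)
  moreover have "enn2real ?m \<le> B" using assms(2,3) by (simp add: enn2real_leI)
  ultimately show ?thesis
    unfolding Lp_norm_def Let_def using assms(1) by (auto intro!: ennreal_leI powr_mono2)
qed

text \<open>Interpolation by splitting at the level \<open>c\<close>: below it the power is at most
  \<open>c powr q\<close>, above it \<open>D x / c\<close> is at least 1 and the exponent can be
  raised from \<open>q\<close> to \<open>r\<close>. The factor 2 counts the two regions.\<close>

lemma nn_integral_powr_le:
  assumes "prob_space M" and D[measurable]: "D \<in> borel_measurable M" and D0: "\<And>x. 0 \<le> D x"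
    and c: "0 < c" and q: "0 \<le> q" "q \<le> real r"
    and B: "(\<integral>\<^sup>+x. ennreal (D x ^ r) \<partial>M) \<le> ennreal (c ^ r)"
  shows "(\<integral>\<^sup>+x. ennreal (D x powr q) \<partial>M) \<le> ennreal (2 * c powr q)"
proof -
  interpret prob_space M by fact
  have "D x powr q \<le> c powr q + c powr q / c ^ r * D x ^ r" for x
  proof (cases "D x \<le> c")
    case True
    have "D x powr q \<le> c powr q" using True D0 q by (intro powr_mono2) auto
    then show ?thesis using c D0[of x] by (simp add: add_increasing2)
  next
    case False
    then have Dp: "0 < D x" "1 \<le> D x / c" using c by auto
    have "D x powr q = c powr q * (D x / c) powr q"
      using Dp c by (simp add: powr_mult[symmetric])
    also have "\<dots> \<le> c powr q * (D x / c) powr real r"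
      using Dp q by (intro mult_left_mono powr_mono) auto
    also have "\<dots> = c powr q / c ^ r * D x ^ r"
      using Dp c by (simp add: powr_realpow power_divide)
    finally show ?thesis by (simp add: add_increasing)
  qed
  then have "ennreal (D x powr q) \<le> ennreal (c powr q + c powr q / c ^ r * D x ^ r)" for x
    by (rule ennreal_leI)
  also have "ennreal (c powr q + c powr q / c ^ r * D x ^ r)
      = ennreal (c powr q) + ennreal (c powr q / c ^ r) * ennreal (D x ^ r)" for x
    using c D0[of x] by (subst ennreal_plus; (subst ennreal_mult)?) auto
  finally have "(\<integral>\<^sup>+x. ennreal (D x powr q) \<partial>M) \<le> (\<integral>\<^sup>+x. ennreal (c powr q) + ennreal (c powr q / c ^ r) * ennreal (D x ^ r) \<partial>M)"
    by (intro nn_integral_mono)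
  also have "\<dots> = ennreal (c powr q) + ennreal (c powr q / c ^ r) * (\<integral>\<^sup>+x. ennreal (D x ^ r) \<partial>M)"
    by (simp add: nn_integral_add nn_integral_cmult emeasure_space_1)
  also have "\<dots> \<le> ennreal (c powr q) + ennreal (c powr q / c ^ r) * ennreal (c ^ r)"
    by (intro add_left_mono mult_left_mono B) simp
  also have "\<dots> = ennreal (2 * c powr q)"
  proof -
    have "c powr q / c ^ r * c ^ r = c powr q" using c by simp
    then have "ennreal (c powr q / c ^ r) * ennreal (c ^ r) = ennreal (c powr q)"
      using c by (subst ennreal_mult[symmetric]) auto
    moreover have "ennreal (c powr q) + ennreal (c powr q) = ennreal (c powr q + c powr q)"
      by (rule ennreal_plus[symmetric]) auto
    ultimately show ?thesis by simp
  qed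
  finally show ?thesis .
qed

text \<open>Rounding a real exponent up to one for which moments are bounded at most doubles it,
  which preserves the linear growth in the exponent.\<close>

lemma power_of_two_between:
  assumes "1 \<le> (q::real)"
  shows "\<exists>k. q \<le> 2 ^ k \<and> 2 ^ k \<le> 2 * q"
proof -
  define k where "k = (LEAST k. q \<le> (2::real) ^ k)"
  obtain j where "q < (2::real) ^ j" using real_arch_pow[of 2 q] by auto
  then have k: "q \<le> 2 ^ k"
    unfolding k_def using LeastI[of "\<lambda>k. q \<le> (2::real) ^ k" j] by linarith
  have "2 ^ k \<le> 2 * q"
  proof (cases k)
    case 0
    then show ?thesis using assms by simp
  next
    case (Suc l)
    then have "l < (LEAST k. q \<le> (2::real) ^ k)" unfolding k_def by simp
    from not_less_Least[OF this] show ?thesis using Suc by simp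
  qed
  with k show ?thesis by blast
qed

text \<open>If all variances vanished, polarisation with the symmetry of \<open>\<Sigma>\<close>
  would make the whole bilinear form zero, and norming functionals would then give
  \<open>\<Sigma> = 0\<close>.\<close>

lemma normal_law_nondegenerate:
  fixes \<Sigma> :: "('a::{banach, second_countable_topology} \<Rightarrow>\<^sub>L real) \<Rightarrow>\<^sub>L 'a"
  assumes law: "normal_law \<Sigma> \<gamma>" and "\<Sigma> \<noteq> 0"
  obtains u where "0 < blinfun_apply u (blinfun_apply \<Sigma> u)"
proof -
  note L = normal_law_facts[OF law]
  have "\<exists>u. 0 < blinfun_apply u (blinfun_apply \<Sigma> u)"
  proof (rule ccontr)
    assume "\<nexists>u. 0 < blinfun_apply u (blinfun_apply \<Sigma> u)"
    then have z: "blinfun_apply u (blinfun_apply \<Sigma> u) = 0" for u :: "'a \<Rightarrow>\<^sub>L real"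
      using L(3)[of u] by (auto simp: normal_rv_def not_less intro: antisym)
    have uv: "blinfun_apply u (blinfun_apply \<Sigma> v) = 0" for u v :: "'a \<Rightarrow>\<^sub>L real"
      using z[of "u + v"] z[of u] z[of v] L(4)[of u v] by (simp add: blinfun.bilinear_simps)
    have "blinfun_apply \<Sigma> v = 0" for v
    proof -
      obtain u :: "'a \<Rightarrow>\<^sub>L real" where "blinfun_apply u (blinfun_apply \<Sigma> v) = norm (blinfun_apply \<Sigma> v)"
        using norming_functional[of "blinfun_apply \<Sigma> v"] by blast
      then show ?thesis using uv[of u v] by simp
    qed
    then have "\<Sigma> = 0" by (intro blinfun_eqI) simp
    with assms show False by simp
  qed
  then show thesis using that by blast
qed

theorem corollary2p2:
  fixes M :: "'b measure"
    and X :: "nat \<Rightarrow> 'b \<Rightarrow> 'a::{banach, second_countable_topology}"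
    and \<gamma> :: "'a measure"
    and \<Sigma> :: "('a \<Rightarrow>\<^sub>L real) \<Rightarrow>\<^sub>L 'a"
    and f :: "(('a \<Rightarrow>\<^sub>L real) \<Rightarrow>\<^sub>L 'a) \<Rightarrow> real"
    and f' :: "(('a \<Rightarrow>\<^sub>L real) \<Rightarrow>\<^sub>L 'a) \<Rightarrow> ((('a \<Rightarrow>\<^sub>L real) \<Rightarrow>\<^sub>L 'a) \<Rightarrow>\<^sub>L real)"
    and n :: nat and \<rho> C0 :: real
  assumes "prob_space M"
    and "n \<ge> 1"
    and "normal_law \<Sigma> \<gamma>"
    and "\<Sigma> \<noteq> 0"
    and "prob_space.indep_vars M (\<lambda>_. borel) X {1..n}"
    and "\<And>j. j \<in> {1..n} \<Longrightarrow> distr M borel (X j) = \<gamma>"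
    and "C0 > 0"
    and "effective_rank \<Sigma> \<gamma> \<le> C0 * real n"
    and "0 < \<rho>" and "\<rho> \<le> 1"
    and "\<And>A. (f has_derivative blinfun_apply (f' A)) (at A)"
    and "continuous_on UNIV f'"
    and "hoelder_condition \<rho> f'"
  shows "psi_norm M (1 / (1 + \<rho>))
           (\<lambda>\<omega>. f (sample_cov n X \<omega>) - f \<Sigma> - blinfun_apply (f' \<Sigma>) (sample_cov n X \<omega> - \<Sigma>))
         \<le> ennreal (remainder_const \<rho> C0 * lip_seminorm \<rho> f' * norm \<Sigma> powr (1 + \<rho>)
                      * sqrt (effective_rank \<Sigma> \<gamma> / real n) powr (1 + \<rho>))"
proof -
  note M = assms(1) and n = assms(2) and law = assms(3)
  note L = normal_law_facts[OF law]
  interpret prob_space M by fact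
  interpret G: prob_space \<gamma> by (rule L(1))
  obtain u0 where u0: "0 < blinfun_apply u0 (blinfun_apply \<Sigma> u0)"
    using normal_law_nondegenerate[OF law assms(4)] by blast
  define T where "T = (\<integral>x. (norm x)\<^sup>2 \<partial>\<gamma>)"
  define s where "s = norm \<Sigma>"
  define R where "R = effective_rank \<Sigma> \<gamma>"
  define y where "y = sqrt (R / real n)"
  define \<Lambda> where "\<Lambda> = lip_seminorm \<rho> f'"
  define D where "D \<omega> = norm (sample_cov n X \<omega> - \<Sigma>)" for \<omega>
  have np: "real n > 0" using n by simp
  have s: "0 < s" unfolding s_def using assms(4) by simp
  \<comment> \<open>A divergent integral would make \<open>T\<close> zero by default, and the
    claimed bound with it; so integrability comes first, and positivity follows by comparison with
    the variance of \<open>u0\<close>.\<close>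
  have T: "0 < T"
  proof -
    have iT: "integrable \<gamma> (\<lambda>x. (norm x)\<^sup>2)" by (rule normal_law_norm_square_integrable[OF law])
    have "blinfun_apply u0 (blinfun_apply \<Sigma> u0) = G.expectation (\<lambda>x. (blinfun_apply u0 x)\<^sup>2)"
      using G.normal_rv_moments(4)[OF L(3)[of u0]] by simp
    also have "\<dots> \<le> G.expectation (\<lambda>x. (norm u0)\<^sup>2 * (norm x)\<^sup>2)"
    proof (rule integral_mono)
      show "integrable \<gamma> (\<lambda>x. (blinfun_apply u0 x)\<^sup>2)"
        using G.normal_rv_moments(1)[OF L(3)[of u0], of 2] by simp
      show "(blinfun_apply u0 x)\<^sup>2 \<le> (norm u0)\<^sup>2 * (norm x)\<^sup>2" for x
        using power_mono[OF norm_blinfun[of u0 x], of 2] by (simp add: power_mult_distrib)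
    qed (use iT in simp)
    also have "\<dots> = (norm u0)\<^sup>2 * T" unfolding T_def by simp
    finally have "0 < (norm u0)\<^sup>2 * T" using u0 by simp
    then show ?thesis by (simp add: zero_less_mult_iff)
  qed
  have R: "R = T / s" unfolding R_def effective_rank_def T_def s_def ..
  have Rp: "0 < R" unfolding R using T s by simp
  have y: "0 < y" "y\<^sup>2 = R / n" unfolding y_def using Rp np by auto
  have yC: "y\<^sup>2 \<le> C0" using assms(8) np unfolding y R_def by (simp add: pos_divide_le_eq)
  \<comment> \<open>The sign of the real supremum is read off from one pair of distinct points, here
    \<open>\<Sigma>\<close> and 0.\<close>
  have \<Lambda>: "0 \<le> \<Lambda>"
  proof -
    have "0 \<le> \<Lambda> * norm (\<Sigma> - 0) powr \<rho>"
      unfolding \<Lambda>_def by (rule order_trans[OF norm_ge_zero lip_seminorm_bound[OF assms(13)]])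
    then show ?thesis using s unfolding s_def by (simp add: zero_le_mult_iff)
  qed
  \<comment> \<open>1200 from \<open>sample_cov_moments\<close> times the 10 in the estimate of
    \<open>2 + 5 * y\<close>; the moment norm of \<open>D\<close> of order \<open>r\<close> is then
    at most \<open>r * d\<close>.\<close>
  define d where "d = 12000 * (1 + C0) * (s * y)"
  have d: "0 < d" unfolding d_def using s y assms(7) by simp
  have Dm: "D \<in> borel_measurable M"
    using sample_cov_moments(1)[OF M n law assms(5,6) u0, of 1 0] unfolding D_def[abs_def] by simp
  have mom: "(\<integral>\<^sup>+\<omega>. ennreal (D \<omega> ^ r) \<partial>M) \<le> ennreal ((real r * d) ^ r)" if r: "r = 2 ^ k" for r k
  proof -
    have e1: "sqrt s * sqrt n * sqrt T / n = s * y"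
    proof -
      have "sqrt T = sqrt s * sqrt R" using R s by (simp add: real_sqrt_mult[symmetric])
      then have "sqrt s * sqrt n * sqrt T = s * (sqrt R * sqrt n)" using s by simp
      moreover have "sqrt R * sqrt n / n = y"
        unfolding y_def real_sqrt_divide using np real_div_sqrt[of "real n"] by (simp add: field_simps)
      ultimately show ?thesis by (metis times_divide_eq_right)
    qed
    have e2: "(sqrt T)\<^sup>2 / n = s * y\<^sup>2" unfolding y R using T s by simp
    have "1200 * real r * (2 * (sqrt s * sqrt n * sqrt T) + 5 * (sqrt T)\<^sup>2) / n
        = 1200 * real r * (2 * (sqrt s * sqrt n * sqrt T / n) + 5 * ((sqrt T)\<^sup>2 / n))"
      by (simp only: add_divide_distrib[symmetric] times_divide_eq_right)
    also have "\<dots> = 1200 * real r * (s * y * (2 + 5 * y))"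
      unfolding e1 e2 by (simp add: power2_eq_square algebra_simps)
    also have "\<dots> \<le> 1200 * real r * (s * y * (10 * (1 + C0)))"
    proof (intro mult_left_mono)
      \<comment> \<open>The place where the rank assumption acts:
        \<open>2 * y \<le> 1 + y\<^sup>2 \<le> 1 + C0\<close> lets the quadratic term in
        \<open>y\<close> be absorbed by the linear one.\<close>
      have "0 \<le> (y - 1)\<^sup>2" by simp
      then have "2 * y \<le> 1 + y\<^sup>2" by (simp add: power2_eq_square algebra_simps)
      then show "2 + 5 * y \<le> 10 * (1 + C0)" using yC assms(7) by simp
    qed (use s y in auto)
    also have "\<dots> = real r * d" unfolding d_def by simp
    finally have le: "1200 * real r * (2 * (sqrt s * sqrt n * sqrt T) + 5 * (sqrt T)\<^sup>2) / n \<le> real r * d" .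
    have "(\<integral>\<^sup>+\<omega>. ennreal (D \<omega> ^ r) \<partial>M) \<le> ennreal ((1200 * real r * (2 * (sqrt s * sqrt n * sqrt T) + 5 * (sqrt T)\<^sup>2) / n) ^ r)"
      using sample_cov_moments(2)[OF M n law assms(5,6) u0 r] unfolding D_def s_def T_def .
    also have "\<dots> \<le> ennreal ((real r * d) ^ r)"
      using le s T np by (intro ennreal_leI power_mono) auto
    finally show ?thesis .
  qed
  let ?\<eta> = "\<lambda>\<omega>. f (sample_cov n X \<omega>) - f \<Sigma> - blinfun_apply (f' \<Sigma>) (sample_cov n X \<omega> - \<Sigma>)"
  let ?r = "1 + \<rho>"
  have "ennreal (p powr (- 1 / (1 / ?r))) * Lp_norm M p ?\<eta> \<le> ennreal (\<Lambda> * (8 * d) powr ?r)" if p: "1 \<le> p" for p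
  proof -
    \<comment> \<open>The moment of order \<open>p\<close> of the remainder is one of order
      \<open>q\<close> of \<open>D\<close>. Since \<open>\<rho> \<le> 1\<close> gives
      \<open>q \<le> 2 * p\<close>, rounding to a power of two yields \<open>r \<le> 4 * p\<close>,
      the origin of \<open>4 * d\<close>.\<close>
    define q where "q = p * ?r"
    have q: "1 \<le> q" "q \<le> 2 * p" unfolding q_def using p assms(9,10) mult_mono[of 1 p 1 ?r] by auto
    obtain k where k: "q \<le> 2 ^ k" "2 ^ k \<le> 2 * q" using power_of_two_between[OF q(1)] by blast
    define r :: nat where "r = 2 ^ k"
    have r: "q \<le> real r" "real r \<le> 4 * p" unfolding r_def using k q by auto
    define c where "c = real r * d"
    have c: "0 < c" unfolding c_def r_def using d by simp
    have "(\<integral>\<^sup>+\<omega>. ennreal (\<bar>?\<eta> \<omega>\<bar> powr p) \<partial>M) \<le> (\<integral>\<^sup>+\<omega>. ennreal (\<Lambda> powr p) * ennreal (D \<omega> powr q) \<partial>M)"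
    proof (rule nn_integral_mono)
      fix \<omega>
      have "\<bar>?\<eta> \<omega>\<bar> powr p \<le> (\<Lambda> * D \<omega> powr ?r) powr p"
        unfolding D_def using p \<Lambda> taylor_remainder_bound[OF assms(11,13,9), of "sample_cov n X \<omega>" \<Sigma>]
        by (intro powr_mono2) (auto simp: \<Lambda>_def)
      also have "\<dots> = \<Lambda> powr p * D \<omega> powr q"
        using \<Lambda> by (simp add: powr_mult powr_powr q_def mult.commute)
      finally show "ennreal (\<bar>?\<eta> \<omega>\<bar> powr p) \<le> ennreal (\<Lambda> powr p) * ennreal (D \<omega> powr q)"
        by (simp add: ennreal_mult[symmetric] ennreal_leI)
    qed
    also have "\<dots> = ennreal (\<Lambda> powr p) * (\<integral>\<^sup>+\<omega>. ennreal (D \<omega> powr q) \<partial>M)"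
      using Dm by (intro nn_integral_cmult) measurable
    also have "\<dots> \<le> ennreal (\<Lambda> powr p) * ennreal (2 * c powr q)"
    proof (intro mult_left_mono nn_integral_powr_le[OF M Dm _ c _ r(1)])
      show "(\<integral>\<^sup>+\<omega>. ennreal (D \<omega> ^ r) \<partial>M) \<le> ennreal (c ^ r)"
        unfolding c_def by (rule mom[OF r_def])
    qed (use q in \<open>auto simp: D_def\<close>)
    also have "\<dots> = ennreal (\<Lambda> powr p * (2 * c powr q))" by (simp add: ennreal_mult[symmetric])
    finally have "Lp_norm M p ?\<eta> \<le> ennreal ((\<Lambda> powr p * (2 * c powr q)) powr (1 / p))"
      using p by (intro Lp_norm_le) auto
    also have "(\<Lambda> powr p * (2 * c powr q)) powr (1 / p) = \<Lambda> * (2 powr (1 / p) * c powr ?r)"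
      using p \<Lambda> c by (simp add: powr_mult powr_powr q_def)
    finally have "ennreal (p powr (- 1 / (1 / ?r))) * Lp_norm M p ?\<eta>
        \<le> ennreal (p powr (- ?r)) * ennreal (\<Lambda> * (2 powr (1 / p) * c powr ?r))"
      using assms(9) by (intro mult_mono) (auto intro!: ennreal_leI)
    also have "\<dots> = ennreal (\<Lambda> * (2 powr (1 / p) * (c / p) powr ?r))"
    proof -
      have "p powr (- ?r) * (\<Lambda> * (2 powr (1 / p) * c powr ?r)) = \<Lambda> * (2 powr (1 / p) * (c / p) powr ?r)"
        unfolding powr_minus_divide using p c by (simp add: powr_divide)
      then show ?thesis using \<Lambda> by (subst ennreal_mult[symmetric]) auto
    qed
    \<comment> \<open>The weight in the Orlicz norm has turned \<open>c\<close> into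
      \<open>c / p\<close>, which is bounded by \<open>4 * d\<close> uniformly in \<open>p\<close>.
      The interpolation factor is enlarged to \<open>2 powr ?r\<close> so that it merges with this
      power into \<open>8 * d\<close>.\<close>
    also have "\<dots> \<le> ennreal (\<Lambda> * (2 powr ?r * (4 * d) powr ?r))"
    proof (intro ennreal_leI mult_left_mono mult_mono \<Lambda>)
      have "1 / p \<le> 1" using p by simp
      also have "\<dots> \<le> ?r" using assms(9) by simp
      finally show "2 powr (1 / p) \<le> 2 powr ?r" by (intro powr_mono) auto
      have "c / p \<le> 4 * d" unfolding c_def using mult_right_mono[OF r(2), of d] d p by (simp add: pos_divide_le_eq mult_ac)
      then show "(c / p) powr ?r \<le> (4 * d) powr ?r" using c p assms(9) by (intro powr_mono2) auto
    qed auto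
    also have "2 powr ?r * (4 * d) powr ?r = (8 * d) powr ?r" using d by (simp add: powr_mult[symmetric])
    finally show ?thesis .
  qed
  then have "psi_norm M (1 / ?r) ?\<eta> \<le> ennreal (\<Lambda> * (8 * d) powr ?r)"
    unfolding psi_norm_def by (intro SUP_least) auto
  also have "\<dots> \<le> ennreal (remainder_const \<rho> C0 * \<Lambda> * s powr ?r * y powr ?r)"
  proof (rule ennreal_leI)
    \<comment> \<open>\<open>8 * 12000 = 96000\<close>, rounded up to \<open>10 ^ 6\<close>.\<close>
    have "8 * d \<le> (10 ^ 6 * (1 + C0)) * (s * y)"
      unfolding d_def using s y assms(7) by simp
    then have "(8 * d) powr ?r \<le> ((10 ^ 6 * (1 + C0)) * (s * y)) powr ?r"
      using d assms(9) by (intro powr_mono2) auto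
    also have "\<dots> = remainder_const \<rho> C0 * (s powr ?r * y powr ?r)"
      unfolding remainder_const_def using s y assms(7) by (simp only: powr_mult)
    finally have "\<Lambda> * (8 * d) powr ?r \<le> \<Lambda> * (remainder_const \<rho> C0 * (s powr ?r * y powr ?r))"
      using \<Lambda> by (rule mult_left_mono)
    then show "\<Lambda> * (8 * d) powr ?r \<le> remainder_const \<rho> C0 * \<Lambda> * s powr ?r * y powr ?r"
      by (simp only: mult_ac)
  qed
  finally show ?thesis
    unfolding s_def y_def R_def \<Lambda>_def .
qed

end
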